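(* Let $G=\langle a,t\mid r\rangle$ where $r$ is a cyclically reduced word in the free group $F(a,t)$ of length at most 12, $r$ has exponent sum $0$ in $t$, and $r$ is not a power of $a$. Then $G$ is not large if and only if either (i) up to cyclic permutation of $r$ or of $r^{-1}$ and replacing either generator by its inverse, $r$ is one of the following 13 words: 1. $t a^2 t^{-1} a t a t^{-1} a$; 2. $t a^2 t^{-1} a t a^{-1} t^{-1} a^{-1}$; 3. $t a^2 t^{-1} a^{-1} t a t^{-1} a^{-1}$; 4. $t a^2 t^{-1} a^2 t a^2 t^{-1} a$; 5. $t a^2 t^{-1} a^2 t a t^{-1} a^2$; 6. $t a^2 t^{-1} a^2 t a^{-1} t^{-1} a^{-2}$; 7. $t a^2 t^{-1} a^2 t a^{-2} t^{-1} a^{-1}$; 8. $t a^2 t^{-1} a t a^{-2} t^{-1} a^{-2}$; 9. $t a^2 t^{-1} a^{-1} t a^2 t^{-1} a^{-2}$; 10. $t a^2 t^{-1} a^{-2} t a t^{-1} a^{-2}$; 11. $t a^3 t^{-1} a t a^2 t^{-1} a$; 12. $t a^3 t^{-1} a t a^{-2} t^{-1} a^{-1}$; 13. $t a^3 t^{-1} a^{-1} t a^2 t^{-1} a^{-1}$; or (ii) the presentation is of the form $\langle a,t\mid ta^pt^{-1}=a^q\rangle$ with $p,q$ coprime integers.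
   Context: A group is large if it has a finite index subgroup admitting a surjective homomorphism onto a non-abelian free group. Word length is length in the free group on $a,t$. (A presentation with relator having exponent sum 0 in one generator is said to be in Magnus form with respect to that generator.) *)

theory Defs
  imports "HOL-Algebra.Algebra"
begin

text \<open>A letter over an alphabet of type 'x is a pair (x, b); b = True means the
  generator x, b = False means its inverse x^-1.\<close>

type_synonym 'x letter = "'x \<times> bool"

definition inv_letter :: "'x letter \<Rightarrow> 'x letter" where
  "inv_letter l = (fst l, \<not> snd l)"

definition inv_word :: "'x letter list \<Rightarrow> 'x letter list" where
  "inv_word w = rev (map inv_letter w)"

fun reduce :: "'x letter list \<Rightarrow> 'x letter list" where
  "reduce [] = []"
| "reduce (l # w) = (case reduce w of [] \<Rightarrow> [l]
      | m # u \<Rightarrow> (if m = inv_letter l then u else l # m # u))"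

definition reduced :: "'x letter list \<Rightarrow> bool" where
  "reduced w \<longleftrightarrow> (\<forall>i. Suc i < length w \<longrightarrow> w ! Suc i \<noteq> inv_letter (w ! i))"

definition cyclically_reduced :: "'x letter list \<Rightarrow> bool" where
  "cyclically_reduced w \<longleftrightarrow> reduced w \<and> (w \<noteq> [] \<longrightarrow> last w \<noteq> inv_letter (hd w))"

definition free_group :: "'x set \<Rightarrow> ('x letter list) monoid" where
  "free_group S = \<lparr> carrier = {w. reduced w \<and> fst ` set w \<subseteq> S},
                    monoid.mult = (\<lambda>u v. reduce (u @ v)), monoid.one = [] \<rparr>"

datatype gen = Ga | Gt

abbreviation F2 :: "(gen letter list) monoid" where
  "F2 \<equiv> free_group UNIV"

definition normal_closure :: "('a, 'b) monoid_scheme \<Rightarrow> 'a set \<Rightarrow> 'a set" where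
  "normal_closure G S =
     generate G {g \<otimes>\<^bsub>G\<^esub> s \<otimes>\<^bsub>G\<^esub> inv\<^bsub>G\<^esub> g | g s. g \<in> carrier G \<and> s \<in> S}"

definition one_rel_group :: "gen letter list \<Rightarrow> (gen letter list set) monoid" where
  "one_rel_group r = F2 Mod (normal_closure F2 {r})"

text \<open>G is large if some finite index subgroup surjects onto a non-abelian free group,
  i.e. a free group of rank at least 2.  (Bases are taken inside nat; every group
  considered here is countable, so this loses nothing.)\<close>
definition large :: "('g, 'b) monoid_scheme \<Rightarrow> bool" where
  "large G \<longleftrightarrow> (\<exists>H. subgroup H G \<and> finite (rcosets\<^bsub>G\<^esub> H) \<and>
      (\<exists>B :: nat set. (\<exists>x\<in>B. \<exists>y\<in>B. x \<noteq> y) \<and>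
         (\<exists>h. h \<in> hom (G\<lparr>carrier := H\<rparr>) (free_group B) \<and> h ` H = carrier (free_group B))))"

definition t_exp_sum :: "gen letter list \<Rightarrow> int" where
  "t_exp_sum w = (\<Sum>l\<leftarrow>w. if fst l = Gt then (if snd l then 1 else -1) else 0)"

definition apow :: "int \<Rightarrow> gen letter list" where
  "apow n = replicate (nat \<bar>n\<bar>) (Ga, n \<ge> 0)"

definition is_power_of_a :: "gen letter list \<Rightarrow> bool" where
  "is_power_of_a w \<longleftrightarrow> (\<exists>n. w = apow n)"

abbreviation tw :: "gen letter list" where "tw \<equiv> [(Gt, True)]"
abbreviation tiw :: "gen letter list" where "tiw \<equiv> [(Gt, False)]"

definition invert_gens :: "bool \<Rightarrow> bool \<Rightarrow> gen letter list \<Rightarrow> gen letter list" where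
  "invert_gens ea et w =
     map (\<lambda>(g, b). (g, if (g = Ga \<and> ea) \<or> (g = Gt \<and> et) then \<not> b else b)) w"

definition equiv_word :: "gen letter list \<Rightarrow> gen letter list \<Rightarrow> bool" where
  "equiv_word r w \<longleftrightarrow> (\<exists>s \<in> {r, inv_word r}. \<exists>k ea et. rotate k (invert_gens ea et s) = w)"

definition exceptional_words :: "gen letter list list" where
  "exceptional_words = [
     tw @ apow 2 @ tiw @ apow 1 @ tw @ apow 1 @ tiw @ apow 1,
     tw @ apow 2 @ tiw @ apow 1 @ tw @ apow (-1) @ tiw @ apow (-1),
     tw @ apow 2 @ tiw @ apow (-1) @ tw @ apow 1 @ tiw @ apow (-1),
     tw @ apow 2 @ tiw @ apow 2 @ tw @ apow 2 @ tiw @ apow 1,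
     tw @ apow 2 @ tiw @ apow 2 @ tw @ apow 1 @ tiw @ apow 2,
     tw @ apow 2 @ tiw @ apow 2 @ tw @ apow (-1) @ tiw @ apow (-2),
     tw @ apow 2 @ tiw @ apow 2 @ tw @ apow (-2) @ tiw @ apow (-1),
     tw @ apow 2 @ tiw @ apow 1 @ tw @ apow (-2) @ tiw @ apow (-2),
     tw @ apow 2 @ tiw @ apow (-1) @ tw @ apow 2 @ tiw @ apow (-2),
     tw @ apow 2 @ tiw @ apow (-2) @ tw @ apow 1 @ tiw @ apow (-2),
     tw @ apow 3 @ tiw @ apow 1 @ tw @ apow 2 @ tiw @ apow 1,
     tw @ apow 3 @ tiw @ apow 1 @ tw @ apow (-2) @ tiw @ apow (-1),
     tw @ apow 3 @ tiw @ apow (-1) @ tw @ apow 2 @ tiw @ apow (-1)]"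

text \<open>The relator of  t a^p t^-1 = a^q, i.e. t a^p t^-1 a^-q.\<close>
definition bs_word :: "int \<Rightarrow> int \<Rightarrow> gen letter list" where
  "bs_word p q = tw @ apow p @ tiw @ apow (- q)"

end

theory Submission
  imports Defs "HOL-Number_Theory.Residues"
begin

text \<open>Write G for the one-relator group of r and b for t a t^-1.

  Non-largeness of the listed groups: in every finite quotient the images of a and b have the same
  order, and the relation then forces b into the subgroup generated by a, either because a and b are
  coprime powers of a common element, or by the argument that n divides (i+1)^n - i^n only for n = 1.
  So every finite quotient is metabelian, whereas a large group has a finite quotient with S_4 as a
  section.

  Largeness of all other groups: a finite permutation representation of F(a,t) whose edges carry
  labels in a free group, such that r reads the trivial label around every point, is the same as a
  homomorphism from a finite index subgroup of G to that free group. Up to the symmetries of the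
  statement and the substitutions t -> t a^k, the 3238 relators that remain are killed by 260 such
  representations. Most of them arise, as in Howie's criterion, from a finite index subgroup H with a
  character H -> Z for which the Alexander polynomial vanishes modulo a prime p: this gives a map from
  H to an HNN extension of (Z/p)^K by the shift, a virtually free group, here given by its action on
  the digit vectors of length K.\<close>

section \<open>Reduced words and free groups\<close>

text \<open>Vanishing of the Alexander polynomial mod p gives a map from H onto the lamplighter
  group Z/p wr Z. This group is the direct limit, for K to infinity, of the HNN extensions in which
  a commutes only with its conjugates by t^i for i < K; as H is finitely presented, the map lifts to
  some finite K. The base group (Z/p)^K, generated by the t^-i a t^i with 0 \<le> i < K, acts
  regularly on the digit vectors and has trivial labels. So the stabiliser of a vector meets all
  conjugates of the base group trivially and acts freely on the Bass-Serre tree. The quotient graph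
  has one vertex and p loops, one for each value of the digit that t carries around, so the
  stabiliser is free of rank p; \<open>lamp\<close> passes to rank 2 by giving all nonzero values
  the same letter. Non-largeness is tested in finite quotients because there b in the subgroup
  generated by a already makes t normalise this subgroup: an injective map of a finite set into
  itself is onto. Commutators then lie in a cyclic group.\<close>

lemma inv_letter_inv_letter [simp]: "inv_letter (inv_letter l) = l"
  by (simp add: inv_letter_def)

lemma inv_letter_neq [simp]: "inv_letter l \<noteq> l" "l \<noteq> inv_letter l"
  by (metis inv_letter_def snd_conv)+

lemma fst_inv_letter [simp]: "fst (inv_letter l) = fst l"
  by (simp add: inv_letter_def)

lemma inv_word_Nil [simp]: "inv_word [] = []"
  by (simp add: inv_word_def)

lemma inv_word_Cons: "inv_word (l # w) = inv_word w @ [inv_letter l]"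
  by (simp add: inv_word_def)

lemma inv_word_append: "inv_word (u @ v) = inv_word v @ inv_word u"
  by (simp add: inv_word_def)

lemma inv_word_inv_word [simp]: "inv_word (inv_word w) = w"
  by (simp add: inv_word_def rev_map o_def)

lemma set_inv_word [simp]: "fst ` set (inv_word w) = fst ` set w"
  by (force simp: inv_word_def image_iff)

text \<open>One step of \<open>reduce\<close>, as a function of the already reduced tail. On reduced
  words, \<open>cons_red l\<close> and \<open>cons_red (inv_letter l)\<close> are inverse to each
  other, and all cancellation arguments rest on this.\<close>

definition cons_red :: "'x letter \<Rightarrow> 'x letter list \<Rightarrow> 'x letter list" where
  "cons_red l w = (case w of [] \<Rightarrow> [l] | m # u \<Rightarrow> (if m = inv_letter l then u else l # m # u))"

lemma reduce_Cons: "reduce (l # w) = cons_red l (reduce w)"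
  by (simp add: cons_red_def)

lemma reduced_Nil [simp]: "reduced []"
  by (simp add: reduced_def)

lemma reduced_single [simp]: "reduced [l]"
  by (simp add: reduced_def)

lemma reduced_Cons_Cons [simp]:
  "reduced (l # m # w) \<longleftrightarrow> m \<noteq> inv_letter l \<and> reduced (m # w)"
  unfolding reduced_def by (auto simp: nth_Cons split: nat.splits)

lemma reduced_tl: "reduced (l # w) \<Longrightarrow> reduced w"
  by (cases w) auto

lemma reduced_cons_red: "reduced w \<Longrightarrow> reduced (cons_red l w)"
  by (cases w) (auto simp: cons_red_def dest: reduced_tl)

lemma reduced_reduce [simp]: "reduced (reduce w)"
  by (induction w) (simp_all add: reduce_Cons reduced_cons_red del: reduce.simps(2))

lemma reduce_reduced: "reduced w \<Longrightarrow> reduce w = w"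
proof (induction w)
  case (Cons l w)
  then show ?case by (cases w) (auto simp: reduce_Cons cons_red_def simp del: reduce.simps(2))
qed simp

lemma cons_red_inv: "reduced w \<Longrightarrow> cons_red (inv_letter l) (cons_red l w) = w"
  by (cases w; cases "tl w") (auto simp: cons_red_def)

lemma reduce_append_reduce_right: "reduce (u @ reduce v) = reduce (u @ v)"
  by (induction u) (simp_all add: reduce_Cons reduce_reduced del: reduce.simps(2))

lemma reduce_cons_red_append: "reduced w \<Longrightarrow> reduce (cons_red l w @ v) = cons_red l (reduce (w @ v))"
proof (cases w)
  case (Cons m u)
  show ?thesis
  proof (cases "m = inv_letter l")
    case True
    then show ?thesis
      using Cons cons_red_inv[of "reduce (u @ v)" "inv_letter l"]
      by (simp add: reduce_Cons cons_red_def[of l "inv_letter l # u"] del: reduce.simps(2))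
  qed (use Cons in \<open>simp add: reduce_Cons cons_red_def[of l "m # u"] del: reduce.simps(2)\<close>)
qed (simp add: reduce_Cons cons_red_def[of l "[]"] del: reduce.simps(2))

lemma reduce_append_reduce_left: "reduce (reduce u @ v) = reduce (u @ v)"
  by (induction u) (simp_all add: reduce_Cons reduce_cons_red_append reduce_reduced del: reduce.simps(2))

lemma reduce_inv_word_left: "reduce (inv_word w @ w) = []"
proof (induction w)
  case (Cons l w)
  have "reduce (inv_letter l # l # w) = reduce w"
    by (simp add: reduce_Cons cons_red_inv del: reduce.simps(2))
  then have "reduce (inv_word w @ inv_letter l # l # w) = reduce (inv_word w @ w)"
    by (metis reduce_append_reduce_right)
  with Cons show ?case by (simp add: inv_word_Cons)
qed simp

lemma reduce_inv_word_right: "reduce (w @ inv_word w) = []"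
  using reduce_inv_word_left[of "inv_word w"] by simp

lemma set_reduce: "set (reduce w) \<subseteq> set w"
proof (induction w)
  case (Cons l w)
  then show ?case by (auto simp: reduce_Cons cons_red_def simp del: reduce.simps(2) split: list.splits if_splits)
qed simp

lemma reduced_inv_word: "reduced w \<Longrightarrow> reduced (inv_word w)"
proof -
  assume r: "reduced w"
  show ?thesis
    unfolding reduced_def
  proof (intro allI impI notI)
    fix i assume i: "Suc i < length (inv_word w)" 
      and e: "inv_word w ! Suc i = inv_letter (inv_word w ! i)"
    have l: "length (inv_word w) = length w" by (simp add: inv_word_def)
    let ?j = "length w - Suc (Suc i)"
    have "inv_word w ! Suc i = inv_letter (w ! ?j)" "inv_word w ! i = inv_letter (w ! Suc ?j)"
      using i l by (auto simp: inv_word_def rev_nth Suc_diff_Suc)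
    then have "w ! Suc ?j = inv_letter (w ! ?j)" using e by simp
    moreover have "Suc ?j < length w" using i l by auto
    ultimately show False using r unfolding reduced_def by blast
  qed
qed

lemma carrier_free_group: "carrier (free_group S) = {w. reduced w \<and> fst ` set w \<subseteq> S}"
  by (simp add: free_group_def)

lemma mult_free_group [simp]: "u \<otimes>\<^bsub>free_group S\<^esub> v = reduce (u @ v)"
  by (simp add: free_group_def)

lemma one_free_group [simp]: "\<one>\<^bsub>free_group S\<^esub> = []"
  by (simp add: free_group_def)

text \<open>Associativity holds because both bracketings reduce the same concatenation: reduction
  may be carried out inside either factor first.\<close>

lemma group_free_group: "group (free_group S)"
proof (rule groupI)
  fix x y assume "x \<in> carrier (free_group S)" "y \<in> carrier (free_group S)"
  then have "fst ` set (reduce (x @ y)) \<subseteq> S"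
    using image_mono[OF set_reduce[of "x @ y"], of fst]
    unfolding carrier_free_group set_append image_Un by blast
  then show "x \<otimes>\<^bsub>free_group S\<^esub> y \<in> carrier (free_group S)"
    by (simp add: carrier_free_group)
next
  fix x assume "x \<in> carrier (free_group S)"
  then show "\<exists>y\<in>carrier (free_group S). y \<otimes>\<^bsub>free_group S\<^esub> x = \<one>\<^bsub>free_group S\<^esub>"
    by (intro bexI[of _ "inv_word x"])
       (simp_all add: carrier_free_group reduce_inv_word_left reduced_inv_word)
qed (auto simp: carrier_free_group reduce_reduced reduce_append_reduce_left reduce_append_reduce_right)

lemma inv_free_group:
  assumes "w \<in> carrier (free_group S)"
  shows "inv\<^bsub>free_group S\<^esub> w = inv_word w"
proof (rule group.inv_equality[OF group_free_group])
  show "inv_word w \<in> carrier (free_group S)"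
    using assms by (simp add: carrier_free_group reduced_inv_word)
qed (use assms in \<open>simp_all add: reduce_inv_word_left\<close>)

section \<open>Labelled actions\<close>

text \<open>A machine reads letters over 'i, moves a state in 'p and writes words over 'o: a permutation
  representation with edge labels in a free group.\<close>

type_synonym ('i, 'p, 'o) machine = "'i letter \<Rightarrow> 'p \<Rightarrow> 'p \<times> 'o letter list"

fun run :: "('i, 'p, 'o) machine \<Rightarrow> 'i letter list \<Rightarrow> 'p \<Rightarrow> 'p \<times> 'o letter list" where
  "run M [] p = (p, [])"
| "run M (l # w) p = (case M l p of (q, u) \<Rightarrow> case run M w q of (q', v) \<Rightarrow> (q', reduce (u @ v)))"

text \<open>The inverse letter goes back along the same edge and writes the inverse label. Hence
  every letter permutes \<open>S\<close>, and the words act from the right.\<close>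

definition is_machine :: "('i, 'p, 'o) machine \<Rightarrow> 'p set \<Rightarrow> bool" where
  "is_machine M S \<longleftrightarrow> (\<forall>l. \<forall>p\<in>S. fst (M l p) \<in> S \<and>
     M (inv_letter l) (fst (M l p)) = (p, inv_word (snd (M l p))))"

definition kills :: "('i, 'p, 'o) machine \<Rightarrow> 'p set \<Rightarrow> 'i letter list \<Rightarrow> bool" where
  "kills M S r \<longleftrightarrow> (\<forall>p\<in>S. run M r p = (p, []))"

declare reduce.simps(2) [simp del]

lemma is_machine_fst: "is_machine M S \<Longrightarrow> p \<in> S \<Longrightarrow> fst (M l p) \<in> S"
  unfolding is_machine_def by blast

lemma reduced_snd_run: "reduced (snd (run M w p))"
  by (cases w) (auto split: prod.splits)

lemma run_append:
  "run M (u @ v) p = (case run M u p of (q, U) \<Rightarrow> case run M v q of (q', V) \<Rightarrow> (q', reduce (U @ V)))"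
proof (induction u arbitrary: p)
  case Nil
  then show ?case
    using reduced_snd_run[of M v p] by (auto simp: reduce_reduced split: prod.splits)
next
  case (Cons l u)
  then show ?case
    by (auto simp: reduce_append_reduce_left reduce_append_reduce_right split: prod.splits)
qed

lemma fst_run_in: "is_machine M S \<Longrightarrow> p \<in> S \<Longrightarrow> fst (run M w p) \<in> S"
proof (induction w arbitrary: p)
  case (Cons l w)
  then have "fst (M l p) \<in> S" by (simp add: is_machine_fst)
  with Cons.IH Cons.prems show ?case by (simp add: case_prod_unfold)
qed simp

lemma run_inv_word:
  assumes "is_machine M S"
  shows "p \<in> S \<Longrightarrow> run M (inv_word w) (fst (run M w p)) = (p, inv_word (snd (run M w p)))"
proof (induction w arbitrary: p)
  case (Cons l w)
  obtain q u where 1: "M l p = (q, u)" by force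
  obtain q' v where 2: "run M w q = (q', v)" by force
  have q: "q \<in> S" and 3: "M (inv_letter l) q = (p, inv_word u)"
    using assms Cons.prems 1 unfolding is_machine_def by (metis fst_conv snd_conv)+
  have "run M (inv_word w) q' = (q, inv_word v)"
    using Cons.IH[OF q] 2 by simp
  \<comment> \<open>Both sides are the inverse of the same element of the free group. The
    calculation inserts \<open>(u @ v) @ inv_word (u @ v)\<close> and cancels its first half against
    the left factor.\<close>
  moreover have "reduce (inv_word v @ inv_word u) = inv_word (reduce (u @ v))"
  proof -
    have "reduce (inv_word (reduce (u @ v))) = reduce (inv_word (reduce (u @ v)) @ (u @ v) @ inv_word (u @ v))"
      by (metis append_Nil2 reduce_append_reduce_right reduce_inv_word_right)
    also have "\<dots> = reduce ((inv_word (reduce (u @ v)) @ reduce (u @ v)) @ inv_word (u @ v))"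
      by (metis append_assoc reduce_append_reduce_left reduce_append_reduce_right)
    also have "\<dots> = reduce (inv_word (u @ v))"
      by (metis append_Nil reduce_append_reduce_left reduce_inv_word_left)
    finally show ?thesis
      by (simp add: inv_word_append reduce_reduced reduced_inv_word)
  qed
  ultimately show ?case
    by (simp add: inv_word_Cons run_append 1 2 3 reduce_append_reduce_right reduce_append_reduce_left)
qed simp

text \<open>A cancelling pair of letters walks along an edge and back, so it neither moves the point
  nor leaves a label. This makes \<open>run\<close> a function of the free group element, see
  \<open>run_reduce\<close>.\<close>

lemma run_cons_red:
  assumes "is_machine M S" "p \<in> S"
  shows "run M (cons_red l w) p = run M (l # w) p"
proof (cases w)
  case (Cons m u)
  show ?thesis
  proof (cases "m = inv_letter l")
    case True
    obtain q U where 1: "M l p = (q, U)" by force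
    then have 2: "M m q = (p, inv_word U)"
      using assms True unfolding is_machine_def by (metis fst_conv snd_conv)
    obtain q' V where 3: "run M u p = (q', V)" by force
    have "reduce (U @ inv_word U @ V) = V"
      using reduced_snd_run[of M u p] 3
      by (metis append.assoc append_Nil reduce_append_reduce_left reduce_inv_word_right reduce_reduced snd_conv)
    then show ?thesis
      using True Cons 1 2 3 by (simp add: cons_red_def reduce_append_reduce_right)
  qed (simp add: cons_red_def Cons)
qed (simp add: cons_red_def)

lemma run_reduce:
  assumes "is_machine M S"
  shows "p \<in> S \<Longrightarrow> run M (reduce w) p = run M w p"
proof (induction w arbitrary: p)
  case (Cons l w)
  have "fst (M l p) \<in> S" using assms Cons.prems by (simp add: is_machine_fst)
  with Cons.IH Cons.prems show ?case
    by (simp add: reduce_Cons run_cons_red[OF assms] case_prod_unfold)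
qed simp

lemma set_snd_run:
  assumes "is_machine M S" "\<And>l p. p \<in> S \<Longrightarrow> fst ` set (snd (M l p)) \<subseteq> B"
  shows "p \<in> S \<Longrightarrow> fst ` set (snd (run M w p)) \<subseteq> B"
proof (induction w arbitrary: p)
  case (Cons l w)
  obtain q u where 1: "M l p = (q, u)" by force
  obtain q' v where 2: "run M w q = (q', v)" by force
  have "q \<in> S" using assms(1) Cons.prems 1 unfolding is_machine_def by (metis fst_conv)
  then have "fst ` set v \<subseteq> B" using Cons.IH 2 by fastforce
  moreover have "fst ` set u \<subseteq> B" using assms(2) Cons.prems 1 by (metis snd_conv)
  ultimately have "fst ` set (u @ v) \<subseteq> B" by (simp add: image_Un)
  then show ?case using 1 2 image_mono[OF set_reduce[of "u @ v"], of fst] by simp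
qed simp

text \<open>The labels written by \<open>M\<close> are the input of \<open>M'\<close>. For the
  stabiliser of a point this composes its label homomorphism with a labelled action of the target
  free group.\<close>

definition comp_machine :: "('i, 'p, 'j) machine \<Rightarrow> ('j, 'q, 'o) machine \<Rightarrow> ('i, 'p \<times> 'q, 'o) machine" where
  "comp_machine M M' l s = (case M l (fst s) of (p, u) \<Rightarrow> case run M' u (snd s) of (q, v) \<Rightarrow> ((p, q), v))"

lemma is_machine_comp:
  assumes "is_machine M S" "is_machine M' S'"
  shows "is_machine (comp_machine M M') (S \<times> S')"
  unfolding is_machine_def
proof (intro allI ballI)
  fix l s assume s: "s \<in> S \<times> S'"
  obtain p u where 1: "M l (fst s) = (p, u)" by force
  obtain q v where 2: "run M' u (snd s) = (q, v)" by force
  have 3: "p \<in> S" "M (inv_letter l) p = (fst s, inv_word u)"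
    using s assms(1) 1 unfolding is_machine_def by (metis fst_conv mem_Times_iff snd_conv)+
  have 4: "q \<in> S'" "run M' (inv_word u) q = (snd s, inv_word v)"
    using fst_run_in[OF assms(2), of "snd s" u] run_inv_word[OF assms(2), of "snd s" u] s 2 by auto
  show "fst (comp_machine M M' l s) \<in> S \<times> S' \<and>
     comp_machine M M' (inv_letter l) (fst (comp_machine M M' l s)) =
       (s, inv_word (snd (comp_machine M M' l s)))"
    by (simp add: comp_machine_def 1 2 3 4)
qed

lemma run_comp:
  assumes "is_machine M S" "is_machine M' S'"
  shows "p \<in> S \<Longrightarrow> q \<in> S' \<Longrightarrow> run (comp_machine M M') w (p, q) =
    (case run M w p of (p', u) \<Rightarrow> case run M' u q of (q', v) \<Rightarrow> ((p', q'), v))"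
proof (induction w arbitrary: p q)
  case (Cons l w)
  obtain p1 u1 where 1: "M l p = (p1, u1)" by force
  obtain q1 v1 where 2: "run M' u1 q = (q1, v1)" by force
  have "p1 \<in> S" using Cons.prems assms(1) 1 unfolding is_machine_def by (metis fst_conv)
  moreover have "q1 \<in> S'" using fst_run_in[OF assms(2), of q u1] Cons.prems 2 by auto
  ultimately have IH: "run (comp_machine M M') w (p1, q1) =
      (case run M w p1 of (p', u) \<Rightarrow> case run M' u q1 of (q', v) \<Rightarrow> ((p', q'), v))"
    by (rule Cons.IH)
  obtain p2 u2 where 3: "run M w p1 = (p2, u2)" by force
  obtain q2 v2 where 4: "run M' u2 q1 = (q2, v2)" by force
  have "run M' (reduce (u1 @ u2)) q = (q2, reduce (v1 @ v2))"
    using Cons.prems by (simp add: run_reduce[OF assms(2)] run_append 2 4)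
  moreover have "comp_machine M M' l (p, q) = ((p1, q1), v1)"
    by (simp add: comp_machine_def 1 2)
  ultimately show ?case using IH by (simp add: 1 3 4)
qed simp

section \<open>Large groups from labelled actions\<close>

lemma free_group_UNIV_carrier [simp]: "w \<in> carrier (free_group UNIV) \<longleftrightarrow> reduced w"
  by (simp add: carrier_free_group)

lemma normal_normal_closure:
  assumes "group G" "S \<subseteq> carrier G"
  shows "normal_closure G S \<lhd> G"
  unfolding normal_closure_def
proof (rule group.normal_generateI[OF assms(1)])
  interpret group G by fact
  show "{g \<otimes>\<^bsub>G\<^esub> s \<otimes>\<^bsub>G\<^esub> inv\<^bsub>G\<^esub> g | g s. g \<in> carrier G \<and> s \<in> S} \<subseteq> carrier G"
    using assms(2) by auto
  fix h g assume h: "h \<in> {g \<otimes>\<^bsub>G\<^esub> s \<otimes>\<^bsub>G\<^esub> inv\<^bsub>G\<^esub> g | g s. g \<in> carrier G \<and> s \<in> S}" and g: "g \<in> carrier G"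
  then obtain k s where k: "k \<in> carrier G" "s \<in> S" "h = k \<otimes>\<^bsub>G\<^esub> s \<otimes>\<^bsub>G\<^esub> inv\<^bsub>G\<^esub> k" by auto
  moreover have "s \<in> carrier G" using k assms(2) by auto
  ultimately have "g \<otimes>\<^bsub>G\<^esub> h \<otimes>\<^bsub>G\<^esub> inv\<^bsub>G\<^esub> g = (g \<otimes>\<^bsub>G\<^esub> k) \<otimes>\<^bsub>G\<^esub> s \<otimes>\<^bsub>G\<^esub> inv\<^bsub>G\<^esub> (g \<otimes>\<^bsub>G\<^esub> k)"
    using g by (simp add: inv_mult_group m_assoc)
  then show "g \<otimes>\<^bsub>G\<^esub> h \<otimes>\<^bsub>G\<^esub> inv\<^bsub>G\<^esub> g \<in> {g \<otimes>\<^bsub>G\<^esub> s \<otimes>\<^bsub>G\<^esub> inv\<^bsub>G\<^esub> g | g s. g \<in> carrier G \<and> s \<in> S}"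
    using g k by (intro CollectI exI[of _ "g \<otimes>\<^bsub>G\<^esub> k"] exI[of _ s]) simp
qed

lemma normal_closure_subset:
  assumes "group G" "S \<subseteq> K" "K \<lhd> G"
  shows "normal_closure G S \<subseteq> K"
  unfolding normal_closure_def
proof (rule group.generate_subgroup_incl[OF assms(1)])
  show "subgroup K G" using assms(3) by (simp add: normal_imp_subgroup)
  show "{g \<otimes>\<^bsub>G\<^esub> s \<otimes>\<^bsub>G\<^esub> inv\<^bsub>G\<^esub> g |g s. g \<in> carrier G \<and> s \<in> S} \<subseteq> K"
    using assms(2) normal.inv_op_closed2[OF assms(3)] by blast
qed

text \<open>\<open>h\<close> is trivial on \<open>N\<close> and so descends to the image of
  \<open>H\<close> in the quotient. In the application \<open>e w\<close> is the point to which
  \<open>w\<close> moves the base point: equal values mean equal cosets of \<open>H\<close>, so the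
  finite range \<open>S\<close> bounds the index.\<close>

lemma large_quotient_free_group:
  fixes N :: "'x letter list set" and h :: "'x letter list \<Rightarrow> nat letter list"
  defines "F \<equiv> (free_group UNIV :: 'x letter list monoid)"
  assumes N: "N \<lhd> F" and H: "subgroup H F" and NH: "N \<subseteq> H"
    and fin: "finite S" and e: "\<And>w. w \<in> carrier F \<Longrightarrow> e w \<in> S"
    and eH: "\<And>u v. u \<in> carrier F \<Longrightarrow> v \<in> carrier F \<Longrightarrow> e u = e v \<Longrightarrow> u \<otimes>\<^bsub>F\<^esub> inv\<^bsub>F\<^esub> v \<in> H"
    and h: "h \<in> hom (F\<lparr>carrier := H\<rparr>) (free_group B)" and hN: "\<And>n. n \<in> N \<Longrightarrow> h n = []"
    and sur: "h ` H = carrier (free_group B)" and B: "x \<in> B" "y \<in> B" "x \<noteq> y"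
  shows "large (F Mod N)"
proof -
  interpret F: group F unfolding F_def by (rule group_free_group)
  interpret N: normal N F by fact
  interpret Q: group "F Mod N" by (rule N.factorgroup_is_group)
  interpret H: subgroup H F by fact
  interpret FB: group "free_group B" by (rule group_free_group)
  let ?q = "\<lambda>w. N #>\<^bsub>F\<^esub> w"
  interpret q: group_hom F "F Mod N" ?q
    by unfold_locales (simp add: N.r_coset_hom_Mod)
  have sub: "subgroup (?q ` H) (F Mod N)"
    using q.subgroup_img_is_subgroup[OF H] .
  have h_eq: "h u = h v" if "u \<in> H" "v \<in> H" "?q u = ?q v" for u v
  proof -
    have uv: "u \<in> carrier F" "v \<in> carrier F" using that by auto
    have "u \<in> ?q v" using that uv F.rcos_self[OF uv(1) N.subgroup_axioms] by simp
    then obtain n where n: "n \<in> N" "u = n \<otimes>\<^bsub>F\<^esub> v" by (auto simp: r_coset_def)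
    then have "h u = h n \<otimes>\<^bsub>free_group B\<^esub> h v"
      using hom_mult[OF h, of n v] NH that by auto
    moreover have "h v \<in> carrier (free_group B)" using sur that by blast
    ultimately show ?thesis using hN[OF n(1)] FB.l_one by simp
  qed
  \<comment> \<open>Two representatives in \<open>H\<close> of the same coset differ by an element
    of \<open>N\<close>, so by \<open>h_eq\<close> the choice does not matter.\<close>
  define h' where "h' C = h (SOME w. w \<in> H \<and> ?q w = C)" for C
  have h': "h' (?q w) = h w" if "w \<in> H" for w
    unfolding h'_def using someI[of "\<lambda>u. u \<in> H \<and> ?q u = ?q w" w] that
    by (intro h_eq) auto
  have "h' \<in> hom ((F Mod N)\<lparr>carrier := ?q ` H\<rparr>) (free_group B)"
  proof (rule homI)
    fix C assume "C \<in> carrier ((F Mod N)\<lparr>carrier := ?q ` H\<rparr>)"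
    then show "h' C \<in> carrier (free_group B)" using h' sur by auto
  next
    fix C D assume "C \<in> carrier ((F Mod N)\<lparr>carrier := ?q ` H\<rparr>)" "D \<in> carrier ((F Mod N)\<lparr>carrier := ?q ` H\<rparr>)"
    then obtain u v where uv: "u \<in> H" "v \<in> H" "C = ?q u" "D = ?q v" by auto
    have "C \<otimes>\<^bsub>F Mod N\<^esub> D = ?q (u \<otimes>\<^bsub>F\<^esub> v)" using uv q.hom_mult[of u v] by auto
    then have "h' (C \<otimes>\<^bsub>F Mod N\<^esub> D) = h (u \<otimes>\<^bsub>F\<^esub> v)"
      using h'[OF H.m_closed[OF uv(1,2)]] by (simp only:)
    also have "\<dots> = h u \<otimes>\<^bsub>free_group B\<^esub> h v"
      using hom_mult[OF h, of u v] uv(1,2) by simp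
    finally show "h' (C \<otimes>\<^bsub>(F Mod N)\<lparr>carrier := ?q ` H\<rparr>\<^esub> D) = h' C \<otimes>\<^bsub>free_group B\<^esub> h' D"
      using h'[OF uv(1)] h'[OF uv(2)] unfolding uv(3,4) by (simp del: mult_free_group)
  qed
  moreover have "h' ` (?q ` H) = carrier (free_group B)"
    using h' sur by (simp add: image_image)
  moreover have "finite (rcosets\<^bsub>F Mod N\<^esub> (?q ` H))"
  proof (rule finite_subset)
    \<comment> \<open>One representative word for each value of \<open>e\<close>; these represent
      all cosets of the image of \<open>H\<close>.\<close>
    define s where "s p = ?q ` H #>\<^bsub>F Mod N\<^esub> ?q (SOME w. w \<in> carrier F \<and> e w = p)" for p
    show "rcosets\<^bsub>F Mod N\<^esub> (?q ` H) \<subseteq> s ` S"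
    proof
      fix C assume "C \<in> rcosets\<^bsub>F Mod N\<^esub> (?q ` H)"
      then obtain w where w: "w \<in> carrier F" "C = ?q ` H #>\<^bsub>F Mod N\<^esub> ?q w"
        by (auto simp: RCOSETS_def FactGroup_def)
      define v where "v = (SOME u. u \<in> carrier F \<and> e u = e w)"
      have v: "v \<in> carrier F" "e v = e w"
        unfolding v_def using someI[of "\<lambda>u. u \<in> carrier F \<and> e u = e w" w] w by auto
      have "w \<otimes>\<^bsub>F\<^esub> inv\<^bsub>F\<^esub> v \<in> H" using eH w v by simp
      then have "?q w \<otimes>\<^bsub>F Mod N\<^esub> inv\<^bsub>F Mod N\<^esub> (?q v) \<in> ?q ` H"
        using w v by (simp only: q.hom_inv[symmetric] q.hom_mult[symmetric] F.inv_closed imageI)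
      then have "?q ` H #>\<^bsub>F Mod N\<^esub> (?q w \<otimes>\<^bsub>F Mod N\<^esub> inv\<^bsub>F Mod N\<^esub> (?q v)) = ?q ` H"
        using w v sub by (intro Q.coset_join2) auto
      then have "?q ` H #>\<^bsub>F Mod N\<^esub> ?q v = ?q ` H #>\<^bsub>F Mod N\<^esub>
          (?q w \<otimes>\<^bsub>F Mod N\<^esub> inv\<^bsub>F Mod N\<^esub> (?q v) \<otimes>\<^bsub>F Mod N\<^esub> ?q v)"
        using w v subgroup.subset[OF sub] by (metis Q.coset_mult_assoc Q.inv_closed Q.m_closed q.hom_closed)
      also have "?q w \<otimes>\<^bsub>F Mod N\<^esub> inv\<^bsub>F Mod N\<^esub> (?q v) \<otimes>\<^bsub>F Mod N\<^esub> ?q v = ?q w"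
        using q.hom_closed[OF w(1)] q.hom_closed[OF v(1)] by (simp only: Q.m_assoc Q.inv_closed Q.l_inv Q.r_one)
      finally have "C = ?q ` H #>\<^bsub>F Mod N\<^esub> ?q v" using w by simp
      then show "C \<in> s ` S" using e[OF w(1)] unfolding s_def v_def by blast
    qed
  qed (use fin in simp)
  ultimately show ?thesis
    unfolding large_def using sub B
    by (intro exI[of _ "?q ` H"] exI[of _ B] exI[of _ h'] conjI bexI[of _ x] bexI[of _ y]) assumption+
qed

text \<open>The two loops at a common point are preimages of the two free generators, which makes
  the label map of the stabiliser of that point surjective.\<close>

definition machine_witness :: "(gen, 'p, nat) machine \<Rightarrow> 'p set \<Rightarrow> gen letter list \<Rightarrow> bool" where
  "machine_witness M S r \<longleftrightarrow> is_machine M S \<and> finite S \<and> kills M S r \<and>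
     (\<forall>l. \<forall>p\<in>S. fst ` set (snd (M l p)) \<subseteq> {0, 1}) \<and>
     (\<exists>p\<in>S. \<exists>u v. run M u p = (p, [(0, True)]) \<and> run M v p = (p, [(1, True)]))"

theorem large_if_machine_witness:
  assumes "machine_witness M S r" and r: "reduced r"
  shows "large (one_rel_group r)"
proof -
  have m: "is_machine M S" and fin: "finite S" and k: "kills M S r"
    and lab: "\<And>l p. p \<in> S \<Longrightarrow> fst ` set (snd (M l p)) \<subseteq> {0, 1}"
    and ex: "\<exists>p\<in>S. \<exists>u v. run M u p = (p, [(0, True)]) \<and> run M v p = (p, [(1, True)])"
    using assms(1) by (simp_all only: machine_witness_def)
  from ex obtain p0 u v where p0: "p0 \<in> S"
    and u: "run M u p0 = (p0, [(0, True)])" and v: "run M v p0 = (p0, [(1, True)])"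
    by (elim bexE exE conjE)
  interpret F: group F2 by (rule group_free_group)
  \<comment> \<open>\<open>K\<close> is the kernel of the whole labelled action, hence normal:
    killing \<open>r\<close> at all points kills its normal closure. \<open>H\<close> is the
    stabiliser of \<open>p0\<close> and \<open>h\<close> its label homomorphism.\<close>
  define K where "K = {w \<in> carrier F2. kills M S w}"
  define H where "H = {w \<in> carrier F2. fst (run M w p0) = p0}"
  define h where "h w = snd (run M w p0)" for w
  have inv: "run M (inv\<^bsub>F2\<^esub> w) (fst (run M w p)) = (p, inv_word (snd (run M w p)))" 
    if "w \<in> carrier F2" "p \<in> S" for w p
    using that run_inv_word[OF m] by (simp add: inv_free_group)
  have mult: "run M (x \<otimes>\<^bsub>F2\<^esub> y) p = run M (x @ y) p" if "p \<in> S" for x y p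
    using that run_reduce[OF m] by simp
  have K: "K \<lhd> F2"
    unfolding F.normal_inv_iff
  proof (intro conjI ballI)
    show "subgroup K F2"
    proof (rule F.subgroupI)
      show "K \<noteq> {}" unfolding K_def kills_def by (auto intro!: exI[of _ "[]"])
      show "inv\<^bsub>F2\<^esub> w \<in> K" if "w \<in> K" for w
      proof -
        have "run M (inv\<^bsub>F2\<^esub> w) p = (p, [])" if "p \<in> S" for p
          using inv[of w p] \<open>w \<in> K\<close> that by (simp add: K_def kills_def)
        then show ?thesis using \<open>w \<in> K\<close> F.inv_closed unfolding K_def kills_def by blast
      qed
      show "x \<otimes>\<^bsub>F2\<^esub> y \<in> K" if "x \<in> K" "y \<in> K" for x y
        using that by (simp add: K_def kills_def run_reduce[OF m] run_append)
    qed (auto simp: K_def)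
    fix x w assume x: "x \<in> carrier F2" and w: "w \<in> K"
    have "run M (x \<otimes>\<^bsub>F2\<^esub> w \<otimes>\<^bsub>F2\<^esub> inv\<^bsub>F2\<^esub> x) p = (p, [])" if "p \<in> S" for p
    proof -
      obtain q U where X: "run M x p = (q, U)" by force
      then have q: "q \<in> S" using fst_run_in[OF m that, of x] by simp
      then have "run M w q = (q, [])" using w by (simp add: K_def kills_def)
      moreover have "run M (inv\<^bsub>F2\<^esub> x) q = (p, inv_word U)" using inv[OF x that] X by simp
      ultimately have "run M ((x @ w) @ inv\<^bsub>F2\<^esub> x) p = (p, [])"
        by (simp only: run_append X) (simp add: reduce_append_reduce_left reduce_inv_word_right)
      moreover have "x \<otimes>\<^bsub>F2\<^esub> w \<otimes>\<^bsub>F2\<^esub> inv\<^bsub>F2\<^esub> x = reduce ((x @ w) @ inv\<^bsub>F2\<^esub> x)"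
        by (simp only: mult_free_group reduce_append_reduce_left)
      ultimately show ?thesis
        using run_reduce[OF m that] by simp
    qed
    then show "x \<otimes>\<^bsub>F2\<^esub> w \<otimes>\<^bsub>F2\<^esub> inv\<^bsub>F2\<^esub> x \<in> K"
      using x w unfolding K_def kills_def by blast
  qed
  have NK: "normal_closure F2 {r} \<subseteq> K"
    using normal_closure_subset[OF F.group_axioms _ K] r k by (simp add: K_def)
  have KH: "K \<subseteq> H" using p0 by (auto simp: K_def H_def kills_def)
  have H: "subgroup H F2"
  proof (rule F.subgroupI)
    show "H \<noteq> {}" unfolding H_def by (auto intro!: exI[of _ "[]"])
    show "inv\<^bsub>F2\<^esub> w \<in> H" if "w \<in> H" for w
      using that inv[of w p0] p0 unfolding H_def by (metis (mono_tags, lifting) F.inv_closed fst_conv mem_Collect_eq)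
    show "x \<otimes>\<^bsub>F2\<^esub> y \<in> H" if "x \<in> H" "y \<in> H" for x y
      using that p0 by (simp add: H_def run_reduce[OF m] run_append case_prod_unfold)
  qed (auto simp: H_def)
  have h_closed: "h w \<in> carrier (free_group {0, 1})" for w
    using set_snd_run[OF m, of "{0, 1}" p0 w] lab p0 reduced_snd_run[of M w p0]
    by (simp add: h_def carrier_free_group)
  have hom: "h \<in> hom (F2\<lparr>carrier := H\<rparr>) (free_group {0, 1})"
    using h_closed p0
    by (intro homI) (simp_all add: H_def h_def run_reduce[OF m] run_append case_prod_unfold)
  have "h ` H = carrier (free_group {0, 1})"
  proof
    show "h ` H \<subseteq> carrier (free_group {0, 1})" using h_closed by auto
    \<comment> \<open>A preimage of \<open>w\<close> is put together letter by letter from the loops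
      \<open>u\<close>, \<open>v\<close> and their inverses.\<close>
    have "\<exists>x. reduced x \<and> run M x p0 = (p0, w)" if "reduced w" "fst ` set w \<subseteq> {0, 1}" for w
      using that
    proof (induction w)
      case Nil
      then show ?case by (auto intro!: exI[of _ "[]"])
    next
      case (Cons l w)
      then have "reduced w" by (blast dest: reduced_tl)
      with Cons obtain x where x: "reduced x" "run M x p0 = (p0, w)" by auto
      have "\<exists>y. run M y p0 = (p0, [l])"
      proof (cases l)
        case (Pair i b)
        then have "i = 0 \<or> i = 1" using Cons.prems by auto
        then obtain y where y: "run M y p0 = (p0, [(i, True)])" using u v by auto
        show ?thesis
        proof (cases b)
          case False
          then have "run M (inv_word y) p0 = (p0, [l])"
            using run_inv_word[OF m p0, of y] y Pair by (simp add: inv_word_def inv_letter_def)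
          then show ?thesis by blast
        qed (use y Pair in auto)
      qed
      then obtain y where "run M y p0 = (p0, [l])" by blast
      then have "run M (reduce (y @ x)) p0 = (p0, l # w)"
        using x Cons.prems by (simp add: run_reduce[OF m p0] run_append reduce_reduced)
      then show ?case by (metis reduced_reduce)
    qed
    then have "\<exists>x\<in>H. w = h x" if "w \<in> carrier (free_group {0, 1})" for w
      using that unfolding carrier_free_group h_def H_def by fastforce
    then show "carrier (free_group {0, 1}) \<subseteq> h ` H" by blast
  qed
  moreover have eH: "x \<otimes>\<^bsub>F2\<^esub> inv\<^bsub>F2\<^esub> y \<in> H"
    if "x \<in> carrier F2" "y \<in> carrier F2" "fst (run M x p0) = fst (run M y p0)" for x y
  proof -
    have "fst (run M (x \<otimes>\<^bsub>F2\<^esub> inv\<^bsub>F2\<^esub> y) p0) = p0"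
      using that inv[of y p0] p0 by (simp only: mult) (simp add: run_append case_prod_unfold)
    then show ?thesis
      unfolding H_def using that F.m_closed F.inv_closed by blast
  qed
  moreover have "h n = []" if "n \<in> normal_closure F2 {r}" for n
    using that NK p0 by (auto simp: K_def kills_def h_def)
  moreover have "normal_closure F2 {r} \<lhd> F2"
    using r by (intro normal_normal_closure group_free_group) simp
  moreover have "normal_closure F2 {r} \<subseteq> H" using NK KH by (rule order_trans)
  ultimately show ?thesis
    unfolding one_rel_group_def
    by (intro large_quotient_free_group[where H = H and S = S and e = "\<lambda>w. fst (run M w p0)"
          and h = h and B = "{0, 1}" and x = 0 and y = 1] H fin hom fst_run_in[OF m p0]) simp_all
qed

section \<open>Evaluating labelled actions\<close>

text \<open>Words in a, t are encoded by numerals whose base 4 digits, after a leading 1, are the letters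
  (0 = a, 1 = a^-1, 2 = t, 3 = t^-1), the first letter in the most significant place.\<close>

fun decn :: "num \<Rightarrow> gen letter list \<Rightarrow> gen letter list" where
  "decn num.One s = s"
| "decn (num.Bit0 (num.Bit0 k)) s = decn k ((Ga, True) # s)"
| "decn (num.Bit1 (num.Bit0 k)) s = decn k ((Ga, False) # s)"
| "decn (num.Bit0 (num.Bit1 k)) s = decn k ((Gt, True) # s)"
| "decn (num.Bit1 (num.Bit1 k)) s = decn k ((Gt, False) # s)"
| "decn (num.Bit0 num.One) s = s"
| "decn (num.Bit1 num.One) s = s"

definition wd :: "nat \<Rightarrow> gen letter list" where
  "wd n = decn (num_of_nat n) []"

lemma wd_1: "wd 1 = []"
  by (simp add: wd_def num_of_nat.simps)

lemma wd_numeral: "wd (numeral k) = decn k []"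
  by (simp add: wd_def num_of_nat_numeral_eq)

text \<open>This and the next three functions restate library notions by structural recursion, so
  that a certificate is checked by rewriting with defining equations alone.\<close>

fun upl :: "nat \<Rightarrow> 'a list \<Rightarrow> nat list" where
  "upl i [] = []"
| "upl i (x # xs) = i # upl (Suc i) xs"

lemma upl_eq: "upl i xs = [i..<i + length xs]"
  by (induction i xs rule: upl.induct) (auto simp: upt_rec)

fun mem :: "'a \<Rightarrow> 'a list \<Rightarrow> bool" where
  "mem x [] \<longleftrightarrow> False"
| "mem x (y # ys) \<longleftrightarrow> x = y \<or> mem x ys"

lemma mem_eq: "mem x xs \<longleftrightarrow> x \<in> set xs"
  by (induction xs) auto

fun sub :: "'a list \<Rightarrow> 'a list \<Rightarrow> bool" where
  "sub [] ys \<longleftrightarrow> True"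
| "sub (x # xs) ys \<longleftrightarrow> mem x ys \<and> sub xs ys"

lemma sub_eq: "sub xs ys \<longleftrightarrow> set xs \<subseteq> set ys"
  by (induction xs) (auto simp: mem_eq)

fun same_len :: "'a list \<Rightarrow> 'b list \<Rightarrow> bool" where
  "same_len [] [] \<longleftrightarrow> True"
| "same_len (x # xs) (y # ys) \<longleftrightarrow> same_len xs ys"
| "same_len [] (y # ys) \<longleftrightarrow> False"
| "same_len (x # xs) [] \<longleftrightarrow> False"

lemma same_len_eq: "same_len xs ys \<longleftrightarrow> length xs = length ys"
  by (induction xs ys rule: same_len.induct) auto

text \<open>A certificate is checked for every \<open>M\<close> with these equations. With
  \<open>M\<close> a variable they act as rewrite rules, so that neither list access nor the
  \<open>LEAST\<close> in \<open>table_machine\<close> is ever evaluated.\<close>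

fun tabs :: "(gen, nat, gen) machine \<Rightarrow> gen \<Rightarrow> nat list \<Rightarrow> nat list \<Rightarrow> nat list \<Rightarrow> bool" where
  "tabs M g (i # is) (q # qs) (u # us) \<longleftrightarrow>
     M (g, True) i = (q, wd u) \<and> M (g, False) q = (i, inv_word (wd u)) \<and> tabs M g is qs us"
| "tabs M g [] qs us \<longleftrightarrow> True"
| "tabs M g is [] us \<longleftrightarrow> True"
| "tabs M g is qs [] \<longleftrightarrow> True"

text \<open>Points count from 1, list positions from 0. The backward direction searches the
  preimage; the condition \<open>j \<ge> 1\<close> excludes \<open>j = 0\<close>, which by truncated
  subtraction would be an alias of point 1.\<close>

definition table_machine :: "(gen \<Rightarrow> nat list) \<Rightarrow> (gen \<Rightarrow> nat list) \<Rightarrow> (gen, nat, gen) machine" where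
  "table_machine Q U l i = (case l of (g, b) \<Rightarrow>
     if b then (Q g ! (i - 1), wd (U g ! (i - 1)))
     else let j = (LEAST j. Q g ! (j - 1) = i \<and> j \<ge> 1) in (j, inv_word (wd (U g ! (j - 1)))))"

lemma tabs_eq:
  "tabs M g is qs us \<longleftrightarrow> (\<forall>j < min (length is) (min (length qs) (length us)).
     M (g, True) (is ! j) = (qs ! j, wd (us ! j)) \<and> M (g, False) (qs ! j) = (is ! j, inv_word (wd (us ! j))))"
proof (induction M g "is" qs us rule: tabs.induct)
  case (1 M g i "is" q qs u us)
  then show ?case
    by (auto simp: nth_Cons less_Suc_eq_0_disj split: nat.splits)
qed auto

lemma table_machine:
  fixes n :: nat
  assumes "\<And>g. length (Q g) = n" "\<And>g. {1..n} \<subseteq> set (Q g)" "\<And>g. length (U g) = n"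
  shows "is_machine (table_machine Q U) {1..n}"
    and "tabs (table_machine Q U) g (upl 1 (Q g)) (Q g) (U g)"
proof -
  \<comment> \<open>A list of length n that contains each of 1..n is a permutation, by counting; so
    the static check of a certificate amounts to inclusions and lengths.\<close>
  have set: "set (Q g) = {1..n}" and dist: "distinct (Q g)" for g
  proof -
    have "card (set (Q g)) \<le> n" using card_length[of "Q g"] assms(1) by simp
    then show s: "set (Q g) = {1..n}"
      using card_subset_eq[OF _ assms(2)[of g]] card_mono[OF _ assms(2)[of g]] by fastforce
    then show "distinct (Q g)" using assms(1)[of g] by (intro card_distinct) simp
  qed
  have fw: "table_machine Q U (g, True) i = (Q g ! (i - 1), wd (U g ! (i - 1)))" for g i
    by (simp add: table_machine_def)
  have bw: "table_machine Q U (g, False) (Q g ! (i - 1)) = (i, inv_word (wd (U g ! (i - 1))))"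
    if "1 \<le> i" "i \<le> n" for g i
  proof -
    have "(LEAST j. Q g ! (j - 1) = Q g ! (i - 1) \<and> j \<ge> 1) = i"
    proof (rule Least_equality)
      fix j assume j: "Q g ! (j - 1) = Q g ! (i - 1) \<and> 1 \<le> j"
      show "i \<le> j"
      proof (rule ccontr)
        assume "\<not> i \<le> j"
        then have "j - 1 < length (Q g)" "i - 1 < length (Q g)"
          using that assms(1)[of g] by linarith+
        then have "j - 1 = i - 1" using j nth_eq_iff_index_eq[OF dist[of g]] by simp
        then show False using \<open>\<not> i \<le> j\<close> that j by linarith
      qed
    qed (use that in simp)
    then show ?thesis by (simp add: table_machine_def)
  qed
  show "is_machine (table_machine Q U) {1..n}"
    unfolding is_machine_def
  proof (intro allI ballI)
    fix l :: "gen letter" and p assume p: "p \<in> {1..n}"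
    obtain g b where l: "l = (g, b)" by force
    show "fst (table_machine Q U l p) \<in> {1..n} \<and> table_machine Q U (inv_letter l) (fst (table_machine Q U l p)) =
      (p, inv_word (snd (table_machine Q U l p)))"
    proof (cases b)
      case True
      have "Q g ! (p - 1) \<in> set (Q g)" using p assms(1)[of g] by (intro nth_mem) auto
      then show ?thesis using True l p set[of g] bw[of p g] by (simp add: fw inv_letter_def)
    next
      case False
      from p set[of g] have "p \<in> set (Q g)" by simp
      then obtain k where "k < n" "p = Q g ! k" using assms(1)[of g] by (auto simp: in_set_conv_nth)
      then have k: "p = Q g ! (Suc k - 1)" "1 \<le> Suc k" "Suc k \<le> n" by auto
      show ?thesis
        using False l k bw[of "Suc k" g] by (simp add: fw inv_letter_def)
    qed
  qed
  have "upl 1 (Q g) ! j = Suc j" if "j < n" for j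
    using that assms(1)[of g] by (simp add: upl_eq del: upt_Suc)
  then show "tabs (table_machine Q U) g (upl 1 (Q g)) (Q g) (U g)"
    unfolding tabs_eq using assms fw bw[of "Suc _" g]
    by (auto simp: upl_eq)
qed

text \<open>The word written so far is kept as a stack with its last letter on top, so that
  appending a letter with free cancellation takes one step.\<close>

fun cr :: "'x letter \<Rightarrow> 'x letter list \<Rightarrow> 'x letter list" where
  "cr x [] = [x]"
| "cr (g, b) ((g', b') # s) = (if g = g' then if b = b' then (g, b) # (g', b') # s else s else (g, b) # (g', b') # s)"

fun push :: "'x letter list \<Rightarrow> 'x letter list \<Rightarrow> 'x letter list" where
  "push [] s = s"
| "push (x # u) s = push u (cr x s)"

text \<open>\<open>run\<close> with an output stack. The detour through \<open>runB\<close> forces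
  \<open>M l p\<close> to become an explicit pair before the next letter is read.\<close>

fun runA :: "('i, 'p, 'o) machine \<Rightarrow> 'i letter list \<Rightarrow> 'p \<Rightarrow> 'o letter list \<Rightarrow> 'p \<times> 'o letter list"
  and runB :: "('i, 'p, 'o) machine \<Rightarrow> 'i letter list \<Rightarrow> 'p \<times> 'o letter list \<Rightarrow> 'o letter list \<Rightarrow> 'p \<times> 'o letter list" where
  "runA M [] p s = (p, s)"
| "runA M (l # w) p s = runB M w (M l p) s"
| "runB M w (q, u) s = runA M w q (push u s)"

lemma reduced_append_single:
  "reduced (w @ [x]) \<longleftrightarrow> reduced w \<and> (w \<noteq> [] \<longrightarrow> x \<noteq> inv_letter (last w))"
proof (induction w)
  case (Cons y w)
  then show ?case by (cases w) auto
qed simp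

lemma cr_eq: "reduced (rev s) \<Longrightarrow> cr x s = rev (reduce (rev s @ [x]))"
proof (cases s)
  case (Cons y s')
  assume r: "reduced (rev s)"
  obtain g b g' b' where xy: "x = (g, b)" "y = (g', b')" by force
  show ?thesis
  proof (cases "x = inv_letter y")
    case True
    have "reduce (rev s @ [x]) = reduce (rev s' @ [y] @ inv_word [y])"
      using Cons True by (simp add: inv_word_def)
    also have "\<dots> = reduce (rev s')"
      by (metis append_Nil2 reduce_append_reduce_right reduce_inv_word_right)
    also have "\<dots> = rev s'"
      using r Cons by (simp add: reduced_append_single reduce_reduced)
    finally show ?thesis using True Cons xy by (auto simp: inv_letter_def)
  next
    case False
    then have "reduced (rev s @ [x])"
      unfolding reduced_append_single[of "rev s" x] using r Cons by simp
    then show ?thesis using False Cons xy by (auto simp: reduce_reduced inv_letter_def)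
  qed
qed (simp add: reduce_reduced)

lemma push_eq: "reduced (rev s) \<Longrightarrow> push u s = rev (reduce (rev s @ u))"
proof (induction u arbitrary: s)
  case (Cons x u)
  have "push (x # u) s = rev (reduce (reduce (rev s @ [x]) @ u))"
    using Cons by (simp add: cr_eq)
  then show ?case by (simp add: reduce_append_reduce_left)
qed (simp add: reduce_reduced)

lemma runA_eq:
  "reduced (rev s) \<Longrightarrow> runA M w p s = (fst (run M w p), rev (reduce (rev s @ snd (run M w p))))"
proof (induction w arbitrary: p s)
  case (Cons l w)
  obtain q u where 1: "M l p = (q, u)" by force
  have "runA M (l # w) p s = runA M w q (rev (reduce (rev s @ u)))"
    using Cons.prems by (simp add: 1 push_eq)
  also have "\<dots> = (fst (run M w q), rev (reduce (reduce (rev s @ u) @ snd (run M w q))))"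
    by (subst Cons.IH) simp_all
  finally show ?case
    by (simp add: 1 case_prod_unfold reduce_append_reduce_left reduce_append_reduce_right)
qed (simp add: reduce_reduced)

lemma runA_Nil: "runA M w p [] = (fst (run M w p), rev (snd (run M w p)))"
  using runA_eq[of "[]" M w p] reduced_snd_run[of M w p] by (simp add: reduce_reduced)

text \<open>The HNN extension of (Z/p)^K by the shift, with Ga adding 1 to the first digit and Gt rotating
  the digits. The label of Gt only records whether the rotated digit is zero. For K = 0 this is the
  identity of the free group on Ga, Gt.\<close>

fun lamp :: "nat \<Rightarrow> (gen, nat list, nat) machine" where
  "lamp p (Ga, b) [] = ([], [(0, b)])"
| "lamp p (Gt, b) [] = ([], [(1, b)])"
| "lamp p (Ga, True) (d # ds) = ((d + 1) mod p # ds, [])"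
| "lamp p (Ga, False) (d # ds) = ((d + (p - 1)) mod p # ds, [])"
| "lamp p (Gt, True) (d # ds) = (last (d # ds) # butlast (d # ds), [(min (last (d # ds)) 1, True)])"
| "lamp p (Gt, False) (d # ds) = (ds @ [d], [(min d 1, False)])"

definition lamp_states :: "nat \<Rightarrow> nat \<Rightarrow> nat list set" where
  "lamp_states p K = {ds. set ds \<subseteq> {..<p} \<and> length ds = K}"

lemma finite_lamp_states: "finite (lamp_states p K)"
  unfolding lamp_states_def by (rule finite_lists_length_eq) simp

lemma is_machine_lamp:
  assumes "p > 0"
  shows "is_machine (lamp p) (lamp_states p K)"
  unfolding is_machine_def
proof (intro allI ballI)
  fix l :: "gen letter" and ds assume ds: "ds \<in> lamp_states p K"
  obtain g b where l: "l = (g, b)" by force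
  show "fst (lamp p l ds) \<in> lamp_states p K \<and>
    lamp p (inv_letter l) (fst (lamp p l ds)) = (ds, inv_word (snd (lamp p l ds)))"
  proof (cases ds)
    case Nil
    then show ?thesis using ds l
      by (cases g; cases b) (auto simp: inv_letter_def inv_word_def)
  next
    case (Cons d es)
    then have d: "d < p" "set es \<subseteq> {..<p}" "length es + 1 = K" using ds by (auto simp: lamp_states_def)
    have 1: "((d + 1) mod p + (p - 1)) mod p = d"
      unfolding mod_add_left_eq using d assms by simp
    have 2: "((d + (p - 1)) mod p + 1) mod p = d"
      unfolding mod_add_left_eq using d assms by simp
    show ?thesis
    proof (cases g; cases b)
      assume "g = Ga" "b" then show ?thesis
        using 1 d Cons l assms by (auto simp: inv_letter_def lamp_states_def)
    next
      assume "g = Ga" "\<not> b" then show ?thesis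
        using 2 d Cons l assms by (auto simp: inv_letter_def lamp_states_def)
    next
      assume "g = Gt" "b"
      moreover have "set (last (d # es) # butlast (d # es)) = set (d # es)"
        by (metis append_butlast_last_id list.set(2) list.simps(15) list.simps(3) rotate1.simps(2) set_rotate1)
      ultimately show ?thesis
        using d Cons l by (auto simp: inv_letter_def lamp_states_def inv_word_def simp del: last.simps butlast.simps)
    next
      assume "g = Gt" "\<not> b"
      moreover have "lamp p (Gt, True) (es @ [d]) = (d # es, [(min d 1, True)])"
        by (cases es) auto
      ultimately show ?thesis
        using d Cons l by (auto simp: inv_letter_def lamp_states_def inv_word_def)
    qed
  qed
qed

text \<open>Addition and subtraction of 1 modulo p by case distinction, so that offsets stay below p
  and no division is ever evaluated.\<close>

fun inc :: "nat \<Rightarrow> nat \<Rightarrow> nat" where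
  "inc p c = (if Suc c = p then 0 else Suc c)"

fun dcr :: "nat \<Rightarrow> nat \<Rightarrow> nat" where
  "dcr p c = (if c = 0 then p - 1 else c - 1)"

declare inc.simps [simp del] dcr.simps [simp del]

text \<open>The action above with symbolic digits (i, c), standing for the i-th initial digit plus c; a word
  that is trivial here is trivial for all p^K digit vectors at once.\<close>

fun sm :: "nat \<Rightarrow> (gen, (nat \<times> nat) list, nat \<times> nat) machine" where
  "sm p (Ga, True) ((i, c) # ds) = ((i, inc p c) # ds, [])"
| "sm p (Ga, False) ((i, c) # ds) = ((i, dcr p c) # ds, [])"
| "sm p (Gt, True) (d # ds) = (last (d # ds) # butlast (d # ds), [(last (d # ds), True)])"
| "sm p (Gt, False) (d # ds) = (ds @ [d], [(d, False)])"
| "sm p l [] = ([], [])"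

text \<open>Renaming generators is a homomorphism of free groups even when the renaming is not
  injective, so reduction before renaming is harmless.\<close>

lemma reduce_map_reduce:
  "reduce (map (\<lambda>(d, b). (f d, b)) (reduce w)) = reduce (map (\<lambda>(d, b). (f d, b)) w)"
proof (induction w)
  case (Cons l w)
  let ?F = "map (\<lambda>(d, b). (f d, b))"
  have "reduce (?F (cons_red l v)) = reduce (?F (l # v))" for v
  proof (cases v)
    case (Cons m u)
    show ?thesis
    proof (cases "m = inv_letter l")
      case True
      obtain d b where "l = (d, b)" by force
      then have "reduce (?F (l # v)) = cons_red (inv_letter (f d, \<not> b)) (cons_red (f d, \<not> b) (reduce (?F u)))"
        using Cons True by (simp add: inv_letter_def reduce_Cons)
      also have "\<dots> = reduce (?F u)" by (rule cons_red_inv) simp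
      also have "u = cons_red l v" using Cons True by (simp add: cons_red_def)
      finally show ?thesis by simp
    qed (simp add: Cons cons_red_def)
  qed (simp add: cons_red_def)
  then show ?case
    using Cons by (simp add: reduce_Cons[of l w]) (simp add: reduce_Cons)
qed simp

text \<open>\<open>g\<close> evaluates a symbolic digit at the digit vector \<open>v\<close>. The
  motion of the digits never depends on their values, so it commutes with evaluation; only the
  labels see the values. The list must be nonempty because on the empty list \<open>lamp\<close>
  writes its input and \<open>sm\<close> writes nothing.\<close>

lemma run_lamp_sm:
  assumes p: "p > 0" and g: "g = (\<lambda>(i, c). (v i + c) mod p)"
  shows "ds \<noteq> [] \<Longrightarrow> run (lamp p) w (map g ds) =
    (map g (fst (run (sm p) w ds)),
     reduce (map (\<lambda>(d, b). (min (g d) 1, b)) (snd (run (sm p) w ds))))"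
proof (induction w arbitrary: ds)
  case (Cons l w)
  let ?F = "map (\<lambda>(d, b). (min (g d) 1, b))"
  obtain es u where 1: "sm p l ds = (es, u)" by force
  obtain d ds' where ds: "ds = d # ds'" using Cons.prems by (cases ds) auto
  obtain i c where d: "d = (i, c)" by force
  obtain x b where l: "l = (x, b)" by force
  have a: "(v i + inc p c) mod p = ((v i + c) mod p + 1) mod p"
    using p by (auto simp: inc.simps mod_simps) (metis add_Suc_right mod_add_self2)
  have b: "(v i + dcr p c) mod p = ((v i + c) mod p + (p - 1)) mod p"
  proof (cases c)
    case (Suc k)
    have "v i + c + (p - 1) = v i + k + p" using p Suc by simp
    then show ?thesis unfolding mod_add_left_eq using Suc by (simp add: dcr.simps)
  qed (simp add: mod_add_left_eq dcr.simps)
  have step: "lamp p l (map g ds) = (map g es, ?F u)" and "es \<noteq> []"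
    using 1 ds d l a b by (cases x; cases b; auto simp: g last_map map_butlast)+
  obtain fs u' where 2: "run (sm p) w es = (fs, u')" by force
  have "run (lamp p) w (map g es) = (map g fs, reduce (?F u'))"
    using Cons.IH[OF \<open>es \<noteq> []\<close>] 2 by simp
  then show ?case
    by (simp add: 1 2 step reduce_append_reduce_right reduce_map_reduce)
qed simp

definition ds0 :: "nat \<Rightarrow> (nat \<times> nat) list" where
  "ds0 K = map (\<lambda>i. (i, 0)) [0..<K]"

lemma run_lamp_if_sm:
  assumes "p > 0" "K > 0" "run (sm p) w (ds0 K) = (ds0 K, [])" "ds \<in> lamp_states p K"
  shows "run (lamp p) w ds = (ds, [])"
proof -
  define g where "g = (\<lambda>(i, c). (ds ! i + c) mod p)"
  have "ds ! i < p" if "i < K" for i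
    using assms(4) that subsetD[OF _ nth_mem[of i ds], of "{..<p}"] by (auto simp: lamp_states_def)
  then have m: "map g (ds0 K) = ds"
    using assms(4) by (intro nth_equalityI) (auto simp: ds0_def g_def lamp_states_def)
  show ?thesis
    using run_lamp_sm[OF assms(1), of g "\<lambda>i. ds ! i" "ds0 K" w] assms(2,3) m
    by (auto simp: g_def ds0_def)
qed

section \<open>Certificates\<close>

text \<open>The state type is fixed to points paired with digit vectors, the form of every
  certificate; an existential over types is not expressible. It is preserved by all the transport
  lemmas below.\<close>

definition has_witness :: "gen letter list \<Rightarrow> bool" where
  "has_witness r \<longleftrightarrow> (\<exists>(M :: (gen, nat \<times> nat list, nat) machine) S. machine_witness M S r)"

lemma large_if_has_witness: "has_witness r \<Longrightarrow> reduced r \<Longrightarrow> large (one_rel_group r)"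
  unfolding has_witness_def using large_if_machine_witness by blast

section \<open>Transport of witnesses along free group automorphisms and rotations\<close>

definition subst :: "('i letter \<Rightarrow> 'j letter list) \<Rightarrow> 'i letter list \<Rightarrow> 'j letter list" where
  "subst \<sigma> w = concat (map \<sigma> w)"

lemma subst_simps [simp]: "subst \<sigma> [] = []" "subst \<sigma> (l # w) = \<sigma> l @ subst \<sigma> w"
  by (simp_all add: subst_def)

lemma run_subst: "run (\<lambda>l. run M (\<sigma> l)) w p = run M (subst \<sigma> w) p"
  by (induction w arbitrary: p) (auto simp: run_append split: prod.splits)

lemma reduce_subst_inverse:
  assumes "\<And>l. reduce (subst \<sigma> (\<tau> l)) = [l]"
  shows "reduce (subst \<sigma> (subst \<tau> w)) = reduce w"
proof (induction w)
  case (Cons l w)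
  have "subst \<sigma> (u @ v) = subst \<sigma> u @ subst \<sigma> v" for u v by (simp add: subst_def)
  then have "reduce (subst \<sigma> (subst \<tau> (l # w))) = reduce (reduce (subst \<sigma> (\<tau> l)) @ reduce (subst \<sigma> (subst \<tau> w)))"
    by (simp add: reduce_append_reduce_left reduce_append_reduce_right)
  also have "\<dots> = reduce ([l] @ w)"
    by (simp only: assms Cons reduce_append_reduce_right)
  finally show ?case by simp
qed simp

text \<open>Let the letter \<open>l\<close> act as the word \<open>\<sigma> l\<close>; then
  \<open>r\<close> acts as \<open>subst \<sigma> r\<close>. The two loops are carried back by
  \<open>\<tau>\<close>, a right inverse of \<open>\<sigma>\<close> on the free group.\<close>

lemma has_witness_subst:
  assumes has_witness: "has_witness (subst \<sigma> r)" and \<sigma>: "\<And>l. \<sigma> (inv_letter l) = inv_word (\<sigma> l)"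
    and \<tau>: "\<And>l. reduce (subst \<sigma> (\<tau> l)) = [l]"
  shows "has_witness r"
proof -
  from has_witness obtain M :: "(gen, nat \<times> nat list, nat) machine" and S where w: "machine_witness M S (subst \<sigma> r)"
    unfolding has_witness_def by blast
  then have m: "is_machine M S" and fin: "finite S" and k: "kills M S (subst \<sigma> r)"
    and lab: "\<And>l p. p \<in> S \<Longrightarrow> fst ` set (snd (M l p)) \<subseteq> {0, 1}"
    by (simp_all only: machine_witness_def)
  from w have ex: "\<exists>p\<in>S. \<exists>u v. run M u p = (p, [(0, True)]) \<and> run M v p = (p, [(1, True)])"
    by (simp only: machine_witness_def)
  let ?N = "\<lambda>l. run M (\<sigma> l)"
  have "is_machine ?N S"
    unfolding is_machine_def using fst_run_in[OF m] run_inv_word[OF m] by (simp add: \<sigma>)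
  moreover have "kills ?N S r"
    using k by (simp add: kills_def run_subst)
  moreover have "\<forall>l. \<forall>p\<in>S. fst ` set (snd (?N l p)) \<subseteq> {0, 1}"
    by (intro allI ballI) (rule set_snd_run[OF m lab])
  moreover have N: "run ?N (subst \<tau> u) p = run M u p" if p: "p \<in> S" for u p
  proof -
    have "run ?N (subst \<tau> u) p = run M (reduce (subst \<sigma> (subst \<tau> u))) p"
      by (simp only: run_subst run_reduce[OF m p])
    also have "\<dots> = run M u p"
      by (simp only: reduce_subst_inverse[of \<sigma> \<tau>, OF \<tau>] run_reduce[OF m p])
    finally show ?thesis .
  qed
  from ex obtain p u v where "p \<in> S" "run M u p = (p, [(0, True)])" "run M v p = (p, [(1, True)])"
    by (elim bexE exE conjE)
  then have "\<exists>p\<in>S. \<exists>u v. run ?N u p = (p, [(0, True)]) \<and> run ?N v p = (p, [(1, True)])"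
    by (intro bexI[of _ p] exI[of _ "subst \<tau> u"] exI[of _ "subst \<tau> v"]) (simp_all only: N)
  ultimately show ?thesis
    unfolding has_witness_def machine_witness_def using fin by (intro exI[of _ ?N] exI[of _ S] conjI)
qed

lemma invert_gens_Nil: "invert_gens ea et [] = []"
  by (simp add: invert_gens_def)

lemma invert_gens_Cons:
  "invert_gens ea et ((Ga, b) # w) = (Ga, b \<noteq> ea) # invert_gens ea et w"
  "invert_gens ea et ((Gt, b) # w) = (Gt, b \<noteq> et) # invert_gens ea et w"
  by (auto simp: invert_gens_def)

lemma has_witness_invert_gens: "has_witness (invert_gens ea et r) \<Longrightarrow> has_witness r"
proof -
  assume has_witness: "has_witness (invert_gens ea et r)"
  let ?\<sigma> = "\<lambda>l. invert_gens ea et [l]"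
  have "subst ?\<sigma> r = invert_gens ea et r" by (induction r) (auto simp: invert_gens_def)
  with has_witness have has_witness': "has_witness (subst ?\<sigma> r)" by simp
  show ?thesis
  proof (rule has_witness_subst[where \<tau> = ?\<sigma>, OF has_witness'])
    fix l :: "gen letter"
    obtain g b where l: "l = (g, b)" by (cases l)
    show "invert_gens ea et [inv_letter l] = inv_word (invert_gens ea et [l])"
      unfolding l by (cases g) (simp_all add: invert_gens_Cons invert_gens_Nil inv_letter_def inv_word_Cons)
    show "reduce (subst ?\<sigma> (invert_gens ea et [l])) = [l]"
      unfolding l by (cases g; cases b; cases ea; cases et)
        (simp_all add: invert_gens_Cons invert_gens_Nil reduce_reduced)
  qed
qed

lemma inv_word_apow: "inv_word (apow k) = apow (- k)"
  by (cases "k = 0") (auto simp: apow_def inv_word_def inv_letter_def)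

fun tsub1 :: "int \<Rightarrow> gen letter \<Rightarrow> gen letter list" where
  "tsub1 k (Ga, b) = [(Ga, b)]"
| "tsub1 k (Gt, True) = (Gt, True) # apow k"
| "tsub1 k (Gt, False) = apow (- k) @ [(Gt, False)]"

definition tsub :: "int \<Rightarrow> gen letter list \<Rightarrow> gen letter list" where
  "tsub k w = subst (tsub1 k) w"

lemma tsub_simps:
  "tsub k [] = []"
  "tsub k ((Ga, b) # w) = (Ga, b) # tsub k w"
  "tsub k ((Gt, True) # w) = (Gt, True) # apow k @ tsub k w"
  "tsub k ((Gt, False) # w) = apow (- k) @ (Gt, False) # tsub k w"
  by (simp_all add: tsub_def)

lemma subst_tsub1_apow: "subst (tsub1 k) (apow j) = apow j"
proof -
  have "subst (tsub1 k) (replicate n (Ga, b)) = replicate n (Ga, b)" for n b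
    by (induction n) auto
  then show ?thesis by (simp add: apow_def)
qed

text \<open>The inverse automorphism is t -> t a^-k.\<close>

lemma has_witness_tsub: "has_witness (tsub k r) \<Longrightarrow> has_witness r"
  unfolding tsub_def
proof (erule has_witness_subst)
  fix l :: "gen letter"
  obtain g b where l: "l = (g, b)" by force
  show "tsub1 k (inv_letter l) = inv_word (tsub1 k l)"
    using l by (cases g; cases b) (auto simp: inv_letter_def inv_word_Cons inv_word_append inv_word_apow)
  have app: "subst (tsub1 k) (u @ v) = subst (tsub1 k) u @ subst (tsub1 k) v" for u v
    by (simp add: subst_def)
  have 1: "reduce (apow k @ apow (- k)) = []" and 2: "reduce (apow k @ apow (- k) @ [x]) = [x]" for x
    using reduce_inv_word_right[of "apow k"] reduce_append_reduce_left[of "apow k @ apow (- k)" "[x]"]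
    by (simp_all add: inv_word_apow reduce.simps)
  have 3: "reduce (x # apow k @ apow (- k)) = [x]" for x
    using reduce_append_reduce_right[of "[x]" "apow k @ apow (- k)"] 1 by (simp add: reduce.simps)
  show "reduce (subst (tsub1 k) (tsub1 (- k) l)) = [l]"
    using l 2 3 by (cases g; cases b) (auto simp: app subst_tsub1_apow reduce.simps)
qed

text \<open>\<open>u @ v\<close> is the conjugate of \<open>v @ u\<close> by
  \<open>u\<close>.\<close>

lemma reduce_append_swap: "reduce (v @ u) = [] \<Longrightarrow> reduce (u @ v) = []"
proof -
  assume 1: "reduce (v @ u) = []"
  have "reduce (u @ v) = reduce ((u @ v) @ reduce (u @ inv_word u))"
    by (simp add: reduce_inv_word_right)
  also have "\<dots> = reduce (u @ reduce (v @ u) @ inv_word u)"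
    by (metis append_assoc reduce_append_reduce_left reduce_append_reduce_right)
  finally show ?thesis using 1 by (simp add: reduce_inv_word_right)
qed

lemma has_witness_rotate1: "has_witness (rotate1 r) \<Longrightarrow> has_witness r"
proof (cases r)
  case (Cons l w)
  assume "has_witness (rotate1 r)"
  then obtain M :: "(gen, nat \<times> nat list, nat) machine" and S where mw: "machine_witness M S (w @ [l])"
    unfolding has_witness_def Cons by auto
  then have m: "is_machine M S" and k: "kills M S (w @ [l])" by (simp_all only: machine_witness_def)
  have "run M (l # w) p = (p, [])" if p: "p \<in> S" for p
  proof -
    obtain q u where 1: "M l p = (q, u)" by (cases "M l p")
    obtain p' v where 2: "run M w q = (p', v)" by (cases "run M w q")
    have q: "q \<in> S" using is_machine_fst[OF m p, of l] 1 by simp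
    have p': "p' \<in> S" using fst_run_in[OF m q, of w] 2 by simp
    have "run M (w @ [l]) q = (q, [])" using k q by (simp add: kills_def)
    then have 3: "fst (M l p') = q" "reduce (v @ snd (M l p')) = []"
      by (auto simp: run_append 2 case_prod_unfold reduce_append_reduce_right)
    \<comment> \<open>The letter \<open>l\<close> leads both from \<open>p\<close> and from
      \<open>p'\<close> to \<open>q\<close>; going back along its inverse shows that the two points
      agree.\<close>
    have "M (inv_letter l) q = (p, inv_word u)" "M (inv_letter l) q = (p', inv_word (snd (M l p')))"
      using m p p' 1 3(1) unfolding is_machine_def by (metis fst_conv snd_conv)+
    then have "p' = p" by simp
    then show ?thesis using 1 2 3 reduce_append_swap[of v u] by simp
  qed
  then have "kills M S r" unfolding kills_def Cons by blast
  with mw show ?thesis unfolding has_witness_def machine_witness_def by blast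
qed simp

lemma has_witness_rotate: "has_witness (rotate k r) \<Longrightarrow> has_witness r"
  by (induction k) (auto dest: has_witness_rotate1)

section \<open>Checking a certificate\<close>

fun isid :: "'a \<times> 'b list \<Rightarrow> 'a \<Rightarrow> bool" where
  "isid (q, []) p \<longleftrightarrow> q = p"
| "isid (q, x # s) p \<longleftrightarrow> False"

text \<open>A trivial label from the first machine settles the point. Otherwise the label, which
  sits reversed on the stack, must act trivially on symbolic digits. \<open>K \<noteq> 0\<close> is
  demanded because on the empty digit list \<open>sm\<close> would accept every word.\<close>

fun tk :: "nat \<Rightarrow> nat \<Rightarrow> nat \<Rightarrow> nat \<times> gen letter list \<Rightarrow> bool" where
  "tk p K i (j, []) \<longleftrightarrow> i = j"
| "tk p K i (j, x # s) \<longleftrightarrow> i = j \<and> K \<noteq> 0 \<and> isid (runA (sm p) (rev (x # s)) (ds0 K) []) (ds0 K)"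

fun kl :: "(gen, nat, gen) machine \<Rightarrow> nat \<Rightarrow> nat \<Rightarrow> nat list \<Rightarrow> gen letter list \<Rightarrow> bool" where
  "kl M p K [] w \<longleftrightarrow> True"
| "kl M p K (i # is) w \<longleftrightarrow> tk p K i (runA M w i []) \<and> kl M p K is w"

lemma isid_eq: "isid x p \<longleftrightarrow> x = (p, [])"
  by (cases "(x, p)" rule: isid.cases) auto

lemma kl_kills:
  assumes p: "p > 0" and m: "is_machine M S" and pts: "set is = S" and kl: "kl M p K is w"
  shows "kills (comp_machine M (lamp p)) (S \<times> lamp_states p K) w"
proof -
  have "run (comp_machine M (lamp p)) w (i, ds) = ((i, ds), [])"
    if i: "i \<in> S" and ds: "ds \<in> lamp_states p K" for i ds
  proof -
    obtain j u where r: "run M w i = (j, u)" by force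
    have "kl M p K is w \<Longrightarrow> i \<in> set is \<Longrightarrow> tk p K i (runA M w i [])"
      by (induction "is") auto
    then have tk: "tk p K i (j, rev u)" using kl i pts by (simp add: runA_Nil r)
    have "j = i \<and> run (lamp p) u ds = (ds, [])"
    proof (cases "rev u")
      case (Cons x s)
      then have "u = rev (x # s)" by (simp add: rev_swap)
      then have "K \<noteq> 0" "runA (sm p) u (ds0 K) [] = (ds0 K, [])" "i = j"
        using tk[unfolded Cons tk.simps isid_eq] by (blast, simp, blast)
      then show ?thesis
        using run_lamp_if_sm[OF p, of K u ds] ds by (auto simp: runA_Nil prod_eq_iff)
    qed (use tk in auto)
    then show ?thesis by (simp add: run_comp[OF m is_machine_lamp[OF p] i ds] r)
  qed
  then show ?thesis by (auto simp: kills_def)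
qed

fun zeros :: "(nat \<times> nat) list \<Rightarrow> bool" where
  "zeros [] \<longleftrightarrow> True"
| "zeros ((i, c) # ds) \<longleftrightarrow> c = 0 \<and> zeros ds"

text \<open>The letter written by \<open>lamp\<close> for a digit with initial value 0 and offset
  c.\<close>

definition cz :: "nat \<Rightarrow> nat \<Rightarrow> nat" where
  "cz p c = min (c mod p) 1"

fun czs :: "nat \<Rightarrow> (nat \<times> nat) letter list \<Rightarrow> nat letter list" where
  "czs p [] = []"
| "czs p (((i, c), b) # s) = (cz p c, b) # czs p s"

text \<open>The loops are needed at the zero vector only. So it is enough that the right number of
  digits with offset 0 remains: their order is irrelevant, as all initial digits there are
  equal.\<close>

fun wt2 :: "nat \<Rightarrow> nat \<Rightarrow> nat \<Rightarrow> (nat \<times> nat) list \<times> (nat \<times> nat) letter list \<Rightarrow> bool" where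
  "wt2 p K x (es, s) \<longleftrightarrow> zeros es \<and> same_len es (ds0 K) \<and> push (czs p (rev s)) [] = [(x, True)]"

text \<open>For \<open>K = 0\<close> the label in a, t is already the final one and must be the
  generator \<open>g\<close> itself; for \<open>K > 0\<close> it is read by the second machine and
  must give the letter \<open>x\<close>.\<close>

fun wt :: "nat \<Rightarrow> nat \<Rightarrow> nat \<Rightarrow> gen \<Rightarrow> nat \<Rightarrow> nat \<times> gen letter list \<Rightarrow> bool" where
  "wt p K b g x (j, s) \<longleftrightarrow> j = b \<and> (if K = 0 then s = [(g, True)] else wt2 p K x (runA (sm p) (rev s) (ds0 K) []))"

lemma wt_run:
  assumes p: "p > 0" and m: "is_machine M S" and b: "b \<in> S"
    and wt: "wt p K b g x (runA M u b [])" and gx: "g = Ga \<and> x = 0 \<or> g = Gt \<and> x = 1"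
  shows "run (comp_machine M (lamp p)) u (b, replicate K 0) = ((b, replicate K 0), [(x, True)])"
proof -
  have z: "replicate K 0 \<in> lamp_states p K" using p by (auto simp: lamp_states_def)
  obtain j s where r: "run M u b = (j, s)" by force
  have "wt p K b g x (j, rev s)" using wt by (simp only: runA_Nil r fst_conv snd_conv)
  then have w: "j = b" "if K = 0 then rev s = [(g, True)] else wt2 p K x (runA (sm p) s (ds0 K) [])"
    unfolding wt.simps rev_rev_ident by (rule conjunct1, rule conjunct2)
  have "run (lamp p) s (replicate K 0) = (replicate K 0, [(x, True)])"
  proof (cases "K = 0")
    case True
    then have s: "s = [(g, True)]" using w(2) by (simp add: rev_swap)
    show ?thesis using gx unfolding s True by (elim disjE) (simp_all add: reduce_reduced)
  next
    case False
    define f where "f = (\<lambda>(i :: nat, c). ((0::nat) + c) mod p)"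
    obtain es v where v: "run (sm p) s (ds0 K) = (es, v)" by force
    have "wt2 p K x (es, rev v)"
      using w(2) unfolding runA_Nil v fst_conv snd_conv if_not_P[OF False] .
    then have 1: "zeros es" "length es = K" "push (czs p v) [] = [(x, True)]"
      unfolding wt2.simps same_len_eq rev_rev_ident by (simp_all add: ds0_def)
    have 2: "map f (ds0 K) = replicate K 0"
      by (simp add: ds0_def f_def o_def map_replicate_const)
    have "zeros es \<Longrightarrow> map f es = replicate (length es) 0"
      by (induction es rule: zeros.induct) (simp_all add: f_def)
    then have 3: "map f es = replicate K 0" using 1 by simp
    have 4: "czs p v = map (\<lambda>(d, b). (min (f d) 1, b)) v"
    proof (induction v)
      case (Cons y v)
      obtain i c b' where "y = ((i, c), b')" by (cases y) force
      then show ?case using Cons by (simp add: f_def cz_def)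
    qed simp
    have 5: "reduce (czs p v) = [(x, True)]"
      using 1(3) push_eq[of "[]" "czs p v"] by (simp add: rev_swap)
    have "ds0 K \<noteq> []" using False by (simp add: ds0_def)
    from run_lamp_sm[OF p f_def this, of s] show ?thesis
      unfolding v fst_conv snd_conv 2 3 4[symmetric] 5 .
  qed
  then show ?thesis using w by (simp add: run_comp[OF m is_machine_lamp[OF p] b z] r)
qed

lemma lamp_labels: "fst ` set (snd (lamp p l ds)) \<subseteq> {0, 1}"
  by (cases "(p, l, ds)" rule: lamp.cases) auto

definition is_exc :: "gen letter list \<Rightarrow> bool" where
  "is_exc r \<longleftrightarrow> (\<exists>w \<in> set exceptional_words. equiv_word r w) \<or>
     (\<exists>p q :: int. coprime p q \<and> equiv_word r (bs_word p q))"

definition good :: "gen letter list \<Rightarrow> bool" where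
  "good r \<longleftrightarrow> has_witness r \<or> is_exc r"

fun goods :: "nat list \<Rightarrow> bool" where
  "goods [] \<longleftrightarrow> True"
| "goods (n # ns) \<longleftrightarrow> good (wd n) \<and> goods ns"

text \<open>The relators of one certificate, grouped by the substitution after which they are
  killed: inversion of a if \<open>ea\<close>, of t if \<open>et\<close>, then t -> t a^k.
  \<open>klg\<close> applies it.\<close>

fun good_groups :: "(bool \<times> bool \<times> int \<times> nat list) list \<Rightarrow> bool" where
  "good_groups [] \<longleftrightarrow> True"
| "good_groups ((ea, et, k, ns) # gs) \<longleftrightarrow> goods ns \<and> good_groups gs"

fun klt :: "(gen, nat, gen) machine \<Rightarrow> nat \<Rightarrow> nat \<Rightarrow> nat list \<Rightarrow> bool \<Rightarrow> bool \<Rightarrow> int \<Rightarrow> nat list \<Rightarrow> bool" where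
  "klt M p K is ea et k [] \<longleftrightarrow> True"
| "klt M p K is ea et k (n # ns) \<longleftrightarrow>
     kl M p K is (tsub k (invert_gens ea et (wd n))) \<and> klt M p K is ea et k ns"

fun klg :: "(gen, nat, gen) machine \<Rightarrow> nat \<Rightarrow> nat \<Rightarrow> nat list \<Rightarrow> (bool \<times> bool \<times> int \<times> nat list) list \<Rightarrow> bool" where
  "klg M p K is [] \<longleftrightarrow> True"
| "klg M p K is ((ea, et, k, ns) # gs) \<longleftrightarrow> klt M p K is ea et k ns \<and> klg M p K is gs"

text \<open>The permutations a, t act on the points 1..n, with labels al, bl; b is the base point, and u, v
  are words whose labels there are the two free generators.\<close>

lemma certificate:
  assumes static: "p \<noteq> 0 \<and> sub (upl 1 a) a \<and> sub (upl 1 a) t \<and> same_len a t \<and> same_len a al \<and>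
      same_len a bl \<and> mem b (upl 1 a)"
    and dyn: "\<And>M. tabs M Ga (upl 1 a) a al \<and> tabs M Gt (upl 1 t) t bl \<Longrightarrow>
      wt p K b Ga 0 (runA M (wd u) b []) \<and> wt p K b Gt 1 (runA M (wd v) b []) \<and> klg M p K (upl 1 a) gs"
  shows "good_groups gs"
proof -
  define n where "n = length a"
  define Q where "Q g = (case g of Ga \<Rightarrow> a | Gt \<Rightarrow> t)" for g
  define U where "U g = (case g of Ga \<Rightarrow> al | Gt \<Rightarrow> bl)" for g
  let ?M = "table_machine Q U"
  have up: "set (upl 1 a) = {1..n}" by (auto simp: upl_eq n_def)
  have 1: "length (Q g) = n" "{1..n} \<subseteq> set (Q g)" "length (U g) = n" for g
    using static up by (cases g; simp add: Q_def U_def n_def sub_eq same_len_eq)+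
  note M = table_machine[of Q n U, OF 1]
  \<comment> \<open>The equations assumed of an arbitrary \<open>M\<close> hold for the table
    machine, which turns the check into a fact about a concrete action.\<close>
  have d: "wt p K b Ga 0 (runA ?M (wd u) b [])" "wt p K b Gt 1 (runA ?M (wd v) b [])" "klg ?M p K (upl 1 a) gs"
    using dyn[of ?M] M(2)[of Ga] M(2)[of Gt] by (simp_all add: Q_def U_def)
  have p: "p > 0" and b: "b \<in> {1..n}" using static up by (auto simp: mem_eq)
  let ?N = "comp_machine ?M (lamp p)" and ?S = "{1..n} \<times> lamp_states p K"
  have has_witnessI: "has_witness w" if "kl ?M p K (upl 1 a) w" for w
  proof -
    have "kills ?N ?S w" by (rule kl_kills[OF p M(1) up that])
    moreover have "is_machine ?N ?S" by (rule is_machine_comp[OF M(1) is_machine_lamp[OF p]])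
    moreover have "finite ?S" using finite_lamp_states by blast
    moreover have "\<forall>l. \<forall>s\<in>?S. fst ` set (snd (?N l s)) \<subseteq> {0, 1}"
    proof (intro allI ballI)
      fix l :: "gen letter" and s assume s: "s \<in> ?S"
      obtain q w' where "?M l (fst s) = (q, w')" by force
      then have "snd (?N l s) = snd (run (lamp p) w' (snd s))"
        by (simp add: comp_machine_def case_prod_unfold)
      moreover have "snd s \<in> lamp_states p K" using s by auto
      ultimately show "fst ` set (snd (?N l s)) \<subseteq> {0, 1}"
        using set_snd_run[OF is_machine_lamp[OF p] lamp_labels] by metis
    qed
    moreover have "(b, replicate K 0) \<in> ?S" using b p by (auto simp: lamp_states_def)
    then have "\<exists>s\<in>?S. \<exists>u v. run ?N u s = (s, [(0, True)]) \<and> run ?N v s = (s, [(1, True)])"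
      using wt_run[OF p M(1) b d(1)] wt_run[OF p M(1) b d(2)]
      by (intro bexI[of _ "(b, replicate K 0)"] exI[of _ "wd u"] exI[of _ "wd v"]) auto
    ultimately show ?thesis
      unfolding has_witness_def machine_witness_def by (intro exI[of _ ?N] exI[of _ ?S] conjI)
  qed
  have t: "klt ?M p K (upl 1 a) ea et k ns \<Longrightarrow> goods ns" for ea et k ns
  proof (induction ns)
    case (Cons n ns)
    then have "has_witness (wd n)" using has_witnessI has_witness_tsub has_witness_invert_gens by (meson klt.simps(2))
    with Cons show ?case by (simp add: good_def)
  qed simp
  have "klg ?M p K (upl 1 a) gs \<Longrightarrow> good_groups gs"
  proof (induction gs rule: good_groups.induct)
    case (2 ea et k ns gs)
    then show ?case using t[of ea et k ns] by simp
  qed simp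
  then show ?thesis using d by simp
qed

text \<open>\<open>last\<close> and \<open>butlast\<close> worked out for the digit counts from 2 to
  6 that occur with \<open>K > 0\<close>; likewise the moduli in \<open>digit_rules\<close> are the
  primes 2, 3, 5 that occur.\<close>

lemma sm_rules:
  "sm p (Gt, True) [d0, d1] = ([d1, d0], [(d1, True)])"
  "sm p (Gt, True) [d0, d1, d2] = ([d2, d0, d1], [(d2, True)])"
  "sm p (Gt, True) [d0, d1, d2, d3] = ([d3, d0, d1, d2], [(d3, True)])"
  "sm p (Gt, True) [d0, d1, d2, d3, d4] = ([d4, d0, d1, d2, d3], [(d4, True)])"
  "sm p (Gt, True) [d0, d1, d2, d3, d4, d5] = ([d5, d0, d1, d2, d3, d4], [(d5, True)])"
  by simp_all

lemma digit_rules: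
  "inc 2 0 = Suc 0" "inc 2 (Suc 0) = 0" "inc 3 0 = Suc 0" "inc 3 (Suc 0) = Suc (Suc 0)" "inc 3 (Suc (Suc 0)) = 0"
  "inc 5 0 = Suc 0" "inc 5 (Suc 0) = Suc (Suc 0)" "inc 5 (Suc (Suc 0)) = Suc (Suc (Suc 0))"
  "inc 5 (Suc (Suc (Suc 0))) = Suc (Suc (Suc (Suc 0)))" "inc 5 (Suc (Suc (Suc (Suc 0)))) = 0"
  "dcr 2 0 = Suc 0" "dcr 2 (Suc 0) = 0" "dcr 3 0 = Suc (Suc 0)" "dcr 3 (Suc 0) = 0" "dcr 3 (Suc (Suc 0)) = Suc 0"
  "dcr 5 0 = Suc (Suc (Suc (Suc 0)))" "dcr 5 (Suc c) = c"
  "cz p 0 = 0" "cz 2 (Suc 0) = 1" "cz 3 (Suc 0) = 1" "cz 3 (Suc (Suc 0)) = 1" "cz 5 (Suc 0) = 1"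
  "cz 5 (Suc (Suc 0)) = 1" "cz 5 (Suc (Suc (Suc 0))) = 1" "cz 5 (Suc (Suc (Suc (Suc 0)))) = 1"
  by (simp_all add: inc.simps dcr.simps cz_def)

lemma ds0_rules:
  "ds0 2 = [(0, 0), (Suc 0, 0)]"
  "ds0 3 = [(0, 0), (Suc 0, 0), (Suc (Suc 0), 0)]"
  "ds0 4 = [(0, 0), (Suc 0, 0), (Suc (Suc 0), 0), (Suc (Suc (Suc 0)), 0)]"
  "ds0 5 = [(0, 0), (Suc 0, 0), (Suc (Suc 0), 0), (Suc (Suc (Suc 0)), 0), (Suc (Suc (Suc (Suc 0))), 0)]"
  "ds0 6 = [(0, 0), (Suc 0, 0), (Suc (Suc 0), 0), (Suc (Suc (Suc 0)), 0), (Suc (Suc (Suc (Suc 0))), 0),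
    (Suc (Suc (Suc (Suc (Suc 0)))), 0)]"
  by (simp_all add: ds0_def upt_rec numeral_eq_Suc)

lemma apow_rules:
  "apow 0 = []" "apow (- 0) = []" "apow 1 = [(Ga, True)]" "apow (- 1) = [(Ga, False)]" "apow (- (- 1)) = [(Ga, True)]"
  "apow 2 = [(Ga, True), (Ga, True)]" "apow (- 2) = [(Ga, False), (Ga, False)]" "apow (- (- 2)) = [(Ga, True), (Ga, True)]"
  by (simp_all add: apow_def numeral_2_eq_2)

lemma Suc_rules: "Suc 1 = 2" "Suc (numeral k) = numeral (Num.inc k)"
  by (simp_all add: add_One)

text \<open>A fixed rule set that evaluates every certificate. Words and points are binary numerals,
  digits of the HNN action are unary, so equality tests are purely syntactic.\<close>

lemmas cert_rules = wd_1 wd_numeral decn.simps tabs.simps(1,2) Suc_rules Num.inc.simps upl.simps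
  cr.simps push.simps runA.simps runB.simps sm.simps(1,2,4) sm_rules digit_rules ds0_rules isid.simps tk.simps
  kl.simps klt.simps klg.simps wt.simps wt2.simps zeros.simps czs.simps same_len.simps sub.simps mem.simps
  tsub_simps(1-4) invert_gens_Nil invert_gens_Cons apow_rules
  inv_word_Nil inv_word_Cons append.simps rev.simps prod.inject simp_thms if_True if_False gen.distinct
  inv_letter_def fst_conv snd_conv list.inject list.distinct numeral_eq_iff num.inject num.distinct nat.inject nat.distinct
  numeral_eq_one_iff one_eq_numeral_iff numeral_neq_zero zero_neq_one one_neq_zero

section \<open>Enumeration of relators\<close>

lemma decn_append2: "decn k (s @ t) = decn k s @ t"
  by (induction k s rule: decn.induct) simp_all

lemma decn_append: "decn k s = decn k [] @ s"
  using decn_append2[of k "[]" s] by simp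

text \<open>Admissible continuations of a word ending in l, with b the number of letters a^+-1 that may
  still follow directly, and x, y the remaining length minus and plus the exponent sum of t so far.
  Both stay nonnegative as long as the exponent sum can return to 0.\<close>

fun vc :: "nat \<Rightarrow> gen letter \<Rightarrow> nat \<Rightarrow> nat \<Rightarrow> nat \<Rightarrow> gen letter list \<Rightarrow> bool" where
  "vc n l b x y [] \<longleftrightarrow> fst l = Gt \<and> x = y"
| "vc n l b x y ((Ga, e) # u) \<longleftrightarrow> (Ga, e) \<noteq> inv_letter l \<and> b > 0 \<and> x > 0 \<and> y > 0 \<and> vc n (Ga, e) (b - 1) (x - 1) (y - 1) u"
| "vc n l b x y ((Gt, True) # u) \<longleftrightarrow> (Gt, True) \<noteq> inv_letter l \<and> x > 1 \<and> vc n (Gt, True) n (x - 2) y u"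
| "vc n l b x y ((Gt, False) # u) \<longleftrightarrow> (Gt, False) \<noteq> inv_letter l \<and> y > 1 \<and> vc n (Gt, False) n x (y - 2) u"

text \<open>A node of the search tree: \<open>k\<close> codes the prefix read so far, and the claim
  concerns all its admissible continuations at once. Rewriting with the rules below walks through
  the tree.\<close>

definition EXT :: "(gen letter list \<Rightarrow> bool) \<Rightarrow> nat \<Rightarrow> num \<Rightarrow> gen letter \<Rightarrow> nat \<Rightarrow> nat \<Rightarrow> nat \<Rightarrow> bool" where
  "EXT Q n k l b x y \<longleftrightarrow> (\<forall>u. vc n l b x y u \<longrightarrow> Q (decn k [] @ u))"

text \<open>\<open>XN\<close> ends the word at this node; the four following predicates append a,
  a^-1, t, t^-1, each under the bounds that \<open>vc\<close> puts on this letter.\<close>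

definition XN :: "(gen letter list \<Rightarrow> bool) \<Rightarrow> num \<Rightarrow> nat \<Rightarrow> nat \<Rightarrow> bool" where
  "XN Q k x y \<longleftrightarrow> (x = y \<longrightarrow> Q (wd (numeral k)))"

definition XA :: "(gen letter list \<Rightarrow> bool) \<Rightarrow> nat \<Rightarrow> num \<Rightarrow> nat \<Rightarrow> nat \<Rightarrow> nat \<Rightarrow> bool" where
  "XA Q n k b x y \<longleftrightarrow> (b > 0 \<and> x > 0 \<and> y > 0 \<longrightarrow> EXT Q n (num.Bit0 (num.Bit0 k)) (Ga, True) (b - 1) (x - 1) (y - 1))"

definition XA' :: "(gen letter list \<Rightarrow> bool) \<Rightarrow> nat \<Rightarrow> num \<Rightarrow> nat \<Rightarrow> nat \<Rightarrow> nat \<Rightarrow> bool" where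
  "XA' Q n k b x y \<longleftrightarrow> (b > 0 \<and> x > 0 \<and> y > 0 \<longrightarrow> EXT Q n (num.Bit1 (num.Bit0 k)) (Ga, False) (b - 1) (x - 1) (y - 1))"

definition XT :: "(gen letter list \<Rightarrow> bool) \<Rightarrow> nat \<Rightarrow> num \<Rightarrow> nat \<Rightarrow> nat \<Rightarrow> bool" where
  "XT Q n k x y \<longleftrightarrow> (x > 1 \<longrightarrow> EXT Q n (num.Bit0 (num.Bit1 k)) (Gt, True) n (x - 2) y)"

definition XT' :: "(gen letter list \<Rightarrow> bool) \<Rightarrow> nat \<Rightarrow> num \<Rightarrow> nat \<Rightarrow> nat \<Rightarrow> bool" where
  "XT' Q n k x y \<longleftrightarrow> (y > 1 \<longrightarrow> EXT Q n (num.Bit1 (num.Bit1 k)) (Gt, False) n x (y - 2))"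

text \<open>Case distinction on the first letter of the continuation; appending a base 4 digit to
  \<open>k\<close> appends this letter to the prefix.\<close>

lemma EXT_unfold:
  "EXT Q n k l b x y \<longleftrightarrow> (fst l = Gt \<longrightarrow> XN Q k x y) \<and> (l \<noteq> (Ga, False) \<longrightarrow> XA Q n k b x y) \<and>
     (l \<noteq> (Ga, True) \<longrightarrow> XA' Q n k b x y) \<and> (l \<noteq> (Gt, False) \<longrightarrow> XT Q n k x y) \<and> (l \<noteq> (Gt, True) \<longrightarrow> XT' Q n k x y)"
proof -
  have split: "(\<forall>u. P u) \<longleftrightarrow> P [] \<and> (\<forall>u. P ((Ga, True) # u)) \<and> (\<forall>u. P ((Ga, False) # u)) \<and>
      (\<forall>u. P ((Gt, True) # u)) \<and> (\<forall>u. P ((Gt, False) # u))" for P :: "gen letter list \<Rightarrow> bool"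
  proof
    assume r: "P [] \<and> (\<forall>u. P ((Ga, True) # u)) \<and> (\<forall>u. P ((Ga, False) # u)) \<and>
      (\<forall>u. P ((Gt, True) # u)) \<and> (\<forall>u. P ((Gt, False) # u))"
    show "\<forall>u. P u"
    proof
      fix u show "P u"
      proof (cases u)
        case (Cons z v)
        obtain g e where "z = (g, e)" by (cases z)
        then show ?thesis using r Cons by (cases g; cases e) auto
      qed (use r in simp)
    qed
  qed blast
  have inv: "(g, e) \<noteq> inv_letter l \<longleftrightarrow> l \<noteq> (g, \<not> e)" for g e
    by (cases l) (auto simp: inv_letter_def)
  have d: "decn k [] @ (Ga, True) # u = decn (num.Bit0 (num.Bit0 k)) [] @ u"
    "decn k [] @ (Ga, False) # u = decn (num.Bit1 (num.Bit0 k)) [] @ u"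
    "decn k [] @ (Gt, True) # u = decn (num.Bit0 (num.Bit1 k)) [] @ u"
    "decn k [] @ (Gt, False) # u = decn (num.Bit1 (num.Bit1 k)) [] @ u" for u
    using decn_append[of k "[_]"] by simp_all
  show ?thesis
    unfolding EXT_def[of Q n k l] split[of "\<lambda>u. vc n l b x y u \<longrightarrow> Q (decn k [] @ u)"] vc.simps inv d
      XN_def XA_def XA'_def XT_def XT'_def EXT_def wd_numeral
    by auto
qed

lemma EXT_rules:
  "EXT Q n k (Ga, True) b x y \<longleftrightarrow> XA Q n k b x y \<and> XT Q n k x y \<and> XT' Q n k x y"
  "EXT Q n k (Ga, False) b x y \<longleftrightarrow> XA' Q n k b x y \<and> XT Q n k x y \<and> XT' Q n k x y"
  "EXT Q n k (Gt, True) b x y \<longleftrightarrow> XN Q k x y \<and> XA Q n k b x y \<and> XA' Q n k b x y \<and> XT Q n k x y"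
  "EXT Q n k (Gt, False) b x y \<longleftrightarrow> XN Q k x y \<and> XA Q n k b x y \<and> XA' Q n k b x y \<and> XT' Q n k x y"
  by (subst EXT_unfold; simp)+

text \<open>With unary counters each bound is decided by the shape of its argument, so the whole
  tree unfolds without arithmetic.\<close>

lemma X_rules:
  "XN Q k (Suc x) (Suc y) \<longleftrightarrow> XN Q k x y" "XN Q k 0 0 \<longleftrightarrow> Q (wd (numeral k))"
  "XN Q k (Suc x) 0 \<longleftrightarrow> True" "XN Q k 0 (Suc y) \<longleftrightarrow> True"
  "XA Q n k (Suc b) (Suc x) (Suc y) \<longleftrightarrow> EXT Q n (num.Bit0 (num.Bit0 k)) (Ga, True) b x y"
  "XA Q n k 0 x y \<longleftrightarrow> True" "XA Q n k b 0 y \<longleftrightarrow> True" "XA Q n k b x 0 \<longleftrightarrow> True"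
  "XA' Q n k (Suc b) (Suc x) (Suc y) \<longleftrightarrow> EXT Q n (num.Bit1 (num.Bit0 k)) (Ga, False) b x y"
  "XA' Q n k 0 x y \<longleftrightarrow> True" "XA' Q n k b 0 y \<longleftrightarrow> True" "XA' Q n k b x 0 \<longleftrightarrow> True"
  "XT Q n k (Suc (Suc x)) y \<longleftrightarrow> EXT Q n (num.Bit0 (num.Bit1 k)) (Gt, True) n x y"
  "XT Q n k 0 y \<longleftrightarrow> True" "XT Q n k (Suc 0) y \<longleftrightarrow> True"
  "XT' Q n k x (Suc (Suc y)) \<longleftrightarrow> EXT Q n (num.Bit1 (num.Bit1 k)) (Gt, False) n x y"
  "XT' Q n k x 0 \<longleftrightarrow> True" "XT' Q n k x (Suc 0) \<longleftrightarrow> True"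
  by (simp_all add: XN_def XA_def XA'_def XT_def XT'_def)

definition no_run :: "nat \<Rightarrow> gen letter list \<Rightarrow> bool" where
  "no_run n w \<longleftrightarrow> (\<forall>e u v. w \<noteq> u @ replicate (Suc n) (Ga, e) @ v)"

lemma t_exp_sum_Cons: "t_exp_sum (l # w) = (if fst l = Gt then (if snd l then 1 else -1) else 0) + t_exp_sum w"
  by (simp add: t_exp_sum_def)

lemma abs_t_exp_sum: "\<bar>t_exp_sum w\<bar> \<le> int (length w)"
  by (induction w) (auto simp: t_exp_sum_Cons, auto simp: t_exp_sum_def)

text \<open>\<open>c\<close> is the number of copies of \<open>l\<close> that have just been read, 0
  if \<open>l\<close> is t or t^-1, so \<open>n - c\<close> letters may still prolong the run. As
  the total exponent sum is 0, that of the remaining \<open>u\<close> is minus that of the prefix,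
  which explains the signs in \<open>x\<close> and \<open>y\<close>.\<close>

lemma vc_if:
  assumes "n > 0"
  shows "reduced (l # u) \<Longrightarrow> no_run n (replicate c l @ u) \<Longrightarrow> (fst l = Gt \<Longrightarrow> c = 0) \<Longrightarrow> c \<le> n \<Longrightarrow>
    fst (last (l # u)) = Gt \<Longrightarrow> length u \<le> m \<Longrightarrow> int x = int m + t_exp_sum u \<Longrightarrow> int y = int m - t_exp_sum u \<Longrightarrow>
    vc n l (n - c) x y u"
proof (induction u arbitrary: l c m x y)
  case Nil
  then show ?case by (auto simp: t_exp_sum_def)
next
  case (Cons z u)
  obtain g e where z: "z = (g, e)" by (cases z)
  obtain m' where m: "m = Suc m'" and m': "length u \<le> m'" using Cons.prems(6) by (cases m) auto
  have red: "reduced (z # u)" "z \<noteq> inv_letter l" using Cons.prems(1) by auto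
  have last: "fst (last (z # u)) = Gt" using Cons.prems(5) by simp
  have tail: "no_run n u"
    using Cons.prems(2) unfolding no_run_def by (metis append.assoc append_Cons append_Nil)
  have b1: "\<bar>t_exp_sum u\<bar> \<le> int m'" using abs_t_exp_sum[of u] m' by simp
  show ?case
  proof (cases g)
    case Ga
    \<comment> \<open>The run either goes on or a new one starts; the case
      \<open>z \<noteq> l\<close> can occur only after t or t^-1, since a and a^-1 are never
      adjacent. So \<open>c'\<close> is \<open>Suc c\<close> in both cases.\<close>
    define c' where "c' = (if z = l then Suc c else 1)"
    have run: "no_run n (replicate c' z @ u)"
    proof (cases "z = l")
      case True
      then show ?thesis using Cons.prems(2) by (simp add: c'_def replicate_append_same flip: replicate_Suc append_assoc)
          (metis append.assoc append_Cons append_Nil replicate_Suc replicate_append_same)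
    next
      case False
      have "no_run n (z # u)" using Cons.prems(2) unfolding no_run_def by (metis append.assoc)
      then show ?thesis using False by (simp add: c'_def)
    qed
    have "c' \<noteq> Suc n"
    proof
      assume "c' = Suc n"
      then have "replicate c' z @ u = [] @ replicate (Suc n) (Ga, e) @ u" using z Ga by simp
      then show False using run unfolding no_run_def by blast
    qed
    moreover have "c' \<le> Suc n" using Cons.prems(4) by (simp add: c'_def)
    ultimately have c': "c' \<le> n" by simp
    have fl: "c = 0" if "z \<noteq> l"
    proof (cases "fst l")
      case Ga' : Ga
      then have "z = inv_letter l \<or> z = l" using z Ga by (cases l) (auto simp: inv_letter_def)
      then show ?thesis using red that by blast
    qed (use Cons.prems(3) in simp)
    have c1: "c' = Suc c" using fl by (auto simp: c'_def)
    have "t_exp_sum (z # u) = t_exp_sum u" using z Ga by (simp add: t_exp_sum_Cons)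
    then have xy: "int (x - 1) = int m' + t_exp_sum u" "int (y - 1) = int m' - t_exp_sum u" "x > 0" "y > 0"
      using Cons.prems(7,8) m b1 by auto
    have "vc n z (n - c') (x - 1) (y - 1) u"
      using Cons.IH[OF red(1) run _ c' last m' xy(1,2)] z Ga by simp
    then show ?thesis using z Ga red xy c' c1 by simp
  next
    case Gt
    \<comment> \<open>After t or t^-1 the run budget is full again, and only one of the two counters
      drops, by 2: remaining length and exponent sum change together.\<close>
    have "vc n z (n - 0) (if e then x - 2 else x) (if e then y else y - 2) u"
      using Cons.prems(7,8) m b1 z Gt tail
      by (intro Cons.IH[OF red(1) _ _ _ last m']) (auto simp: t_exp_sum_Cons)
    then show ?thesis
      using z Gt red Cons.prems(7,8) m b1 by (cases e) (auto simp: t_exp_sum_Cons)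
  qed
qed

section \<open>Recognising the listed relators\<close>

lemma equiv_wordI:
  "rotate k (invert_gens ea et (if iv then inv_word r else r)) = v \<Longrightarrow> equiv_word r v"
  unfolding equiv_word_def by (intro bexI[of _ "if iv then inv_word r else r"] exI) auto

lemma good_if_exceptional:
  "mem (rotate k (invert_gens ea et (if iv then inv_word r else r))) exceptional_words \<Longrightarrow> good r"
  unfolding good_def is_exc_def mem_eq using equiv_wordI[OF refl] by blast

lemma good_if_bs:
  "coprime p q \<Longrightarrow> rotate k r = bs_word p q \<Longrightarrow> good r"
proof -
  assume "coprime p q" "rotate k r = bs_word p q"
  moreover have "invert_gens False False r = r" by (induction r) (auto simp: invert_gens_def)
  ultimately show ?thesis
    unfolding good_def is_exc_def using equiv_wordI[of k False False False r "bs_word p q"] by auto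
qed

lemma id_rotate_rules: "rotate 0 w = w" "rotate (Suc k) (l # w) = rotate k (w @ [l])"
  by (simp_all add: rotate1_rotate_swap)

lemma replicate_num: "replicate (numeral k) x = x # replicate (pred_numeral k) x"
  by (simp add: numeral_eq_Suc)

lemmas word_rules = replicate_num wd_numeral decn.simps id_rotate_rules invert_gens_Nil invert_gens_Cons inv_word_Nil inv_word_Cons
  inv_letter_def bs_word_def apow_def exceptional_words_def mem.simps

text \<open>The part of the symmetry of \<open>equiv_word\<close> that the normal form below uses:
  rotations and generator inversions, with the relator itself never inverted.\<close>

definition variant :: "gen letter list \<Rightarrow> gen letter list \<Rightarrow> bool" where
  "variant r w \<longleftrightarrow> (\<exists>k ea et. w = rotate k (invert_gens ea et r))"

lemma invert_gens_invert_gens: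
  "invert_gens ea et (invert_gens ea' et' w) = invert_gens (ea \<noteq> ea') (et \<noteq> et') w"
proof (induction w)
  case (Cons l w)
  obtain g b where "l = (g, b)" by (cases l)
  then show ?case using Cons by (cases g) (auto simp: invert_gens_Cons)
qed (simp add: invert_gens_Nil)

lemma invert_gens_rotate: "invert_gens ea et (rotate k w) = rotate k (invert_gens ea et w)"
  by (simp add: invert_gens_def rotate_map)

lemma variant_refl: "variant r r"
proof -
  have "invert_gens False False r = r" by (induction r) (auto simp: invert_gens_def)
  then show ?thesis unfolding variant_def by (metis rotate0 id_apply)
qed

lemma variant_rotate: "variant r w \<Longrightarrow> variant r (rotate k w)"
  unfolding variant_def by (metis rotate_rotate)

lemma variant_invert_gens: "variant r w \<Longrightarrow> variant r (invert_gens ea et w)"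
  unfolding variant_def by (metis invert_gens_rotate invert_gens_invert_gens)

lemma variant_induct:
  assumes v: "variant r w" and r: "P r" and rot: "\<And>w. P w \<Longrightarrow> P (rotate1 w)"
    and inv: "\<And>ea et w. P w \<Longrightarrow> P (invert_gens ea et w)"
  shows "P w"
proof -
  obtain k ea et where w: "w = rotate k (invert_gens ea et r)" using v unfolding variant_def by blast
  have "P (rotate k (invert_gens ea et r))" by (induction k) (simp_all add: r rot inv)
  then show ?thesis by (simp add: w)
qed

lemma reduced_invert_gens: "reduced (invert_gens ea et w) \<longleftrightarrow> reduced w"
proof (induction w rule: induct_list012)
  case 1
  then show ?case by (simp add: invert_gens_def)
next
  case (2 x)
  then show ?case by (simp add: invert_gens_def case_prod_unfold)
next
  case (3 x y zs)
  obtain g b h c where xy: "x = (g, b)" "y = (h, c)" by (cases x; cases y)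
  obtain g' b' h' c' where
    e: "invert_gens ea et (x # y # zs) = (g, b') # (h, c') # invert_gens ea et zs" "invert_gens ea et (y # zs) = (h, c') # invert_gens ea et zs"
    and "(h, c') = inv_letter (g, b') \<longleftrightarrow> (h, c) = inv_letter (g, b)"
    using xy by (cases g; cases h) (auto simp: invert_gens_Cons inv_letter_def)
  then show ?case using 3 xy by simp
qed

lemma cyclically_reduced_rotate1: "cyclically_reduced w \<Longrightarrow> cyclically_reduced (rotate1 w)"
proof (cases w)
  case (Cons l u)
  assume w: "cyclically_reduced w"
  show ?thesis
  proof (cases u)
    case (Cons m v)
    have "reduced (l # u)" "last u \<noteq> inv_letter l" using w \<open>w = l # u\<close> Cons by (auto simp: cyclically_reduced_def)
    then have "reduced u" "l \<noteq> inv_letter (last u)" "m \<noteq> inv_letter l" using Cons by auto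
    then have "reduced (u @ [l])" "l \<noteq> inv_letter m" using reduced_append_single[of u l] by auto
    then show ?thesis using \<open>w = l # u\<close> Cons by (simp add: cyclically_reduced_def)
  qed (use w Cons in simp)
qed simp

lemma cyclically_reduced_invert_gens: "cyclically_reduced w \<Longrightarrow> cyclically_reduced (invert_gens ea et w)"
proof (cases "w = []")
  case False
  assume w: "cyclically_reduced w"
  have *: "(case l of (g, b) \<Rightarrow> (g, if g = Ga \<and> ea \<or> g = Gt \<and> et then \<not> b else b)) =
      inv_letter (case m of (g, b) \<Rightarrow> (g, if g = Ga \<and> ea \<or> g = Gt \<and> et then \<not> b else b)) \<longleftrightarrow> l = inv_letter m"
    for l m by (cases l; cases m) (auto simp: inv_letter_def)
  have "last (invert_gens ea et w) = inv_letter (hd (invert_gens ea et w)) \<longleftrightarrow> last w = inv_letter (hd w)"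
    unfolding invert_gens_def last_map[OF False] list.map_sel(1)[OF False] by (rule *)
  then show ?thesis using w False by (simp add: cyclically_reduced_def reduced_invert_gens)
qed (simp add: cyclically_reduced_def invert_gens_def)

lemma variant_props:
  assumes v: "variant r w"
  shows "cyclically_reduced r \<Longrightarrow> cyclically_reduced w" "length w = length r"
    "t_exp_sum r = 0 \<Longrightarrow> t_exp_sum w = 0" "fst ` set w = fst ` set r"
proof -
  show "cyclically_reduced w" if "cyclically_reduced r"
    by (rule variant_induct[OF v, of cyclically_reduced])
      (simp_all add: that cyclically_reduced_rotate1 cyclically_reduced_invert_gens)
  show "length w = length r"
    by (rule variant_induct[OF v, of "\<lambda>w. length w = length r"]) (simp_all add: invert_gens_def)
  have 1: "t_exp_sum (rotate1 u) = t_exp_sum u" for u by (cases u) (simp_all add: t_exp_sum_def)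
  have 2: "t_exp_sum (invert_gens ea et u) = (if et then - t_exp_sum u else t_exp_sum u)" for ea et u
    by (induction u) (auto simp: t_exp_sum_def invert_gens_def)
  show "t_exp_sum w = 0" if "t_exp_sum r = 0"
    by (rule variant_induct[OF v, of "\<lambda>w. t_exp_sum w = 0"]) (simp_all add: that 1 2)
  have "fst ` set (invert_gens ea et u) = fst ` set u" for ea et u
    by (force simp: invert_gens_def image_image)
  then show "fst ` set w = fst ` set r"
    by (intro variant_induct[OF v, of "\<lambda>w. fst ` set w = fst ` set r"]) simp_all
qed

text \<open>Adjacent letters on the same generator that do not cancel are equal.\<close>

lemma reduced_const:
  "reduced (l # u) \<Longrightarrow> fst ` set u \<subseteq> {fst l} \<Longrightarrow> u = replicate (length u) l"
proof (induction u arbitrary: l)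
  case (Cons m u)
  then have "m \<noteq> inv_letter l" "fst m = fst l" by auto
  then have "m = l" by (cases m; cases l) (auto simp: inv_letter_def)
  then show ?case using Cons by simp
qed simp

text \<open>Witnesses are pulled back by the transport lemmas. For the listed words the point is
  that rotations, generator inversions and inversion of the relator commute up to changing the
  amount of rotation, so their composite again has the shape in \<open>equiv_word\<close>.\<close>

lemma good_variant:
  assumes "variant r w" "good w"
  shows "good r"
proof -
  obtain k ea et where w: "w = rotate k (invert_gens ea et r)" using assms(1) unfolding variant_def by blast
  have inv1: "\<exists>j. inv_word (rotate1 u) = rotate j (inv_word u)" for u :: "gen letter list"
  proof (cases u)
    case (Cons l v)
    have "inv_word (rotate1 u) = rotate (length (inv_word v)) (inv_word u)"
      by (simp add: Cons inv_word_append inv_word_Cons rotate_append)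
    then show ?thesis by blast
  qed (auto intro!: exI[of _ 0])
  have inv: "\<exists>j. inv_word (rotate i u) = rotate j (inv_word u)" for i and u :: "gen letter list"
  proof (induction i)
    case (Suc i)
    then obtain j where j: "inv_word (rotate i u) = rotate j (inv_word u)" by blast
    obtain j' where "inv_word (rotate1 (rotate i u)) = rotate j' (inv_word (rotate i u))" using inv1 by blast
    then show ?case using j by (auto simp: rotate_rotate)
  qed (auto intro!: exI[of _ 0])
  have invI: "inv_word (invert_gens ea et u) = invert_gens ea et (inv_word u)" for ea et and u :: "gen letter list"
    by (induction u) (auto simp: inv_word_def invert_gens_def inv_letter_def)
  have ew: "equiv_word r v" if e: "equiv_word w v" for v
  proof -
    obtain s i ea' et' where s: "s \<in> {w, inv_word w}" and v: "rotate i (invert_gens ea' et' s) = v"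
      using e unfolding equiv_word_def by blast
    obtain j where "inv_word w = rotate j (inv_word (invert_gens ea et r))" unfolding w using inv by blast
    then have "\<exists>s'\<in>{r, inv_word r}. \<exists>j. s = rotate j (invert_gens ea et s')"
      using s w invI by auto
    then obtain s' j where s': "s' \<in> {r, inv_word r}" "s = rotate j (invert_gens ea et s')" by blast
    then have "v = rotate (i + j) (invert_gens (ea' \<noteq> ea) (et' \<noteq> et) s')"
      using v by (simp add: invert_gens_rotate rotate_rotate invert_gens_invert_gens)
    then show ?thesis unfolding equiv_word_def using s'(1) by blast
  qed
  from assms(2) consider "has_witness w" | "is_exc w" unfolding good_def by blast
  then show ?thesis
  proof cases
    case 1
    then have "has_witness (invert_gens ea et r)" unfolding w by (rule has_witness_rotate)
    then show ?thesis unfolding good_def using has_witness_invert_gens by blast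
  next
    case 2
    then show ?thesis unfolding good_def is_exc_def using ew by blast
  qed
qed

text \<open>Rotate a longest power of a to the front.\<close>

lemma normal_variant:
  assumes cr: "cyclically_reduced r" and t: "t_exp_sum r = 0" and np: "\<not> is_power_of_a r"
  obtains n u where "n > 0" "variant r (replicate n (Ga, True) @ (Gt, True) # u)" "no_run n u"
    "fst (last ((Gt, True) # u)) = Gt"
proof -
  have red: "reduced r" using cr by (simp add: cyclically_reduced_def)
  have ne: "r \<noteq> []" using np by (auto simp: is_power_of_a_def apow_def intro: exI[of _ 0])
  then obtain l0 u0 where r: "r = l0 # u0" by (cases r) auto
  have Gt: "Gt \<in> fst ` set r"
  proof (rule ccontr)
    assume "Gt \<notin> fst ` set r"
    then have a: "fst l = Ga" if l: "l \<in> set r" for l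
      using imageI[OF l, of fst] by (cases "fst l") simp_all
    then have "u0 = replicate (length u0) l0" using red r by (intro reduced_const) auto
    then have "r = replicate (length r) l0" using r by simp
    moreover have "fst l0 = Ga" using a[of l0] r by simp
    then obtain e where "l0 = (Ga, e)" by (cases l0) simp
    ultimately have "r = apow (if e then int (length r) else - int (length r))"
      using ne by (cases e) (auto simp: apow_def)
    then show False using np unfolding is_power_of_a_def by blast
  qed
  \<comment> \<open>A reduced nonempty word in t alone is t^m with m nonzero, against exponent sum
    0.\<close>
  have Ga: "Ga \<in> fst ` set r"
  proof (rule ccontr)
    assume "Ga \<notin> fst ` set r"
    then have a: "fst l = Gt" if l: "l \<in> set r" for l
      using imageI[OF l, of fst] by (cases "fst l") simp_all
    then have "u0 = replicate (length u0) l0" using red r by (intro reduced_const) auto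
    then have rr: "r = replicate (Suc (length u0)) l0" using r by simp
    have "fst l0 = Gt" using a[of l0] r by simp
    then obtain e where "l0 = (Gt, e)" by (cases l0) simp
    then have s: "t_exp_sum (replicate k l0) = (if e then int k else - int k)" for k
      by (induction k) (simp_all add: t_exp_sum_Cons, simp add: t_exp_sum_def)
    have "t_exp_sum r = t_exp_sum (replicate (Suc (length u0)) l0)" by (rule arg_cong[OF rr])
    then have "(if e then int (Suc (length u0)) else - int (Suc (length u0))) = 0"
      unfolding s t by (rule sym)
    then show False by (cases e) simp_all
  qed
  define P where "P n \<longleftrightarrow> (\<exists>v. variant r (replicate n (Ga, True) @ v))" for n
  \<comment> \<open>Any run of n equal letters a or a^-1 in any variant can be rotated to the front
    and made positive, so \<open>P\<close> bounds all runs, also those that arise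
    cyclically.\<close>
  have flip: "P n" if v: "variant r (u @ replicate n (Ga, e) @ v)" for n u e v
  proof -
    have "variant r (rotate (length u) (u @ replicate n (Ga, e) @ v))" using v by (rule variant_rotate)
    then have "variant r (replicate n (Ga, e) @ v @ u)" by (simp add: rotate_append)
    then have "variant r (invert_gens (\<not> e) False (replicate n (Ga, e) @ v @ u))" by (rule variant_invert_gens)
    moreover have "invert_gens (\<not> e) False (replicate n (Ga, e) @ w) = replicate n (Ga, True) @ invert_gens (\<not> e) False w" for w
      by (simp add: invert_gens_def)
    ultimately show ?thesis unfolding P_def by auto
  qed
  have P1: "P 1"
  proof -
    obtain e where "(Ga, e) \<in> set r" using Ga by auto
    then obtain u v where "r = u @ replicate 1 (Ga, e) @ v" by (auto dest: split_list)
    then show ?thesis using flip variant_refl by metis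
  qed
  have bound: "n \<le> length r" if "P n" for n
    using that unfolding P_def using variant_props(2) by (metis le_add1 length_append length_replicate)
  define n where "n = Greatest P"
  have Pn: "P n" unfolding n_def by (rule GreatestI_nat[of P 1 "length r", OF P1 bound])
  have max: "m \<le> n" if "P m" for m unfolding n_def by (rule Greatest_le_nat[of P m "length r", OF that bound])
  have n: "n > 0" using max[OF P1] by simp
  obtain v where v: "variant r (replicate n (Ga, True) @ v)" using Pn unfolding P_def by blast
  define w where "w = replicate n (Ga, True) @ v"
  have crw: "cyclically_reduced w" using variant_props(1)[OF v cr] by (simp add: w_def)
  have "v \<noteq> []"
  proof
    assume "v = []"
    then have "Gt \<notin> fst ` set w" using n by (auto simp: w_def)
    then show False using variant_props(4)[OF v] Gt by (simp add: w_def)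
  qed
  then obtain z u where zu: "v = z # u" by (cases v) auto
  have "z \<noteq> (Ga, True)"
  proof
    assume "z = (Ga, True)"
    then have "replicate n (Ga, True) @ v = [] @ replicate (Suc n) (Ga, True) @ u"
      by (simp add: zu replicate_app_Cons_same)
    then have "P (Suc n)" using flip v by metis
    then show False using max by fastforce
  qed
  moreover have "z \<noteq> (Ga, False)"
  proof
    assume z: "z = (Ga, False)"
    obtain m where m: "n = Suc m" using n by (cases n) auto
    have "w = replicate m (Ga, True) @ (Ga, True) # (Ga, False) # u"
      by (simp add: w_def zu z m replicate_app_Cons_same flip: replicate_Suc)
    moreover have "reduced w" using crw by (simp add: cyclically_reduced_def)
    moreover have "\<not> reduced (replicate m x @ (Ga, True) # (Ga, False) # u)" for x
    proof (induction m)
      case (Suc m)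
      then show ?case using reduced_tl by (metis append_Cons replicate_Suc)
    qed (simp add: inv_letter_def)
    ultimately show False by blast
  qed
  ultimately obtain e where z: "z = (Gt, e)" by (cases z) (metis (full_types) gen.exhaust)
  \<comment> \<open>A final a would prolong the leading run after a rotation, and a final a^-1 would
    cancel against it cyclically.\<close>
  have last: "fst (last v) = Gt"
  proof (rule ccontr)
    assume "fst (last v) \<noteq> Gt"
    then obtain f where f: "last v = (Ga, f)" by (metis gen.exhaust prod.collapse)
    then have u: "u \<noteq> []" using zu z by auto
    have hl: "hd w = (Ga, True)" "last w = (Ga, f)" "w \<noteq> []" using n f zu by (auto simp: w_def hd_append)
    show False
    proof (cases f)
      case True
      have "w = (replicate n (Ga, True) @ butlast v) @ [(Ga, True)]"
        using f True zu by (simp add: w_def) (metis append_butlast_last_id list.discI)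
      then have "variant r (rotate (length (replicate n (Ga, True) @ butlast v)) ((replicate n (Ga, True) @ butlast v) @ [(Ga, True)]))"
        using v variant_rotate unfolding w_def by metis
      then have "variant r ([(Ga, True)] @ replicate n (Ga, True) @ butlast v)" unfolding rotate_append by simp
      then have "P (Suc n)" unfolding P_def by auto
      then show False using max by fastforce
    next
      case False
      then show False using crw hl by (simp add: cyclically_reduced_def inv_letter_def)
    qed
  qed
  have nr: "no_run n u"
    unfolding no_run_def
  proof (intro allI notI)
    fix e' p q assume "u = p @ replicate (Suc n) (Ga, e') @ q"
    then have "replicate n (Ga, True) @ v = (replicate n (Ga, True) @ z # p) @ replicate (Suc n) (Ga, e') @ q"
      using zu by simp
    then have "P (Suc n)" using flip v by metis
    then show False using max by fastforce
  qed
  have app: "invert_gens False (\<not> e) (x @ y) = invert_gens False (\<not> e) x @ invert_gens False (\<not> e) y" for x y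
    by (simp add: invert_gens_def)
  have a: "invert_gens False (\<not> e) (replicate m (Ga, f)) = replicate m (Ga, f)" for m f
    by (simp add: invert_gens_def)
  \<comment> \<open>Inverting t if necessary makes the first letter after the run positive and
    leaves the runs of a untouched.\<close>
  let ?u = "invert_gens False (\<not> e) u"
  have "variant r (invert_gens False (\<not> e) (replicate n (Ga, True) @ v))" using v by (rule variant_invert_gens)
  then have 1: "variant r (replicate n (Ga, True) @ (Gt, True) # ?u)"
    by (simp add: app a zu z invert_gens_Cons)
  have 2: "no_run n ?u"
    unfolding no_run_def
  proof (intro allI notI)
    fix e' p q assume "?u = p @ replicate (Suc n) (Ga, e') @ q"
    then have "invert_gens False (\<not> e) ?u = invert_gens False (\<not> e) p @ replicate (Suc n) (Ga, e') @ invert_gens False (\<not> e) q"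
      by (simp only: app a)
    moreover have "invert_gens False (\<not> e) ?u = u"
    proof -
      have "invert_gens False False u = u" by (induction u) (auto simp: invert_gens_def)
      then show ?thesis by (simp add: invert_gens_invert_gens)
    qed
    ultimately show False using nr unfolding no_run_def by metis
  qed
  have 3: "fst (last ((Gt, True) # ?u)) = Gt"
  proof (cases "u = []")
    case False
    then have "fst (last ?u) = fst (last u)" by (simp add: invert_gens_def last_map case_prod_unfold)
    then show ?thesis using last False zu by (simp add: invert_gens_def)
  qed (simp add: invert_gens_Nil)
  show thesis by (rule that[OF n 1 2 3])
qed

section \<open>Finite metabelian quotients\<close>

definition lval :: "('g, 'b) monoid_scheme \<Rightarrow> ('x \<Rightarrow> 'g) \<Rightarrow> 'x letter \<Rightarrow> 'g" where
  "lval G f l = (if snd l then f (fst l) else inv\<^bsub>G\<^esub> f (fst l))"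

fun weval :: "('g, 'b) monoid_scheme \<Rightarrow> ('x \<Rightarrow> 'g) \<Rightarrow> 'x letter list \<Rightarrow> 'g" where
  "weval G f [] = \<one>\<^bsub>G\<^esub>"
| "weval G f (l # w) = lval G f l \<otimes>\<^bsub>G\<^esub> weval G f w"

context group
begin

lemma inv_mult_cancel:
  "x \<in> carrier G \<Longrightarrow> z \<in> carrier G \<Longrightarrow> inv x \<otimes> (x \<otimes> z) = z"
  "x \<in> carrier G \<Longrightarrow> z \<in> carrier G \<Longrightarrow> x \<otimes> (inv x \<otimes> z) = z"
  by (simp_all flip: m_assoc)

lemma lval_closed: "(\<And>x. f x \<in> carrier G) \<Longrightarrow> lval G f l \<in> carrier G"
  by (simp add: lval_def)

lemma weval_closed: "(\<And>x. f x \<in> carrier G) \<Longrightarrow> weval G f w \<in> carrier G"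
  by (induction w) (simp_all add: lval_closed)

lemma lval_inv_letter: "(\<And>x. f x \<in> carrier G) \<Longrightarrow> lval G f (inv_letter l) = inv (lval G f l)"
  by (simp add: lval_def inv_letter_def)

lemma weval_append:
  "(\<And>x. f x \<in> carrier G) \<Longrightarrow> weval G f (u @ v) = weval G f u \<otimes> weval G f v"
  by (induction u) (simp_all add: weval_closed lval_closed m_assoc)

lemma weval_reduce:
  assumes f: "\<And>x. f x \<in> carrier G"
  shows "weval G f (reduce w) = weval G f w"
proof (induction w)
  case (Cons l w)
  have "weval G f (cons_red l v) = weval G f (l # v)" for v
  proof (cases v)
    case (Cons m u)
    show ?thesis
    proof (cases "m = inv_letter l")
      case True
      have "lval G f l \<otimes> (inv (lval G f l) \<otimes> weval G f u) = weval G f u"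
        using weval_closed[of f u, OF f] lval_closed[of f l, OF f] by (simp flip: m_assoc)
      then show ?thesis using Cons True lval_inv_letter[of f l, OF f] by (simp add: cons_red_def)
    qed (simp add: Cons cons_red_def)
  qed (simp add: cons_red_def)
  then show ?case using Cons by (simp add: reduce_Cons)
qed simp

lemma weval_inv_word:
  assumes f: "\<And>x. f x \<in> carrier G"
  shows "weval G f (inv_word w) = inv (weval G f w)"
  by (induction w)
    (simp_all add: inv_word_Cons weval_append[OF f] lval_inv_letter[OF f] lval_closed[OF f] weval_closed[OF f] inv_mult_group)

lemma weval_rotate1:
  assumes f: "\<And>x. f x \<in> carrier G" and w: "weval G f w = \<one>"
  shows "weval G f (rotate1 w) = \<one>"
proof (cases w)
  case (Cons l u)
  then have "lval G f l \<otimes> weval G f u = \<one>" using w by simp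
  then have "weval G f u \<otimes> lval G f l = \<one>"
    using lval_closed[of f l, OF f] weval_closed[of f u, OF f] inv_comm by blast
  then show ?thesis
    by (simp add: Cons weval_append[OF f] lval_closed[OF f])
qed simp

lemma weval_rotate:
  assumes f: "\<And>x. f x \<in> carrier G" and w: "weval G f w = \<one>"
  shows "weval G f (rotate k w) = \<one>"
  by (induction k) (simp_all add: w weval_rotate1[OF f])

lemma weval_invert_gens:
  assumes f: "\<And>x. f x \<in> carrier G"
  shows "weval G f (invert_gens ea et w) =
    weval G (\<lambda>x. if x = Ga \<and> ea \<or> x = Gt \<and> et then inv (f x) else f x) w"
  by (induction w) (auto simp: invert_gens_def lval_def f)

lemma weval_apow:
  assumes f: "\<And>x. f x \<in> carrier G"
  shows "weval G f (apow k) = f Ga [^] k"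
proof -
  have 1: "weval G f (replicate n (Ga, True)) = f Ga [^] n" for n
  proof (induction n)
    case (Suc n)
    then show ?case by (simp only: replicate_Suc weval.simps lval_def fst_conv snd_conv if_True nat_pow_Suc2[OF f])
  qed simp
  have 2: "weval G f (replicate n (Ga, False)) = inv (f Ga) [^] n" for n
  proof (induction n)
    case (Suc n)
    then show ?case by (simp only: replicate_Suc weval.simps lval_def fst_conv snd_conv if_False nat_pow_Suc2[OF inv_closed[OF f]])
  qed simp
  show ?thesis
    unfolding apow_def int_pow_def2 using 1[of "nat k"] 2[of "nat (- k)"]
    by (cases "k < 0") (simp_all only: nat_pow_inv[OF f], simp_all)
qed

lemma int_pow_conj:
  assumes "x \<in> carrier G" "g \<in> carrier G"
  shows "g \<otimes> x [^] (k::int) \<otimes> inv g = (g \<otimes> x \<otimes> inv g) [^] k"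
proof -
  have n: "g \<otimes> x [^] (n::nat) \<otimes> inv g = (g \<otimes> x \<otimes> inv g) [^] n" if "x \<in> carrier G" for n x
  proof (induction n)
    case (Suc n)
    have "g \<otimes> x [^] Suc n \<otimes> inv g = (g \<otimes> x [^] n \<otimes> inv g) \<otimes> (g \<otimes> x \<otimes> inv g)"
      using that assms by (simp add: m_assoc inv_mult_cancel)
    then show ?case using Suc by simp
  qed (use assms in simp)
  have y: "g \<otimes> inv x \<otimes> inv g = inv (g \<otimes> x \<otimes> inv g)" "g \<otimes> x \<otimes> inv g \<in> carrier G"
    using assms by (simp_all add: inv_mult_group m_assoc)
  have i: "g \<otimes> inv (x [^] m) \<otimes> inv g = inv ((g \<otimes> x \<otimes> inv g) [^] m)" for m :: nat
    using n[OF inv_closed[OF assms(1)], of m]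
    unfolding y(1) nat_pow_inv[OF y(2)] nat_pow_inv[OF assms(1)] .
  show ?thesis
    unfolding int_pow_def2 using i[of "nat (- k)"] n[OF assms(1), of "nat k"]
    by (cases "k < 0") (simp_all only: if_True if_False)
qed

end

text \<open>The law that commutators commute, for the subgroup generated by the values of
  \<open>f\<close>. Stated for words, it can be read in any group that the free group maps
  to.\<close>

definition metabelian_words :: "('g, 'b) monoid_scheme \<Rightarrow> (gen \<Rightarrow> 'g) \<Rightarrow> bool" where
  "metabelian_words G f \<longleftrightarrow> (\<forall>x y z v. 
     weval G f ((x @ y @ inv_word x @ inv_word y) @ (z @ v @ inv_word z @ inv_word v)) =
     weval G f ((z @ v @ inv_word z @ inv_word v) @ (x @ y @ inv_word x @ inv_word y)))"

context group
begin

text \<open>The subgroup generated by a and t is the product of the cyclic group \<open>?C\<close>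
  of a and the powers of t. Its quotient by \<open>?C\<close> is cyclic, so commutators lie in
  \<open>?C\<close> and commute.\<close>

lemma metabelian_if_normalized:
  assumes f: "\<And>x. f x \<in> carrier G"
    and n: "\<And>c. c \<in> generate G {f Ga} \<Longrightarrow> f Gt \<otimes> c \<otimes> inv (f Gt) \<in> generate G {f Ga}"
      "\<And>c. c \<in> generate G {f Ga} \<Longrightarrow> inv (f Gt) \<otimes> c \<otimes> f Gt \<in> generate G {f Ga}"
  shows "metabelian_words G f"
proof -
  let ?C = "generate G {f Ga}" and ?t = "f Gt"
  have sg: "subgroup ?C G" using generate_is_subgroup f by blast
  have Cc: "c \<in> carrier G" if "c \<in> ?C" for c using that subgroup.mem_carrier[OF sg] by blast
  have com: "c \<otimes> d = d \<otimes> c" if "c \<in> ?C" "d \<in> ?C" for c d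
    using that unfolding generate_pow[OF f] by (auto simp: f int_pow_mult[symmetric] add.commute)
  have conj: "?t [^] i \<otimes> c \<otimes> inv (?t [^] i) \<in> ?C" if "c \<in> ?C" for i :: int and c
    using that
  proof (induction i arbitrary: c rule: int_induct[where k = 0])
    case base
    then show ?case using Cc by simp
  next
    case (step1 i)
    have "?t [^] (i + 1) \<otimes> c \<otimes> inv (?t [^] (i + 1)) = ?t [^] i \<otimes> (?t \<otimes> c \<otimes> inv ?t) \<otimes> inv (?t [^] i)"
      using Cc[OF step1.prems] f by (simp add: int_pow_mult inv_mult_group m_assoc)
    then show ?case using step1.IH n(1)[OF step1.prems] by simp
  next
    case (step2 i)
    have "?t [^] (i - 1) \<otimes> c \<otimes> inv (?t [^] (i - 1)) = ?t [^] i \<otimes> (inv ?t \<otimes> c \<otimes> ?t) \<otimes> inv (?t [^] i)"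
      using Cc[OF step2.prems] f by (simp add: int_pow_diff inv_mult_group m_assoc)
    then show ?case using step2.IH n(2)[OF step2.prems] by simp
  qed
  \<comment> \<open>The multiplication rule of a semidirect product, for the form c t^i.\<close>
  have mul: "c \<otimes> ?t [^] i \<otimes> (d \<otimes> ?t [^] j) = (c \<otimes> (?t [^] i \<otimes> d \<otimes> inv (?t [^] i))) \<otimes> ?t [^] (i + j)"
    if "c \<in> ?C" "d \<in> ?C" for c d and i j :: int
    using Cc[OF that(1)] Cc[OF that(2)] f by (simp add: int_pow_mult m_assoc inv_mult_cancel)
  have form: "\<exists>c\<in>?C. weval G f w = c \<otimes> ?t [^] t_exp_sum w" for w
  proof (induction w)
    case Nil
    then show ?case using subgroup.one_closed[OF sg] by (auto simp: t_exp_sum_def intro!: bexI[of _ \<one>])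
  next
    case (Cons l w)
    then obtain c where c: "c \<in> ?C" "weval G f w = c \<otimes> ?t [^] t_exp_sum w" by blast
    have "\<exists>d\<in>?C. lval G f l = d \<otimes> ?t [^] t_exp_sum [l]"
    proof (cases "fst l")
      case Ga
      have "f Ga \<in> ?C" by (simp add: generate.incl)
      then have "lval G f l \<in> ?C" using Ga subgroup.m_inv_closed[OF sg] by (simp add: lval_def)
      then show ?thesis using Ga Cc by (auto simp: t_exp_sum_def intro!: bexI[of _ "lval G f l"])
    next
      case Gt
      then have "lval G f l = \<one> \<otimes> ?t [^] t_exp_sum [l]"
        using f by (simp add: lval_def t_exp_sum_def int_pow_neg)
      then show ?thesis using subgroup.one_closed[OF sg] by blast
    qed
    then obtain d where d: "d \<in> ?C" "lval G f l = d \<otimes> ?t [^] t_exp_sum [l]" by blast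
    have "t_exp_sum (l # w) = t_exp_sum [l] + t_exp_sum w" by (simp add: t_exp_sum_def)
    then have "weval G f (l # w) = (d \<otimes> (?t [^] t_exp_sum [l] \<otimes> c \<otimes> inv (?t [^] t_exp_sum [l]))) \<otimes> ?t [^] t_exp_sum (l # w)"
      using c d mul by simp
    then show ?case using conj[OF c(1)] subgroup.m_closed[OF sg d(1)] by blast
  qed
  have comm: "weval G f (x @ y @ inv_word x @ inv_word y) \<in> ?C" for x y
  proof -
    obtain c where c: "c \<in> ?C" "weval G f x = c \<otimes> ?t [^] t_exp_sum x" using form by blast
    obtain d where d: "d \<in> ?C" "weval G f y = d \<otimes> ?t [^] t_exp_sum y" using form by blast
    let ?i = "t_exp_sum x" and ?j = "t_exp_sum y"
    define e where "e = c \<otimes> (?t [^] ?i \<otimes> d \<otimes> inv (?t [^] ?i))"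
    define e' where "e' = d \<otimes> (?t [^] ?j \<otimes> c \<otimes> inv (?t [^] ?j))"
    have e: "e \<in> ?C" "e' \<in> ?C"
      unfolding e_def e'_def using conj[OF c(1)] conj[OF d(1)] subgroup.m_closed[OF sg] c d by blast+
    \<comment> \<open>Both products end in the same power of t, which therefore drops out of the
      commutator.\<close>
    have xy: "weval G f x \<otimes> weval G f y = e \<otimes> ?t [^] (?i + ?j)"
      "weval G f y \<otimes> weval G f x = e' \<otimes> ?t [^] (?i + ?j)"
      unfolding c d e_def e'_def by (rule mul[OF c(1) d(1)]) (simp add: mul[OF d(1) c(1)] add.commute)
    have "weval G f (x @ y @ inv_word x @ inv_word y) = (weval G f x \<otimes> weval G f y) \<otimes> inv (weval G f y \<otimes> weval G f x)"
      by (simp add: weval_append[OF f] weval_inv_word[OF f] weval_closed[OF f] inv_mult_group m_assoc)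
    also have "\<dots> = e \<otimes> inv e'"
      unfolding xy using Cc[OF e(1)] Cc[OF e(2)] f
      by (simp add: inv_mult_group m_assoc inv_mult_cancel)
    finally show ?thesis
      using e subgroup.m_closed[OF sg] subgroup.m_inv_closed[OF sg] by simp
  qed
  show ?thesis
    unfolding metabelian_words_def
  proof (intro allI)
    fix x y z v :: "gen letter list"
    let ?A = "x @ y @ inv_word x @ inv_word y" and ?B = "z @ v @ inv_word z @ inv_word v"
    show "weval G f (?A @ ?B) = weval G f (?B @ ?A)"
      unfolding weval_append[of f ?A ?B, OF f] weval_append[of f ?B ?A, OF f] by (rule com[OF comm comm])
  qed
qed

text \<open>Conjugation by t maps the cyclic group of a into itself and is injective; by finiteness
  it is onto, so the inverse of t normalises this group too.\<close>

lemma metabelian_if_conj_in: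
  assumes fin: "finite (carrier G)" and f: "\<And>x. f x \<in> carrier G"
    and b: "f Gt \<otimes> f Ga \<otimes> inv (f Gt) \<in> generate G {f Ga}"
  shows "metabelian_words G f"
proof -
  let ?C = "generate G {f Ga}" and ?t = "f Gt"
  have sg: "subgroup ?C G" using generate_is_subgroup f by blast
  have Cc: "?C \<subseteq> carrier G" using subgroup.subset[OF sg] .
  have n1: "?t \<otimes> c \<otimes> inv ?t \<in> ?C" if c: "c \<in> ?C" for c
  proof -
    obtain k :: int where "c = f Ga [^] k" using c unfolding generate_pow[OF f] by blast
    then show ?thesis using int_pow_conj[OF f f] subgroup_int_pow_closed[OF sg b] by simp
  qed
  have inj: "inj_on (\<lambda>c. ?t \<otimes> c \<otimes> inv ?t) ?C"
    using Cc f by (intro inj_onI) (auto simp: subset_iff)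
  have "(\<lambda>c. ?t \<otimes> c \<otimes> inv ?t) ` ?C = ?C"
    using n1 finite_subset[OF Cc fin] by (intro endo_inj_surj inj) auto
  then have n2: "inv ?t \<otimes> c \<otimes> ?t \<in> ?C" if "c \<in> ?C" for c
  proof -
    from that \<open>_ = ?C\<close> obtain d where d: "d \<in> ?C" "c = ?t \<otimes> d \<otimes> inv ?t" by blast
    have "inv ?t \<otimes> c \<otimes> ?t = d"
      unfolding d using subsetD[OF Cc d(1)] f by (simp add: m_assoc inv_mult_cancel)
    then show ?thesis using d by simp
  qed
  from metabelian_if_normalized[of f, OF f n1 n2] show ?thesis .
qed

text \<open>Inverting generators is a bijection of the set of all words that respects the commutator
  pattern, so the law for the twisted values is the law for \<open>f\<close>.\<close>

lemma metabelian_words_invert_gens: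
  assumes f: "\<And>x. f x \<in> carrier G"
    and m: "metabelian_words G (\<lambda>x. if x = Ga \<and> ea \<or> x = Gt \<and> et then inv (f x) else f x)"
  shows "metabelian_words G f"
proof -
  let ?I = "invert_gens ea et"
  have app: "?I (u @ v) = ?I u @ ?I v" for u v by (simp add: invert_gens_def)
  have inv: "?I (inv_word u) = inv_word (?I u)" for u
    by (induction u) (auto simp: inv_word_def invert_gens_def inv_letter_def)
  have id: "?I (?I u) = u" for u
    by (induction u) (auto simp: invert_gens_def split: if_splits)
  show ?thesis
    unfolding metabelian_words_def
  proof (intro allI)
    fix x y z v :: "gen letter list"
    show "weval G f ((x @ y @ inv_word x @ inv_word y) @ (z @ v @ inv_word z @ inv_word v)) =
     weval G f ((z @ v @ inv_word z @ inv_word v) @ (x @ y @ inv_word x @ inv_word y))"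
      using m[unfolded metabelian_words_def weval_invert_gens[of f, OF f, symmetric], rule_format, of "?I x" "?I y" "?I z" "?I v"]
      unfolding app inv id .
  qed
qed

end

text \<open>Let p be the least prime factor of n. Then n is coprime to p - 1, so raising to the
  power n is injective on the units modulo p, and i + 1 would be congruent to i.\<close>

lemma dvd_power_diff_imp_1:
  fixes n i :: nat
  assumes n: "n \<noteq> 0" and c: "[(i + 1) ^ n = i ^ n] (mod n)"
  shows "n = 1"
proof (rule ccontr)
  assume "n \<noteq> 1"
  then obtain p0 where "Factorial_Ring.prime p0" "p0 dvd n" using prime_factor_nat by blast
  define p where "p = (LEAST p. Factorial_Ring.prime p \<and> p dvd n)"
  have p: "Factorial_Ring.prime p" "p dvd n"
    unfolding p_def using LeastI[of "\<lambda>p. Factorial_Ring.prime p \<and> p dvd n" p0] \<open>Factorial_Ring.prime p0\<close> \<open>p0 dvd n\<close> by blast+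
  have least: "p \<le> q" if "Factorial_Ring.prime q" "q dvd n" for q
    unfolding p_def using that by (intro Least_le) blast
  have cop: "coprime n (p - 1)"
  proof (rule ccontr)
    assume "\<not> coprime n (p - 1)"
    then obtain q where q: "Factorial_Ring.prime q" "q dvd n" "q dvd p - 1"
      using prime_factor_nat[of "gcd n (p - 1)"] by (auto simp: coprime_iff_gcd_eq_1)
    have "q \<le> p - 1" using q(3) prime_gt_1_nat[OF p(1)] by (intro dvd_imp_le) auto
    then show False using least[OF q(1,2)] prime_gt_1_nat[OF p(1)] by linarith
  qed
  \<comment> \<open>\<open>x\<close> inverts \<open>n\<close> modulo p - 1: by Fermat the power
    \<open>n * x\<close> is the identity on units modulo p. That i and i + 1 are units follows
    because p would otherwise divide both.\<close>
  obtain x y where xy: "n * x = (p - 1) * y + 1"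
    using bezout_nat[OF n, of "p - 1"] cop by auto
  have cp: "[(i + 1) ^ n = i ^ n] (mod p)" using c p(2) unfolding cong_def by (metis mod_mod_cancel)
  have ndvd: "\<not> p dvd i" "\<not> p dvd i + 1"
  proof -
    have *: "p dvd (i + 1) ^ n \<longleftrightarrow> p dvd i ^ n" using cp by (rule cong_dvd_iff[rotated])
    then have "p dvd i + 1 \<longleftrightarrow> p dvd i"
      using p(1) n by (simp add: prime_dvd_power_iff)
    moreover have "\<not> (p dvd i \<and> p dvd i + 1)"
      using p(1) by (metis dvd_add_right_iff not_prime_unit)
    ultimately show "\<not> p dvd i" "\<not> p dvd i + 1" by blast+
  qed
  have fl: "[a ^ (n * x) = a] (mod p)" if "\<not> p dvd a" for a
  proof -
    have "[a ^ (p - 1) = 1] (mod p)" using fermat_theorem[OF p(1) that] .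
    then have "[(a ^ (p - 1)) ^ y * a = 1 ^ y * a] (mod p)" by (intro cong_mult cong_pow) auto
    then show ?thesis by (simp only: xy power_mult power_add power_one power_one_right mult_1)
  qed
  have "[((i + 1) ^ n) ^ x = (i ^ n) ^ x] (mod p)" using cp by (rule cong_pow)
  then have "[i + 1 = i] (mod p)"
    using fl[OF ndvd(1)] fl[OF ndvd(2)] by (metis cong_sym cong_trans power_mult)
  then have "[1 = 0] (mod p)" using cong_add_lcancel_nat[of i 1 0 p] by simp
  then show False using p(1) by (simp add: cong_0_iff)
qed

context group
begin

lemma ord_conj:
  assumes "x \<in> carrier G" "g \<in> carrier G"
  shows "ord (g \<otimes> x \<otimes> inv g) = ord x"
proof -
  have "(g \<otimes> x \<otimes> inv g) [^] n = \<one> \<longleftrightarrow> x [^] n = \<one>" for n :: nat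
  proof -
    have "(g \<otimes> x \<otimes> inv g) [^] n = g \<otimes> x [^] n \<otimes> inv g"
      using int_pow_conj[OF assms, of "int n", symmetric] unfolding int_pow_int .
    moreover have "z = \<one>" if z: "z \<in> carrier G" and e: "g \<otimes> z \<otimes> inv g = \<one>" for z
    proof -
      have "inv g \<otimes> (g \<otimes> z \<otimes> inv g) \<otimes> g = z"
        using z assms by (simp add: m_assoc inv_mult_cancel)
      then show ?thesis unfolding e using assms by simp
    qed
    from this[of "x [^] n"] have "g \<otimes> x [^] n \<otimes> inv g = \<one> \<longleftrightarrow> x [^] n = \<one>"
      using assms by (metis nat_pow_closed r_one r_inv)
    ultimately show ?thesis by simp
  qed
  then show ?thesis using assms by (simp add: ord_unique pow_eq_id)
qed

text \<open>The usual formula for the order of a power, multiplied out so that comparing two orders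
  becomes comparing two gcds.\<close>

lemma ord_int_pow:
  assumes x: "x \<in> carrier G" and o: "ord x \<noteq> 0"
  shows "int (ord (x [^] (k::int))) * gcd (int (ord x)) k = int (ord x)"
proof -
  have "ord (x [^] k) = ord (x [^] nat \<bar>k\<bar>)"
  proof (cases "k < 0")
    case True
    then have "nat \<bar>k\<bar> = nat (- k)" by simp
    then show ?thesis unfolding int_pow_def2 if_P[OF True] using ord_inv[OF nat_pow_closed[OF x]] by (simp only:)
  next
    case False
    then have "nat \<bar>k\<bar> = nat k" by simp
    then show ?thesis unfolding int_pow_def2 if_not_P[OF False] by (simp only:)
  qed
  moreover have "ord (x [^] nat \<bar>k\<bar>) * gcd (ord x) (nat \<bar>k\<bar>) = ord x"
  proof -
    have "ord (x [^] n) * gcd (ord x) n = ord x" for n :: nat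
      using ord_pow_gen[OF x, of n] o by (cases "n = 0") simp_all
    then show ?thesis .
  qed
  ultimately have "int (ord (x [^] k) * gcd (ord x) (nat \<bar>k\<bar>)) = int (ord x)" by (simp only:)
  moreover have "gcd (int (ord x)) k = int (gcd (ord x) (nat \<bar>k\<bar>))"
    by (simp only: gcd_int_def abs_of_nat nat_int)
  ultimately show ?thesis by (simp only: of_nat_mult)
qed

lemma in_generate_pow:
  assumes x: "x \<in> carrier G" and c: "coprime (int (ord x)) k"
  shows "x \<in> generate G {x [^] k}"
proof -
  obtain u v where uv: "u * int (ord x) + v * k = 1"
    using bezout_int[of "int (ord x)" k] c by auto
  have "x = x [^] (u * int (ord x) + k * v)" using x uv by (simp add: mult.commute)
  also have "\<dots> = x [^] (u * int (ord x)) \<otimes> (x [^] k) [^] v"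
    using x by (simp add: int_pow_mult int_pow_pow)
  also have "x [^] (u * int (ord x)) = \<one>" using x by (simp add: int_pow_eq_id)
  finally have "x = (x [^] k) [^] v" using x by simp
  then show ?thesis using generate_pow[of "x [^] k"] x by blast
qed

lemma generate_sub: "x \<in> generate G {y} \<Longrightarrow> y \<in> generate G {z} \<Longrightarrow> z \<in> carrier G \<Longrightarrow> x \<in> generate G {z}"
  using generate_subgroup_incl[of "{y}" "generate G {z}"] generate_is_subgroup[of "{z}"] by blast

lemma int_pow_in_generate: "z \<in> carrier G \<Longrightarrow> y \<in> generate G {z} \<Longrightarrow> y [^] (k::int) \<in> generate G {z}"
  using subgroup_int_pow_closed generate_is_subgroup[of "{z}"] by simp

text \<open>Equal orders give m = ord c the same gcd with i and j. It divides both, so it is 1, and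
  c^i already generates c.\<close>

lemma coprime_powers_generate:
  assumes fin: "finite (carrier G)" and c: "c \<in> carrier G" and ij: "coprime (i::int) j"
    and o: "ord (c [^] i) = ord (c [^] j)"
  shows "c [^] j \<in> generate G {c [^] i}"
proof -
  have o0: "ord c \<noteq> 0" "ord (c [^] i) \<noteq> 0"
    using ord_ge_1[OF fin c] ord_ge_1[OF fin int_pow_closed[OF c, of i]] by simp_all
  have "int (ord (c [^] i)) * gcd (int (ord c)) i = int (ord (c [^] i)) * gcd (int (ord c)) j"
    using ord_int_pow[OF c o0(1), of i] ord_int_pow[OF c o0(1), of j] unfolding o by simp
  then have e: "gcd (int (ord c)) i = gcd (int (ord c)) j" using o0(2) by simp
  have "gcd (int (ord c)) i dvd j" unfolding e by simp
  then have "is_unit (gcd (int (ord c)) i)" using coprime_common_divisor[OF ij, of "gcd (int (ord c)) i"] by simp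
  then have "coprime (int (ord c)) i" by (simp only: is_unit_gcd)
  then show ?thesis using in_generate_pow[OF c] int_pow_in_generate c by simp
qed

text \<open>Put m = ord c and n = ord v. Comparing the orders of c^i, of v^2 and of c^j gives
  gcd(n,2) gcd(m,2) = gcd(m,3). The left side is a power of 2 and the right side is 1 or 3, so all
  three gcds are 1 and c and v generate the same subgroup.\<close>

lemma square_cube_generate:
  assumes fin: "finite (carrier G)" and c: "c \<in> carrier G" and v: "v \<in> carrier G"
    and i: "\<bar>i\<bar> = (2::int)" and j: "\<bar>j\<bar> = (3::int)" and vv: "v [^] (2::int) = c [^] j"
    and o: "ord (c [^] i) = ord v"
  shows "c [^] i \<in> generate G {v}" "v \<in> generate G {c [^] i}"
proof -
  have o0: "ord x \<noteq> 0" if "x \<in> carrier G" for x using ord_ge_1[OF fin that] by simp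
  let ?m = "int (ord c)" and ?n = "int (ord v)" and ?o = "int (ord (c [^] j))"
  have "?n * gcd ?m i = ?m" using ord_int_pow[OF c o0[OF c], of i] o by simp
  moreover have "?o * gcd ?n 2 = ?n" using ord_int_pow[OF v o0[OF v], of 2] vv by simp
  moreover have "?o * gcd ?m j = ?m" using ord_int_pow[OF c o0[OF c], of j] .
  ultimately have "?o * (gcd ?n 2 * gcd ?m i) = ?o * gcd ?m j" by (simp add: mult.assoc[symmetric])
  then have e: "gcd ?n 2 * gcd ?m i = gcd ?m j" using o0[of "c [^] j"] c by simp
  have ij: "gcd ?m i = gcd ?m 2" "gcd ?m j = gcd ?m 3"
    using gcd_abs2_int[of ?m i] gcd_abs2_int[of ?m j] i j by simp_all
  have g2: "gcd x 2 = 1 \<or> gcd x 2 = 2" for x :: int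
  proof -
    have "gcd x 2 \<le> 2" "gcd x 2 > 0" by (simp_all add: zdvd_imp_le)
    then show ?thesis by linarith
  qed
  have "gcd ?m 3 \<le> 3" "gcd ?m 3 > 0" by (simp_all add: zdvd_imp_le)
  moreover have "gcd ?m 3 \<noteq> 2"
  proof
    assume "gcd ?m 3 = 2"
    then have "(2::int) dvd 3" by (metis gcd_dvd2)
    then show False by simp
  qed
  ultimately have "gcd ?m 3 = 1 \<or> gcd ?m 3 = 3" by linarith
  then have "gcd ?n 2 = 1 \<and> gcd ?m i = 1 \<and> gcd ?m j = 1"
    using e g2[of ?n] g2[of ?m] unfolding ij by auto
  then have cop: "coprime ?n 2" "coprime ?m i" "coprime ?m j" by (simp_all add: coprime_iff_gcd_eq_1)
  have 1: "c \<in> generate G {c [^] i}" "c \<in> generate G {v [^] (2::int)}" "v \<in> generate G {v [^] (2::int)}"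
    using in_generate_pow[OF c cop(2)] in_generate_pow[OF c cop(3)] in_generate_pow[OF v cop(1)] vv by simp_all
  show "v \<in> generate G {c [^] i}"
    using generate_sub[OF 1(3)] int_pow_in_generate[OF _ 1(1), of j] vv c by simp
  have "v [^] (2::int) \<in> generate G {v}" using int_pow_in_generate[of v v] v by (simp add: generate.incl)
  then show "c [^] i \<in> generate G {v}"
    using int_pow_in_generate[OF v generate_sub[OF 1(2) _ v]] by simp
qed

text \<open>Iterating the relation k times gives g^k u^(i^k) g^-k = u^((i+1)^k). For k = ord u the
  conjugation disappears, and n = ord u divides (i+1)^n - i^n, which forces n = 1.\<close>

lemma trivial_if_conj_pow:
  assumes fin: "finite (carrier G)" and u: "u \<in> carrier G" and g: "g \<in> carrier G"
    and rel: "g \<otimes> u [^] (i::nat) \<otimes> inv g = u [^] (i + 1)" and o: "g [^] ord u = \<one>"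
  shows "u = \<one>"
proof -
  have conj: "g \<otimes> (u [^] a) [^] b \<otimes> inv g = (g \<otimes> u [^] a \<otimes> inv g) [^] b" for a b :: nat
    using int_pow_conj[of "u [^] a" g "int b"] u g unfolding int_pow_int by (simp only: nat_pow_closed)
  have "g [^] k \<otimes> u [^] (i ^ k) \<otimes> inv (g [^] k) = u [^] ((i + 1) ^ k)" for k :: nat
  proof (induction k)
    case (Suc k)
    let ?h = "g [^] k"
    have "g [^] Suc k \<otimes> u [^] (i ^ Suc k) \<otimes> inv (g [^] Suc k) =
        ?h \<otimes> (g \<otimes> (u [^] i) [^] (i ^ k) \<otimes> inv g) \<otimes> inv ?h"
      using u g by (simp add: nat_pow_pow inv_mult_group m_assoc)
    also have "\<dots> = ?h \<otimes> (u [^] (i + 1)) [^] (i ^ k) \<otimes> inv ?h"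
      unfolding conj rel ..
    also have "\<dots> = ?h \<otimes> (u [^] (i ^ k)) [^] (i + 1) \<otimes> inv ?h"
      using u by (simp only: nat_pow_pow mult.commute)
    also have "\<dots> = (?h \<otimes> u [^] (i ^ k) \<otimes> inv ?h) [^] (i + 1)"
      using int_pow_conj[of "u [^] (i ^ k)" ?h "int (i + 1)"] u g by (simp only: int_pow_int nat_pow_closed)
    finally show ?case using Suc u by (simp only: nat_pow_pow power_Suc mult.commute)
  qed (use u in simp)
  from this[of "ord u"] have "u [^] (i ^ ord u) = u [^] ((i + 1) ^ ord u)"
    using o u by simp
  then have "int (ord u) dvd int ((i + 1) ^ ord u) - int (i ^ ord u)"
    using int_pow_eq[OF u, of "int (i ^ ord u)" "int ((i + 1) ^ ord u)"] by (simp only: int_pow_int simp_thms)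
  then have "[(i + 1) ^ ord u = i ^ ord u] (mod ord u)"
    by (simp only: cong_iff_dvd_diff cong_int_iff[symmetric])
  moreover have "ord u \<noteq> 0" using ord_ge_1[OF fin u] by simp
  ultimately show ?thesis using dvd_power_diff_imp_1 ord_eq_1[OF u] by blast
qed

end

section \<open>From subgroups of finite index to finite quotients\<close>

context group
begin

text \<open>With a representative s chosen in the coset of g under \<open>H\<close>, the coset of g
  under \<open>K\<close> is determined by that coset and the value of \<kappa> at g s^-1. Both range
  over finite sets.\<close>

lemma finite_index_kernel:
  assumes H: "subgroup H G" and fin: "finite (rcosets H)" and P: "group P" "finite (carrier P)"
    and k: "\<kappa> \<in> hom (G\<lparr>carrier := H\<rparr>) P"
  defines "K \<equiv> {g \<in> H. \<kappa> g = \<one>\<^bsub>P\<^esub>}"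
  shows "subgroup K G" "finite (rcosets K)"
proof -
  interpret P: group P by fact
  interpret H: subgroup H G by fact
  interpret HG: group "G\<lparr>carrier := H\<rparr>" by (rule subgroup_imp_group[OF H])
  interpret k: group_hom "G\<lparr>carrier := H\<rparr>" P \<kappa> by unfold_locales (rule k)
  have kc: "\<kappa> x \<in> carrier P" if "x \<in> H" for x using k.hom_closed that by simp
  have km: "\<kappa> (x \<otimes> y) = \<kappa> x \<otimes>\<^bsub>P\<^esub> \<kappa> y" if "x \<in> H" "y \<in> H" for x y using k.hom_mult that by simp
  have ki: "\<kappa> (inv x) = inv\<^bsub>P\<^esub> \<kappa> x" if "x \<in> H" for x
    using k.hom_inv[of x] that by (simp add: m_inv_consistent[OF H that])
  have k1: "\<kappa> \<one> = \<one>\<^bsub>P\<^esub>" using k.hom_one by simp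
  show K: "subgroup K G"
  proof (rule subgroupI)
    show "K \<subseteq> carrier G" using H.subset by (auto simp: K_def)
    show "K \<noteq> {}" using H.one_closed k1 unfolding K_def by blast
    show "inv a \<in> K" if "a \<in> K" for a using that ki by (simp add: K_def)
    show "a \<otimes> b \<in> K" if "a \<in> K" "b \<in> K" for a b using that km by (simp add: K_def)
  qed
  define rep where "rep C = (SOME s. s \<in> C)" for C :: "'a set"
  define D where "D = (\<lambda>(C, \<pi>). {g \<in> C. \<kappa> (g \<otimes> inv (rep C)) = \<pi>})"
  have "rcosets K \<subseteq> D ` ((rcosets H) \<times> carrier P)"
  proof
    fix Y assume "Y \<in> rcosets K"
    then obtain g where g: "g \<in> carrier G" "Y = K #> g" by (auto simp: RCOSETS_def)
    define C where "C = H #> g"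
    define s where "s = rep C"
    have gC: "g \<in> C" unfolding C_def by (rule rcos_self[OF g(1) H])
    then have sC: "s \<in> C" unfolding s_def rep_def by (rule someI[of "\<lambda>s. s \<in> C"])
    have C: "x \<in> carrier G" if "x \<in> C" for x
      using that g(1) H.subset unfolding C_def r_coset_def by auto
    have diff: "x \<otimes> inv y \<in> H" if "x \<in> C" "y \<in> C" for x y
    proof -
      obtain a b where ab: "a \<in> H" "x = a \<otimes> g" "b \<in> H" "y = b \<otimes> g"
        using \<open>x \<in> C\<close> \<open>y \<in> C\<close> unfolding C_def r_coset_def by blast
      have "x \<otimes> inv y = a \<otimes> inv b"
        unfolding ab using H.mem_carrier[OF ab(1)] H.mem_carrier[OF ab(3)] g(1)
        by (simp add: inv_mult_group m_assoc inv_mult_cancel)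
      then show ?thesis using ab by simp
    qed
    have eq: "x \<otimes> inv s = (x \<otimes> inv g) \<otimes> (g \<otimes> inv s)" if "x \<in> carrier G" for x
      using that g(1) C[OF sC] by (simp add: m_assoc inv_mult_cancel)
    have kx: "\<kappa> (x \<otimes> inv s) = \<kappa> (x \<otimes> inv g) \<otimes>\<^bsub>P\<^esub> \<kappa> (g \<otimes> inv s)" if x: "x \<in> C" for x
      unfolding eq[OF C[OF x]] by (rule km[OF diff[OF x gC] diff[OF gC sC]])
    have "x \<in> K #> g \<longleftrightarrow> x \<in> D (C, \<kappa> (g \<otimes> inv s))" for x
    proof
      assume "x \<in> K #> g"
      then obtain a where a: "a \<in> H" "\<kappa> a = \<one>\<^bsub>P\<^esub>" "x = a \<otimes> g" by (auto simp: r_coset_def K_def)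
      then have x: "x \<in> C" unfolding C_def r_coset_def by blast
      have "x \<otimes> inv g = a" using a(3) H.mem_carrier[OF a(1)] g(1) by (simp add: m_assoc)
      then have "\<kappa> (x \<otimes> inv s) = \<kappa> (g \<otimes> inv s)"
        using kx[OF x] a(2) kc[OF diff[OF gC sC]] by simp
      then show "x \<in> D (C, \<kappa> (g \<otimes> inv s))" using x by (simp add: D_def s_def)
    next
      assume "x \<in> D (C, \<kappa> (g \<otimes> inv s))"
      then have x: "x \<in> C" and e: "\<kappa> (x \<otimes> inv s) = \<kappa> (g \<otimes> inv s)" by (simp_all add: D_def s_def)
      have "\<kappa> (x \<otimes> inv g) \<otimes>\<^bsub>P\<^esub> \<kappa> (g \<otimes> inv s) = \<one>\<^bsub>P\<^esub> \<otimes>\<^bsub>P\<^esub> \<kappa> (g \<otimes> inv s)"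
        unfolding kx[OF x, symmetric] e using kc[OF diff[OF gC sC]] by simp
      then have "\<kappa> (x \<otimes> inv g) = \<one>\<^bsub>P\<^esub>"
        unfolding P.right_cancel[OF kc[OF diff[OF gC sC]] kc[OF diff[OF x gC]] P.one_closed] .
      then have "x \<otimes> inv g \<in> K" using diff[OF x gC] by (simp add: K_def)
      moreover have "x = (x \<otimes> inv g) \<otimes> g" using C[OF x] g(1) by (simp add: m_assoc)
      ultimately show "x \<in> K #> g" unfolding r_coset_def by blast
    qed
    then have "Y = D (C, \<kappa> (g \<otimes> inv s))" using g(2) by blast
    moreover have "C \<in> rcosets H" using g(1) by (auto simp: C_def RCOSETS_def)
    ultimately show "Y \<in> D ` ((rcosets H) \<times> carrier P)"
      using kc[OF diff[OF gC sC]] by blast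
  qed
  then show "finite (rcosets K)" using fin P(2) by (meson finite_SigmaI finite_imageI finite_subset)
qed

text \<open>The inverse turns right multiplication on right cosets into a homomorphism. An element
  of its kernel fixes the coset \<open>K\<close> itself and hence lies in \<open>K\<close>.\<close>

lemma coset_action:
  assumes K: "subgroup K G"
  defines "\<phi> \<equiv> \<lambda>g. \<lambda>C\<in>rcosets K. C #> inv g"
  shows "\<phi> \<in> hom G (BijGroup (rcosets K))"
    and "\<And>g. g \<in> carrier G \<Longrightarrow> \<phi> g = \<one>\<^bsub>BijGroup (rcosets K)\<^esub> \<Longrightarrow> g \<in> K"
proof -
  have Ks: "K \<subseteq> carrier G" by (rule subgroup.subset[OF K])
  have sub: "C \<subseteq> carrier G" if "C \<in> rcosets K" for C
    using that rcosets_part_G[OF K] by blast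
  have cl: "C #> g \<in> rcosets K" if "C \<in> rcosets K" "g \<in> carrier G" for C g
    using that Ks by (auto simp: RCOSETS_def coset_mult_assoc)
  have bij: "\<phi> g \<in> Bij (rcosets K)" if g: "g \<in> carrier G" for g
  proof -
    have "bij_betw (\<phi> g) (rcosets K) (rcosets K)"
      unfolding \<phi>_def
    proof (rule bij_betw_byWitness[where f' = "\<lambda>C. C #> g"])
      show "\<forall>C\<in>rcosets K. restrict (\<lambda>C. C #> inv g) (rcosets K) C #> g = C"
        using g sub by (simp add: coset_mult_assoc coset_mult_one)
      show "\<forall>C\<in>rcosets K. restrict (\<lambda>C. C #> inv g) (rcosets K) (C #> g) = C"
        using g sub cl by (simp add: coset_mult_assoc coset_mult_one)
    qed (use g cl in auto)
    then show ?thesis by (simp add: Bij_def \<phi>_def)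
  qed
  show "\<phi> \<in> hom G (BijGroup (rcosets K))"
  proof (rule homI)
    show "\<phi> g \<in> carrier (BijGroup (rcosets K))" if "g \<in> carrier G" for g
      using bij[OF that] by (simp add: BijGroup_def)
    fix g h assume gh: "g \<in> carrier G" "h \<in> carrier G"
    have "\<phi> (g \<otimes> h) C = compose (rcosets K) (\<phi> g) (\<phi> h) C" for C
      using gh cl sub by (simp add: \<phi>_def compose_def inv_mult_group coset_mult_assoc restrict_def)
    then show "\<phi> (g \<otimes> h) = \<phi> g \<otimes>\<^bsub>BijGroup (rcosets K)\<^esub> \<phi> h"
      using bij gh by (auto simp: BijGroup_def)
  qed
  fix g assume g: "g \<in> carrier G" "\<phi> g = \<one>\<^bsub>BijGroup (rcosets K)\<^esub>"
  have KK: "K \<in> rcosets K"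
    using coset_mult_one[OF Ks] one_closed unfolding RCOSETS_def by blast
  have "K #> inv g = K" using fun_cong[OF g(2), of K] KK by (simp add: \<phi>_def BijGroup_def)
  then have "inv g \<in> K" using rcos_self[OF inv_closed[OF g(1)] K] by simp
  then show "g \<in> K" using subgroup.m_inv_closed[OF K] g(1) by fastforce
qed

end

lemma finite_BijGroup: "finite S \<Longrightarrow> finite (carrier (BijGroup S))"
proof -
  assume "finite S"
  then have "finite (S \<rightarrow>\<^sub>E S)" by (intro finite_PiE)
  moreover have "carrier (BijGroup S) \<subseteq> S \<rightarrow>\<^sub>E S"
    by (auto simp: BijGroup_def Bij_def PiE_def bij_betw_def)
  ultimately show ?thesis by (rule finite_subset[rotated])
qed

lemma weval_hom:
  assumes "group_hom G H \<phi>" "\<And>x. f x \<in> carrier G"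
  shows "\<phi> (weval G f w) = weval H (\<phi> \<circ> f) w"
proof -
  interpret group_hom G H \<phi> by fact
  have "\<phi> (lval G f l) = lval H (\<phi> \<circ> f) l" for l using assms(2) by (simp add: lval_def)
  then show ?thesis
    by (induction w) (simp_all add: G.lval_closed[OF assms(2)] G.weval_closed[OF assms(2)])
qed

lemma weval_free_group:
  "weval (free_group UNIV) (\<lambda>x. [(x, True)]) w = reduce w"
proof (induction w)
  case (Cons l w)
  have "lval (free_group UNIV) (\<lambda>x. [(x, True)]) l = [l]"
    by (cases l) (auto simp: lval_def inv_free_group carrier_free_group inv_word_def inv_letter_def)
  then show ?case using Cons reduce_append_reduce_right[of "[l]" w] by simp
qed simp

text \<open>\<open>s4x\<close> is the transposition (1 2), \<open>s4y\<close> the 4-cycle (1 2 3 4),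
  and \<open>s4z\<close> its inverse. The commutators of \<open>s4x\<close> with \<open>s4y\<close>
  and with \<open>s4z\<close> are 3-cycles on {1,2,3} and on {1,2,4}, which do not commute.\<close>

definition s4x :: "nat \<Rightarrow> nat" where "s4x = transpose 1 2"
definition s4y :: "nat \<Rightarrow> nat" where "s4y = transpose 1 2 \<circ> transpose 2 3 \<circ> transpose 3 4"
definition s4z :: "nat \<Rightarrow> nat" where "s4z = transpose 3 4 \<circ> transpose 2 3 \<circ> transpose 1 2"

lemma s4_carrier: "s4x \<in> carrier (sym_group 4)" "s4y \<in> carrier (sym_group 4)"
  unfolding s4x_def s4y_def sym_group_def
  by (auto intro!: permutes_compose permutes_swap_id)

lemma s4_inv: "inv\<^bsub>sym_group 4\<^esub> s4x = s4x" "inv\<^bsub>sym_group 4\<^esub> s4y = s4z" 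
proof -
  have "s4z \<in> carrier (sym_group 4)"
    unfolding s4z_def sym_group_def by (auto intro!: permutes_compose permutes_swap_id)
  moreover have "s4x \<otimes>\<^bsub>sym_group 4\<^esub> s4x = \<one>\<^bsub>sym_group 4\<^esub>" "s4z \<otimes>\<^bsub>sym_group 4\<^esub> s4y = \<one>\<^bsub>sym_group 4\<^esub>"
    by (simp_all add: s4x_def s4y_def s4z_def fun_eq_iff sym_group_def)
  ultimately show "inv\<^bsub>sym_group 4\<^esub> s4x = s4x" "inv\<^bsub>sym_group 4\<^esub> s4y = s4z"
    using s4_carrier by (blast intro: group.inv_equality[OF sym_group_is_group])+
qed

text \<open>Largeness sends a subgroup \<open>H\<close> of finite index onto a free group and on to
  S_4; the kernel \<open>K\<close> of this map has finite index in \<open>G\<close>. The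
  permutations of the cosets of \<open>K\<close> form a finite group \<open>Q\<close>, and whatever
  dies in \<open>Q\<close> lies in \<open>K\<close>. A double commutator dies in \<open>Q\<close> by
  assumption, yet its image in S_4 is not 1. The type of \<open>Q\<close> is that of permutations of
  sets of elements of \<open>G\<close>.\<close>

theorem not_large_if_metabelian:
  assumes red: "reduced r"
    and met: "\<And>(Q :: (gen letter list set set \<Rightarrow> gen letter list set set) monoid) f.
      group Q \<Longrightarrow> finite (carrier Q) \<Longrightarrow> (\<And>x. f x \<in> carrier Q) \<Longrightarrow> weval Q f r = \<one>\<^bsub>Q\<^esub> \<Longrightarrow> metabelian_words Q f"
  shows "\<not> large (one_rel_group r)"
proof
  define N where "N = normal_closure F2 {r}"
  define G where "G = F2 Mod N"
  assume "large (one_rel_group r)"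
  then have "large G" by (simp add: one_rel_group_def G_def N_def)
  then obtain H and B :: "nat set" and x y h where H: "subgroup H G" "finite (rcosets\<^bsub>G\<^esub> H)"
    and xy: "x \<in> B" "y \<in> B" "x \<noteq> y"
    and h: "h \<in> hom (G\<lparr>carrier := H\<rparr>) (free_group B)" "h ` H = carrier (free_group B)"
    unfolding large_def by blast
  interpret F: group F2 by (rule group_free_group)
  interpret N: normal N F2
    unfolding N_def using red by (intro normal_normal_closure group_free_group) simp
  interpret G: group G unfolding G_def by (rule N.factorgroup_is_group)
  interpret FB: group "free_group B" by (rule group_free_group)
  let ?S = "sym_group 4"
  interpret S: group ?S by (rule sym_group_is_group)
  let ?q = "\<lambda>w. N #>\<^bsub>F2\<^esub> w"
  have q: "group_hom F2 G ?q"
    unfolding G_def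
    by (intro group_hom.intro group_hom_axioms.intro F.group_axioms N.factorgroup_is_group N.r_coset_hom_Mod)
  interpret q: group_hom F2 G ?q by (rule q)
  \<comment> \<open>Two basis elements go to the transposition and the 4-cycle; any further ones go
    to the identity.\<close>
  define \<rho> where "\<rho> z = (if z = x then s4x else if z = y then s4y else \<one>\<^bsub>?S\<^esub>)" for z
  have \<rho>: "\<rho> z \<in> carrier ?S" for z using s4_carrier by (simp add: \<rho>_def)
  define \<psi> where "\<psi> = weval ?S \<rho>"
  have "\<psi> \<in> hom (free_group B) ?S"
    unfolding \<psi>_def by (intro homI) (simp_all add: S.weval_closed[OF \<rho>] S.weval_reduce[OF \<rho>] S.weval_append[OF \<rho>])
  then have \<kappa>: "\<psi> \<circ> h \<in> hom (G\<lparr>carrier := H\<rparr>) ?S" using h(1) by (rule hom_compose[rotated])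
  have finS: "finite (carrier ?S)" by (simp add: sym_group_def finite_permutations)
  define K where "K = {g \<in> H. (\<psi> \<circ> h) g = \<one>\<^bsub>?S\<^esub>}"
  have K: "subgroup K G" "finite (rcosets\<^bsub>G\<^esub> K)"
    unfolding K_def using G.finite_index_kernel[OF H S.group_axioms finS \<kappa>] by blast+
  define E where "E = rcosets\<^bsub>G\<^esub> K"
  obtain \<phi> where \<phi>: "\<phi> \<in> hom G (BijGroup E)" "\<And>g. g \<in> carrier G \<Longrightarrow> \<phi> g = \<one>\<^bsub>BijGroup E\<^esub> \<Longrightarrow> g \<in> K"
    unfolding E_def using G.coset_action[OF K(1)] by blast
  interpret Q: group "BijGroup E" by (rule group_BijGroup)
  interpret \<phi>: group_hom G "BijGroup E" \<phi> by unfold_locales (rule \<phi>(1))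
  define f where "f = (\<lambda>z. \<phi> (?q [(z, True)]))"
  have qc: "?q [(z, True)] \<in> carrier G" for z by (rule q.hom_closed) simp
  have f: "f z \<in> carrier (BijGroup E)" for z unfolding f_def by (rule \<phi>.hom_closed[OF qc])
  have ev: "weval (BijGroup E) f w = \<phi> (?q (reduce w))" for w
  proof -
    have "\<phi> (?q (weval F2 (\<lambda>z. [(z, True)]) w)) = weval (BijGroup E) (\<phi> \<circ> (?q \<circ> (\<lambda>z. [(z, True)]))) w"
      using weval_hom[OF q, of "\<lambda>z. [(z, True)]" w] weval_hom[OF \<phi>.group_hom_axioms, of "?q \<circ> (\<lambda>z. [(z, True)])" w] qc
      by (simp only: o_apply free_group_UNIV_carrier reduced_single)
    then show ?thesis by (simp add: weval_free_group f_def o_def)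
  qed
  have "r \<in> N"
  proof -
    have "[] \<otimes>\<^bsub>F2\<^esub> r \<otimes>\<^bsub>F2\<^esub> inv\<^bsub>F2\<^esub> [] \<in> {g \<otimes>\<^bsub>F2\<^esub> s \<otimes>\<^bsub>F2\<^esub> inv\<^bsub>F2\<^esub> g | g s. g \<in> carrier F2 \<and> s \<in> {r}}"
      by (intro CollectI exI[of _ "[]"] exI[of _ r] conjI refl) simp_all
    moreover have "[] \<otimes>\<^bsub>F2\<^esub> r \<otimes>\<^bsub>F2\<^esub> inv\<^bsub>F2\<^esub> [] = r"
      using F.inv_one red by (simp add: reduce_reduced)
    ultimately have "r \<in> {g \<otimes>\<^bsub>F2\<^esub> s \<otimes>\<^bsub>F2\<^esub> inv\<^bsub>F2\<^esub> g | g s. g \<in> carrier F2 \<and> s \<in> {r}}"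
      by (simp only:)
    then show ?thesis unfolding N_def normal_closure_def by (rule generate.incl)
  qed
  then have "?q r = \<one>\<^bsub>G\<^esub>" using N.rcos_const[OF F.group_axioms] by (simp add: G_def FactGroup_def)
  then have "weval (BijGroup E) f r = \<one>\<^bsub>BijGroup E\<^esub>"
    using ev[of r] red by (simp add: reduce_reduced)
  then have met: "metabelian_words (BijGroup E) f"
    using met[OF Q.group_axioms finite_BijGroup f] K(2) by (simp add: E_def)
  \<comment> \<open>Lifts of the two basis elements to words in a and t, so that the word law of
    \<open>Q\<close> can be applied to them.\<close>
  have "\<exists>u. reduced u \<and> ?q u \<in> H \<and> h (?q u) = [(z, True)]" if z: "z \<in> B" for z
  proof -
    have "[(z, True)] \<in> h ` H" unfolding h(2) using z by (simp add: carrier_free_group)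
    then obtain g where g: "g \<in> H" "h g = [(z, True)]" by force
    then have "g \<in> carrier G" using subgroup.mem_carrier[OF H(1)] by blast
    then obtain u where "u \<in> carrier F2" "g = ?q u" unfolding G_def by (auto simp: FactGroup_def RCOSETS_def)
    then show ?thesis using g by auto
  qed
  then obtain u v where u: "reduced u" "?q u \<in> H" "h (?q u) = [(x, True)]" and v: "reduced v" "?q v \<in> H" "h (?q v) = [(y, True)]"
    using xy by meson
  define k where "k w = (\<psi> \<circ> h) (?q (reduce w))" for w
  have qH: "?q (reduce (a @ b)) \<in> H" "k (a @ b) = k a \<circ> k b"
    if "?q (reduce a) \<in> H" "?q (reduce b) \<in> H" for a b
  proof -
    have e: "?q (reduce (a @ b)) = ?q (reduce a) \<otimes>\<^bsub>G\<^esub> ?q (reduce b)"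
      using q.hom_mult[of "reduce a" "reduce b"] by (simp add: reduce_append_reduce_left reduce_append_reduce_right)
    then show "?q (reduce (a @ b)) \<in> H" using subgroup.m_closed[OF H(1)] that by simp
    show "k (a @ b) = k a \<circ> k b"
      unfolding k_def e using hom_mult[OF \<kappa>, of "?q (reduce a)" "?q (reduce b)"] that by (simp add: sym_group_def)
  qed
  have qI: "?q (reduce (inv_word a)) \<in> H" "k (inv_word a) = inv\<^bsub>?S\<^esub> (k a)" if a: "?q (reduce a) \<in> H" for a
  proof -
    have "reduce (inv_word a) = inv\<^bsub>F2\<^esub> (reduce a)"
      by (rule F.inv_equality[symmetric]) (simp_all add: reduce_append_reduce_left reduce_append_reduce_right reduce_inv_word_left)
    then have e: "?q (reduce (inv_word a)) = inv\<^bsub>G\<^esub> (?q (reduce a))" by (simp add: q.hom_inv)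
    then show "?q (reduce (inv_word a)) \<in> H" using subgroup.m_inv_closed[OF H(1) a] by simp
    interpret \<kappa>: group_hom "G\<lparr>carrier := H\<rparr>" ?S "\<psi> \<circ> h"
      by (intro group_hom.intro G.subgroup_imp_group[OF H(1)] S.group_axioms group_hom_axioms.intro \<kappa>)
    show "k (inv_word a) = inv\<^bsub>?S\<^esub> (k a)"
      unfolding k_def e using \<kappa>.hom_inv[of "?q (reduce a)"] a by (simp add: G.m_inv_consistent[OF H(1) a])
  qed
  have ku: "k u = s4x" and kv: "k v = s4y"
    using u v xy by (simp_all add: k_def \<psi>_def reduce_reduced lval_def \<rho>_def sym_group_def)
  have uH: "?q (reduce u) \<in> H" "?q (reduce v) \<in> H" using u v by (simp_all add: reduce_reduced)
  \<comment> \<open>\<open>?c\<close> is the commutator of \<open>u\<close> with \<open>v\<close>,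
    and \<open>?d\<close> that of \<open>u\<close> with the inverse of \<open>v\<close>.
    \<open>?w\<close> is trivial exactly when the two commute.\<close>
  let ?c = "u @ v @ inv_word u @ inv_word v" and ?d = "u @ inv_word v @ inv_word u @ inv_word (inv_word v)"
  let ?w = "(?c @ ?d) @ inv_word (?d @ ?c)"
  have cd: "?q (reduce (?c @ ?d)) \<in> H" "?q (reduce (?d @ ?c)) \<in> H"
    by (intro qH(1) qI(1) uH)+
  have "weval (BijGroup E) f (?c @ ?d) = weval (BijGroup E) f (?d @ ?c)"
    using met unfolding metabelian_words_def by blast
  then have "weval (BijGroup E) f ?w = \<one>\<^bsub>BijGroup E\<^esub>"
    unfolding Q.weval_append[of f "?c @ ?d" "inv_word (?d @ ?c)", OF f] Q.weval_inv_word[of f "?d @ ?c", OF f]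
    using Q.weval_closed[of f "?d @ ?c", OF f] by simp
  then have "?q (reduce ?w) \<in> K" using \<phi>(2) ev[of ?w] q.hom_closed[of "reduce ?w"] by simp
  then have "k ?w = \<one>\<^bsub>?S\<^esub>" by (simp add: K_def k_def)
  moreover have "k ?w = k (?c @ ?d) \<circ> inv\<^bsub>?S\<^esub> (k (?d @ ?c))"
    by (simp only: qH(2)[OF cd(1) qI(1)[OF cd(2)]] qI(2)[OF cd(2)])
  moreover have kc: "k (?d @ ?c) \<in> carrier ?S"
    unfolding k_def using hom_in_carrier[OF \<kappa>] cd(2) by simp
  ultimately have "k (?c @ ?d) \<otimes>\<^bsub>?S\<^esub> inv\<^bsub>?S\<^esub> (k (?d @ ?c)) = \<one>\<^bsub>?S\<^esub>" by (simp add: sym_group_def)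
  moreover have "k (?c @ ?d) \<in> carrier ?S" unfolding k_def using hom_in_carrier[OF \<kappa>] cd(1) by simp
  ultimately have eq: "k (?c @ ?d) = k (?d @ ?c)" using kc by (metis S.inv_inv S.inv_closed S.inv_equality)
  have "k ?c = s4x \<circ> s4y \<circ> s4x \<circ> s4z" "k ?d = s4x \<circ> s4z \<circ> s4x \<circ> s4y"
    by (simp_all only: qH qI uH ku kv s4_inv o_assoc) (metis S.inv_inv s4_carrier(2) s4_inv(2))
  moreover have "k (?c @ ?d) = k ?c \<circ> k ?d" "k (?d @ ?c) = k ?d \<circ> k ?c"
    by (intro qH(2) qH(1) qI(1) uH)+
  \<comment> \<open>The point 1 lies in the support of both 3-cycles, and their two products already
    differ there.\<close>
  ultimately have "(s4x \<circ> s4y \<circ> s4x \<circ> s4z \<circ> (s4x \<circ> s4z \<circ> s4x \<circ> s4y)) 1 = (s4x \<circ> s4z \<circ> s4x \<circ> s4y \<circ> (s4x \<circ> s4y \<circ> s4x \<circ> s4z)) 1"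
    using eq by simp
  then show False by (simp add: s4x_def s4y_def s4z_def transpose_def)
qed

section \<open>Finite quotients of the listed groups\<close>

context group
begin

lemma int_pow_numerals:
  assumes "x \<in> carrier G"
  shows "x [^] (1::int) = x" "x [^] (2::int) = x \<otimes> x" "x [^] (3::int) = x \<otimes> (x \<otimes> x)"
    "x [^] (- 1::int) = inv x" "x [^] (- 2::int) = inv x \<otimes> inv x"
proof -
  have 2: "x [^] (2::int) = x \<otimes> x" using int_pow_mult[OF assms, of 1 1] assms by simp
  then show "x [^] (2::int) = x \<otimes> x" .
  show "x [^] (3::int) = x \<otimes> (x \<otimes> x)" using int_pow_mult[OF assms, of 1 2] assms 2 by simp
  show "x [^] (- 1::int) = inv x" using int_pow_neg[OF assms, of 1] assms by simp
  show "x [^] (- 2::int) = inv x \<otimes> inv x" using int_pow_neg[OF assms, of 2] assms 2 by (simp add: inv_mult_group)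
qed (use assms in simp)

text \<open>The relation x (x^k y)^2 = 1 makes x and y powers of the single element c = x^k y. Six
  of the thirteen relators have this shape with x = b.\<close>

lemma solve_square:
  assumes x: "x \<in> carrier G" and y: "y \<in> carrier G" and e: "x \<otimes> (c \<otimes> c) = \<one>" and c: "c = x [^] (k::int) \<otimes> y"
  shows "x = c [^] (- 2::int)" "y = c [^] (2 * k + 1)"
proof -
  have cc: "c \<in> carrier G" using x y c by simp
  have "x = inv (c \<otimes> c)" using inv_equality[OF e] cc x by simp
  then show 1: "x = c [^] (- 2::int)" using cc by (simp add: int_pow_numerals inv_mult_group)
  have "y = inv (x [^] k) \<otimes> c" unfolding c using x y by (simp add: inv_mult_cancel)
  also have "\<dots> = c [^] (2 * k) \<otimes> c [^] (1::int)"
    unfolding 1 int_pow_pow[OF cc] int_pow_neg[OF cc, symmetric] using cc by simp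
  also have "\<dots> = c [^] (2 * k + 1)" using int_pow_mult[OF cc] by simp
  finally show "y = c [^] (2 * k + 1)" .
qed

text \<open>In all listed words t occurs only in blocks t a^k t^-1, so they are words in a and its
  conjugate b.\<close>

lemma weval_height1:
  assumes f: "\<And>x. f x \<in> carrier G"
  defines "b \<equiv> f Gt \<otimes> f Ga \<otimes> inv (f Gt)"
  shows "weval G f (tw @ apow k1 @ tiw @ apow l1 @ tw @ apow k2 @ tiw @ apow l2) =
      b [^] k1 \<otimes> (f Ga [^] l1 \<otimes> (b [^] k2 \<otimes> f Ga [^] l2))"
    and "weval G f (bs_word k1 l1) = b [^] k1 \<otimes> f Ga [^] (- l1)"
proof -
  have b: "b [^] k = f Gt \<otimes> f Ga [^] k \<otimes> inv (f Gt)" for k :: int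
    unfolding b_def by (rule int_pow_conj[OF f f, symmetric])
  show "weval G f (tw @ apow k1 @ tiw @ apow l1 @ tw @ apow k2 @ tiw @ apow l2) =
      b [^] k1 \<otimes> (f Ga [^] l1 \<otimes> (b [^] k2 \<otimes> f Ga [^] l2))"
    unfolding b using f by (simp add: weval_append[OF f] weval_apow[OF f] lval_def m_assoc)
  show "weval G f (bs_word k1 l1) = b [^] k1 \<otimes> f Ga [^] (- l1)"
    unfolding b bs_word_def using f by (simp add: weval_append[OF f] weval_apow[OF f] lval_def m_assoc)
qed

text \<open>From b^p = a^q and ord a = ord b = m follows gcd(m,p) = gcd(m,q), which divides the
  coprime p and q and so is 1. Hence b is a power of b^p = a^q.\<close>

lemma conj_in_bs:
  assumes fin: "finite (carrier G)" and f: "\<And>x. f x \<in> carrier G"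
    and pq: "coprime (p::int) q" and e: "weval G f (bs_word p q) = \<one>"
  shows "f Gt \<otimes> f Ga \<otimes> inv (f Gt) \<in> generate G {f Ga}"
proof -
  define a where "a = f Ga"
  define b where "b = f Gt \<otimes> f Ga \<otimes> inv (f Gt)"
  have a: "a \<in> carrier G" and b: "b \<in> carrier G" using f by (simp_all add: a_def b_def)
  have o: "ord b = ord a" unfolding a_def b_def by (rule ord_conj[OF f f])
  have o0: "ord x \<noteq> 0" if "x \<in> carrier G" for x using ord_ge_1[OF fin that] by simp
  have "b [^] p \<otimes> a [^] (- q) = \<one>" using e weval_height1(2)[of f p q, OF f] by (simp only: a_def b_def)
  then have pe: "b [^] p = a [^] q"
    using inv_equality[of "b [^] p" "a [^] (- q)"] a b int_pow_neg[OF a, of q] by simp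
  have "int (ord (b [^] p)) * gcd (int (ord a)) p = int (ord (b [^] p)) * gcd (int (ord a)) q"
    using ord_int_pow[OF b o0[OF b], of p] ord_int_pow[OF a o0[OF a], of q] unfolding pe o by simp
  then have g: "gcd (int (ord a)) p = gcd (int (ord a)) q" using o0[of "b [^] p"] b by simp
  have "gcd (int (ord a)) p dvd q" unfolding g by simp
  then have "is_unit (gcd (int (ord a)) p)" using coprime_common_divisor[OF pq, of "gcd (int (ord a)) p"] by simp
  then have "coprime (int (ord b)) p" unfolding o by (simp only: is_unit_gcd)
  then have "b \<in> generate G {b [^] p}" by (rule in_generate_pow[OF b])
  moreover have "b [^] p \<in> generate G {a}"
    unfolding pe using int_pow_in_generate[OF a, of a q] by (simp add: generate.incl)
  ultimately show ?thesis using generate_sub a unfolding a_def b_def by blast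
qed

text \<open>Each relator reads b^k1 a^l1 b^k2 a^l2 with ord a = ord b. Eight of them make a and b,
  or one of them and the square of the other, powers of a common c with exponents built from 2 and
  an odd number. In the other five a power of one generator conjugates u^i to u^(i+1), u being the
  other generator, and both generators are trivial.\<close>

lemma conj_in_exceptional:
  assumes fin: "finite (carrier G)" and f: "\<And>x. f x \<in> carrier G"
    and w: "w \<in> set exceptional_words" and e: "weval G f w = \<one>"
  shows "f Gt \<otimes> f Ga \<otimes> inv (f Gt) \<in> generate G {f Ga}"
proof -
  define a where "a = f Ga"
  define b where "b = f Gt \<otimes> f Ga \<otimes> inv (f Gt)"
  have a: "a \<in> carrier G" and b: "b \<in> carrier G" using f by (simp_all add: a_def b_def)
  have o: "ord b = ord a" unfolding a_def b_def by (rule ord_conj[OF f f])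
  note ip = int_pow_numerals[OF a] int_pow_numerals[OF b]
  let ?P = "\<lambda>k1 l1 k2 l2. b [^] (k1::int) \<otimes> (a [^] (l1::int) \<otimes> (b [^] (k2::int) \<otimes> a [^] (l2::int))) = \<one>"
  note h1 = weval_height1(1)[of f, OF f, folded a_def b_def]
  have "?P 2 1 1 1 \<or> ?P 2 1 (-1) (-1) \<or> ?P 2 (-1) 1 (-1) \<or> ?P 2 2 2 1 \<or> ?P 2 2 1 2 \<or> ?P 2 2 (-1) (-2) \<or>
    ?P 2 2 (-2) (-1) \<or> ?P 2 1 (-2) (-2) \<or> ?P 2 (-1) 2 (-2) \<or> ?P 2 (-2) 1 (-2) \<or> ?P 3 1 2 1 \<or> ?P 3 1 (-2) (-1) \<or> ?P 3 (-1) 2 (-1)"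
    using w e unfolding exceptional_words_def by (auto simp only: list.set insert_iff empty_iff h1)
  \<comment> \<open>The relators b (b^k y)^2 with y = a or a^-1. Here b = c^-2 and y = c^(2k+1) have
    coprime exponents and equal orders.\<close>
  moreover have tA: "b \<in> generate G {a}" if y: "y = a \<or> y = inv a" and k: "k = 1 \<or> k = (2::int)"
    and e: "b \<otimes> ((b [^] k \<otimes> y) \<otimes> (b [^] k \<otimes> y)) = \<one>" for y k
  proof -
    define c where "c = b [^] k \<otimes> y"
    have yc: "y \<in> carrier G" and c: "c \<in> carrier G" using y a b by (auto simp: c_def)
    note s = solve_square[OF b yc e[folded c_def] c_def]
    have oy: "ord y = ord b" using y o a by auto
    have "coprime (2 * k + 1) (- 2)" by simp
    then have "c [^] (- 2::int) \<in> generate G {c [^] (2 * k + 1)}"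
      using oy s by (intro coprime_powers_generate[OF fin c]) simp_all
    then have "b \<in> generate G {y}" using s by simp
    moreover have "y \<in> generate G {a}" using y by (auto intro: generate.incl generate.inv)
    ultimately show ?thesis using generate_sub a by blast
  qed
  \<comment> \<open>The relators b (b y)^2 with y = a^2 or a^-2. Now b = c^-2 and only the square of
    a is known to be a power of c, namely c^3 or c^-3.\<close>
  moreover have tB: "b \<in> generate G {a}" if y: "y = a [^] (2::int) \<or> y = a [^] (- 2::int)"
    and e: "b \<otimes> ((b [^] (1::int) \<otimes> y) \<otimes> (b [^] (1::int) \<otimes> y)) = \<one>" for y
  proof -
    define c where "c = b [^] (1::int) \<otimes> y"
    have yc: "y \<in> carrier G" and c: "c \<in> carrier G" using y a b by (auto simp: c_def)
    note s = solve_square[OF b yc e[folded c_def] c_def]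
    have y3: "y = c [^] (3::int)" using s(2) by simp
    have "a [^] (2::int) = c [^] (3::int) \<or> a [^] (2::int) = c [^] (- 3::int)"
    proof (cases "y = a [^] (2::int)")
      case False
      then have "a [^] (2::int) = inv y" using y int_pow_neg[OF a, of 2] a by simp
      then show ?thesis using y3 int_pow_neg[OF c, of 3] by simp
    qed (use y3 in simp)
    then have "\<exists>j::int. \<bar>j\<bar> = 3 \<and> a [^] (2::int) = c [^] j"
    proof
      assume "a [^] (2::int) = c [^] (3::int)"
      then show ?thesis by (intro exI[of _ 3] conjI) simp_all
    next
      assume "a [^] (2::int) = c [^] (- 3::int)"
      then show ?thesis by (intro exI[of _ "- 3"] conjI) simp_all
    qed
    then obtain j where j: "\<bar>j\<bar> = (3::int)" "a [^] (2::int) = c [^] j" by (elim exE conjE)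
    have "c [^] (- 2::int) \<in> generate G {a}"
      using square_cube_generate(1)[OF fin c a _ j(1) j(2), of "- 2"] o s(1) by simp
    then show ?thesis using s(1) by simp
  qed
  \<comment> \<open>The mirror case with a and b exchanged: a is c^2 or c^-2, and b^2 = c^3.\<close>
  moreover have tB': "b \<in> generate G {a}" if c: "c \<in> carrier G" and i: "\<bar>i\<bar> = (2::int)" and s: "a = c [^] i" "b [^] (2::int) = c [^] (3::int)" for c i
    using square_cube_generate(2)[OF fin c b i _ s(2)] o s(1) by simp
  moreover have triv: "b \<in> generate G {a}" if "a = \<one> \<or> b = \<one>"
  proof -
    have "b = \<one>" using that ord_eq_1[OF a] ord_eq_1[OF b] o by auto
    then show ?thesis by (simp add: generate.one)
  qed
  \<comment> \<open>Since a and b have the same order, a conjugating power of either one has trivial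
    \<open>ord u\<close>-th power, as \<open>trivial_if_conj_pow\<close> requires.\<close>
  moreover have tC: "b \<in> generate G {a}" if u: "u = a \<or> u = b" and g: "g \<in> carrier G" "g [^] ord a = \<one>"
    and r: "g \<otimes> u [^] i \<otimes> inv g = u [^] (i + 1)" for u g and i :: nat
  proof -
    have "u \<in> carrier G" "ord u = ord a" using u a b o by auto
    then have "u = \<one>" using trivial_if_conj_pow[OF fin _ g(1) r] g(2) by simp
    then show ?thesis using u triv by auto
  qed
  have pa: "a [^] ord a = \<one>" "(a \<otimes> a) [^] ord a = \<one>" "(b \<otimes> b) [^] ord a = \<one>" "inv (b \<otimes> b) [^] ord a = \<one>"
  proof -
    have *: "(x \<otimes> x) [^] n = \<one>" if "x \<in> carrier G" "x [^] n = \<one>" for x and n :: nat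
      using that pow_mult_distrib[of x x n] by simp
    show "a [^] ord a = \<one>" using a by simp
    then show "(a \<otimes> a) [^] ord a = \<one>" using * a by blast
    have "b [^] ord a = \<one>" unfolding o[symmetric] by (rule pow_ord_eq_1[OF b])
    then show bb: "(b \<otimes> b) [^] ord a = \<one>" by (rule *[OF b])
    show "inv (b \<otimes> b) [^] ord a = \<one>" using bb b by (simp add: nat_pow_inv del: inv_mult_group)
  qed
  have "b \<in> generate G {a}" if "?P 2 1 1 1" using that tA[of a 1] a b by (simp add: ip m_assoc)
  moreover have "b \<in> generate G {a}" if "?P 2 (-1) 1 (-1)" using that tA[of "inv a" 1] a b by (simp add: ip m_assoc)
  moreover have "b \<in> generate G {a}" if "?P 3 1 2 1" using that tA[of a 2] a b by (simp add: ip m_assoc)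
  moreover have "b \<in> generate G {a}" if "?P 3 (-1) 2 (-1)" using that tA[of "inv a" 2] a b by (simp add: ip m_assoc)
  moreover have "b \<in> generate G {a}" if "?P 2 2 1 2" using that tB[of "a \<otimes> a"] a b by (simp add: ip m_assoc)
  moreover have "b \<in> generate G {a}" if "?P 2 (-2) 1 (-2)" using that tB[of "inv a \<otimes> inv a"] a b by (simp add: ip m_assoc)
  moreover have "b \<in> generate G {a}" if e: "?P 2 2 2 1"
  proof -
    \<comment> \<open>The relator b^2 a^2 b^2 a is c a c, and c a c = 1 gives a = c^-2 and b^2 = c
      a^-1 = c^3.\<close>
    define c where "c = b \<otimes> b \<otimes> a"
    have c: "c \<in> carrier G" using a b by (simp add: c_def)
    have "(c \<otimes> a) \<otimes> c = \<one>" using e a b by (simp add: ip m_assoc c_def)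
    then have "c \<otimes> (c \<otimes> a) = \<one>" using inv_comm[of "c \<otimes> a" c] a c by simp
    then have "(c \<otimes> c) \<otimes> a = \<one>" using a c by (simp add: m_assoc)
    then have "a \<otimes> (c \<otimes> c) = \<one>" using inv_comm[of "c \<otimes> c" a] a c by simp
    then have "a = inv (c \<otimes> c)" using inv_equality[of a "c \<otimes> c"] a c by simp
    then have s: "a = c [^] (- 2::int)" using c by (simp add: int_pow_numerals inv_mult_group)
    have "b \<otimes> b = c \<otimes> inv a" using a b by (simp add: c_def m_assoc)
    also have "\<dots> = c \<otimes> (c \<otimes> c)" unfolding \<open>a = inv (c \<otimes> c)\<close> using c by simp
    finally show ?thesis using tB'[OF c, of "- 2"] s b c by (simp add: int_pow_numerals)
  qed
  moreover have "b \<in> generate G {a}" if e: "?P 2 (-1) 2 (-2)"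
  proof -
    \<comment> \<open>The relator b^2 a^-1 b^2 a^-2 is c^2 a^-1, so a = c^2 and b^2 = c a =
      c^3.\<close>
    define c where "c = b \<otimes> b \<otimes> inv a"
    have c: "c \<in> carrier G" using a b by (simp add: c_def)
    have "(c \<otimes> c) \<otimes> inv a = \<one>" using e a b by (simp add: ip m_assoc c_def)
    then have s: "a = c \<otimes> c" using inv_equality[of "c \<otimes> c" "inv a"] a c by simp
    have "b \<otimes> b = c \<otimes> a" using a b by (simp add: c_def m_assoc)
    then show ?thesis using tB'[OF c, of 2] s b c by (simp add: int_pow_numerals)
  qed
  moreover have "b \<in> generate G {a}" if e: "?P 2 1 (-1) (-1)"
  proof -
    have "(b \<otimes> b) \<otimes> (a \<otimes> inv b \<otimes> inv a) = \<one>" using e a b by (simp add: ip m_assoc)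
    then have "inv (a \<otimes> inv b \<otimes> inv a) = b \<otimes> b" using a b by (intro inv_equality) simp_all
    then show ?thesis using tC[of b a 1] a b pa by (simp add: inv_mult_group m_assoc numeral_2_eq_2)
  qed
  moreover have "b \<in> generate G {a}" if e: "?P 2 2 (-1) (-2)"
  proof -
    have "(b \<otimes> b) \<otimes> ((a \<otimes> a) \<otimes> inv b \<otimes> inv (a \<otimes> a)) = \<one>" using e a b by (simp add: ip m_assoc inv_mult_group)
    then have "inv ((a \<otimes> a) \<otimes> inv b \<otimes> inv (a \<otimes> a)) = b \<otimes> b" using a b by (intro inv_equality) simp_all
    then show ?thesis using tC[of b "a \<otimes> a" 1] a b pa by (simp add: inv_mult_group m_assoc numeral_2_eq_2)
  qed
  moreover have "b \<in> generate G {a}" if e: "?P 3 1 (-2) (-1)"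
  proof -
    have "(b \<otimes> b \<otimes> b) \<otimes> (a \<otimes> inv (b \<otimes> b) \<otimes> inv a) = \<one>" using e a b by (simp add: ip m_assoc inv_mult_group)
    then have "inv (a \<otimes> inv (b \<otimes> b) \<otimes> inv a) = b \<otimes> b \<otimes> b" using a b by (intro inv_equality) simp_all
    then show ?thesis using tC[of b a 2] a b pa by (simp add: inv_mult_group m_assoc numeral_2_eq_2 numeral_3_eq_3)
  qed
  moreover have "b \<in> generate G {a}" if e: "?P 2 1 (-2) (-2)"
  proof -
    have "((b \<otimes> b) \<otimes> a \<otimes> inv (b \<otimes> b)) \<otimes> inv (a \<otimes> a) = \<one>" using e a b by (simp add: ip m_assoc inv_mult_group)
    then have "inv (inv (a \<otimes> a)) = (b \<otimes> b) \<otimes> a \<otimes> inv (b \<otimes> b)" using a b by (intro inv_equality) simp_all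
    then show ?thesis using tC[of a "b \<otimes> b" 1] a b pa by (simp add: m_assoc numeral_2_eq_2)
  qed
  moreover have "b \<in> generate G {a}" if e: "?P 2 2 (-2) (-1)"
  proof -
    have "((b \<otimes> b) \<otimes> (a \<otimes> a) \<otimes> inv (b \<otimes> b)) \<otimes> inv a = \<one>" using e a b by (simp add: ip m_assoc inv_mult_group)
    then have "inv (inv a) = (b \<otimes> b) \<otimes> (a \<otimes> a) \<otimes> inv (b \<otimes> b)" using a b by (intro inv_equality) simp_all
    then have *: "a = (b \<otimes> b) \<otimes> (a \<otimes> a) \<otimes> inv (b \<otimes> b)" using a by simp
    \<comment> \<open>Read backwards, the relation says that the inverse of b^2 conjugates a to
      a^2.\<close>
    have "inv (b \<otimes> b) \<otimes> a \<otimes> (b \<otimes> b) = a \<otimes> a"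
      by (subst (1) *) (use a b in \<open>simp add: m_assoc inv_mult_cancel inv_mult_group\<close>)
    then show ?thesis using tC[of a "inv (b \<otimes> b)" 1] a b pa by (simp add: numeral_2_eq_2)
  qed
  ultimately have "b \<in> generate G {a}" by blast
  then show ?thesis by (simp add: a_def b_def)
qed

end

text \<open>If \<open>r\<close> dies under \<open>f\<close>, then \<open>w\<close> dies under
  \<open>f\<close> with the generators inverted accordingly. Conjugacy and inversion of the relator
  do not affect its triviality.\<close>

lemma not_large_equiv:
  assumes red: "reduced r" and eq: "equiv_word r w"
    and w: "\<And>(Q :: (gen letter list set set \<Rightarrow> gen letter list set set) monoid) f.
      group Q \<Longrightarrow> finite (carrier Q) \<Longrightarrow> (\<And>x. f x \<in> carrier Q) \<Longrightarrow> weval Q f w = \<one>\<^bsub>Q\<^esub> \<Longrightarrow>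
      f Gt \<otimes>\<^bsub>Q\<^esub> f Ga \<otimes>\<^bsub>Q\<^esub> inv\<^bsub>Q\<^esub> (f Gt) \<in> generate Q {f Ga}"
  shows "\<not> large (one_rel_group r)"
proof (rule not_large_if_metabelian[OF red])
  fix Q :: "(gen letter list set set \<Rightarrow> gen letter list set set) monoid" and f
  assume Q: "group Q" "finite (carrier Q)" and f: "\<And>x. f x \<in> carrier Q" and e: "weval Q f r = \<one>\<^bsub>Q\<^esub>"
  interpret group Q by fact
  from eq obtain s k ea et where s: "s \<in> {r, inv_word r}" and w': "rotate k (invert_gens ea et s) = w"
    unfolding equiv_word_def by blast
  let ?f = "\<lambda>x. if x = Ga \<and> ea \<or> x = Gt \<and> et then inv\<^bsub>Q\<^esub> (f x) else f x"
  have f': "?f x \<in> carrier Q" for x using f by simp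
  have "weval Q f s = \<one>\<^bsub>Q\<^esub>" using s e weval_inv_word[of f r, OF f] by auto
  moreover have "invert_gens ea et (invert_gens ea et s) = s"
    by (induction s) (auto simp: invert_gens_def split: if_splits)
  ultimately have "weval Q ?f (invert_gens ea et s) = \<one>\<^bsub>Q\<^esub>"
    using weval_invert_gens[of f ea et "invert_gens ea et s", OF f] by simp
  then have "weval Q ?f w = \<one>\<^bsub>Q\<^esub>" unfolding w'[symmetric] by (rule weval_rotate[OF f'])
  then have "metabelian_words Q ?f"
    using metabelian_if_conj_in[OF Q(2), of ?f] f' w[OF Q, of ?f] by blast
  then show "metabelian_words Q f" by (rule metabelian_words_invert_gens[OF f])
qed

theorem not_large_exceptional:
  assumes "reduced r" "w \<in> set exceptional_words" "equiv_word r w"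
  shows "\<not> large (one_rel_group r)"
  using group.conj_in_exceptional assms(2) by (intro not_large_equiv[OF assms(1,3)]) blast

theorem not_large_bs:
  assumes "reduced r" "coprime (p::int) q" "equiv_word r (bs_word p q)"
  shows "\<not> large (one_rel_group r)"
  using group.conj_in_bs assms(2) by (intro not_large_equiv[OF assms(1,3)]) blast

section \<open>The certificates\<close>

text \<open>The arguments are p, the images of 1..n under a and under t, the labels of the a-edges
  and t-edges by source point, the base point, K, and the words u and v. As labels, 1 is the empty
  word and 4, 5, 6, 7 are a, a^-1, t, t^-1. Here u = a^-1 t and v = a t^-1; read from point 2 they
  have the labels a and t.\<close>

lemma cert1: "good_groups [(False,False,0,[76415,272959,4205183,4231130,4235210,4236278,4237298,16788031,16912330,
    16924426,16932826,16940890,16942066,16945090,16947190,16949206])]"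
  by (rule certificate[of 2 "[2,3,1]" "[2,3,1]" "[5,1,4]" "[1,7,6]" 2 0 22 19]) (simp_all only: cert_rules)

lemma cert2: "good_groups [(False,False,0,[19079975,19080035,19080039,19080995,19080999,19081059,19081063,19096355,
    19096359,19096419,19096423,19097379,19097383,19097443,19097447,19342115,19342119,19342179,19342183,19343139,
    19343203,19343207,19358499,19358503,19358563,19358567,19359523,19359527,19359587,19359591])]"
  by (rule certificate[of 2 "[1,3,2]" "[2,1,3]" "[1,1,1]" "[4,1,6]" 2 0 26 72]) (simp_all only: cert_rules)

lemma cert3: "good_groups [(False,False,0,[271203,1084823,1087331,4204327,4337815,4348963,4349335,16810791,
    16817283])]"
  by (rule certificate[of 2 "[1,3,4,2]" "[2,1,4,3]" "[1,1,1,1]" "[1,4,6,6]" 2 0 26 72]) (simp_all only: cert_rules)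

lemma cert4: "good_groups [(False,False,0,[1189503,1189878,1195878,1205823,1206258,1212258,1221495,1222515])]"
  by (rule certificate[of 2 "[1,3,2,4]" "[2,4,1,3]" "[4,1,1,6]" "[1,1,1,1]" 1 0 4 1674]) (simp_all only: cert_rules)

lemma cert5: "good_groups [(False,False,0,[272231,1082215,1088899,4203299,4328487,4328835,4354179,16813207,
    16815907])]"
  by (rule certificate[of 2 "[1,3,4,2]" "[2,1,3,4]" "[1,1,1,1]" "[4,1,6,6]" 2 0 26 73]) (simp_all only: cert_rules)

lemma cert6: "good_groups [(False,False,0,[1204863,1205238,1212198,1222455,17402335,17418655,17419738,17458999,
    17463079,17463094,19309559,19343999,19349354,19395239,19555199,19559039,19562279,19562294]),(False,False,1,
    [17394163,17407783]),(False,True,1,[17344471,17397706,17418871,17423818,17446774,17448406])]"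
  by (rule certificate[of 2 "[1,3,2,4]" "[2,1,4,3]" "[19,4,1,6]" "[1,1,1,1]" 3 0 16 98]) (simp_all only: cert_rules)

lemma cert7: "good_groups [(False,False,0,[17366890,17432362,17448922,17465290,17469430,17473522])]"
  by (rule certificate[of 2 "[2,1,4,3]" "[2,4,1,3]" "[1,1,5,4]" "[7,1,6,1]" 2 0 394 28]) (simp_all only: cert_rules)

lemma cert8: "good_groups [(False,False,0,[17358694]),(False,True,0,[17407858])]"
  by (rule certificate[of 2 "[2,1,4,3]" "[3,4,1,2]" "[1,4,1,6]" "[6,1,1,7]" 1 0 16 26]) (simp_all only: cert_rules)

lemma cert9: "good_groups [(False,False,0,[19440607,19441615,19461082,19462090,19506127,19507167,19526602,19527642])]"
  by (rule certificate[of 2 "[2,1,4,3]" "[1,3,2,4]" "[1,1,1,1]" "[4,1,1,6]" 1 0 6 18568]) (simp_all only: cert_rules)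

lemma cert10: "good_groups [(False,False,0,[19048439,19545974,19562354]),(False,True,0,[19556159]),(True,False,0,
    [19310579]),(True,True,0,[19103594,19365674,19539839])]"
  by (rule certificate[of 2 "[1,2,3,4]" "[2,4,1,3]" "[1,1,5,6]" "[1,1,1,4]" 4 0 103 4]) (simp_all only: cert_rules)

text \<open>One point with labels a and t: the full group maps to the HNN extension with p = K = 2.
  Among the relators is a^2 t a^2 t^-1 (4227), which is trivial as soon as a^2 = 1. At the zero
  vector t has label 0. In t^-1 a t^2 a the second t carries the digit 1, and the other labels
  cancel, leaving the label 1.\<close>

lemma cert11: "good_groups [(False,False,0,[4227,4247,65667,65687,68111,68191,74531,74535,74595,74599,75555,75559,
    75619,75623,1048707,1048727,1050627,1050967,1051151,1051231,1057571,1057575,1057635,1057639,1058595,1058599,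
    1058659,1058663,1081871,1081951,1082306,1082326,1083443,1083447,1083763,1083767,1084451,1084455,1084771,1084775,
    1086991,1087071,1087426,1087446,1087539,1087543,1087859,1087863,1088547,1088551,1088867,1088871,1089731,1089751,
    1091011,1091031,1091647,1091967,16777347,16777367,16779267,16779607,16779791,16779871,16786211,16786215,16786275,
    16786279,16787235,16787239,16787299,16787303,16810511,16810591,16810946,16810966,16812083,16812087,16812403,
    16812407,16813091,16813095,16813411,16813415,16815631,16815711,16816066,16816086,16816179,16816183,16816499,
    16816503,16817187,16817191,16817507,16817511,16818191,16818371,16818391,16819551,16819651,16819671,16820287,
    16820607,16909091,16909095,16909155,16909159,16911491,16911511,16911554,16911574,16911747,16911767,16911810,
    16911830,16920611,16920615,16921091,16921175,16921955,16921959,16922115,16922199,16930595,16930599,16930659,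
    16930663,16931971,16931991,16932034,16932054,16932227,16932247,16932290,16932310,16936995,16936999,16937475,
    16937559,16938339,16938343,16938499,16938583,17309891,17309911,17311171,17311191,17311807,17312127,17313923,
    17313943,17313986,17314006,17315203,17315223,17315266,17315286,17317642,17317722,17337487,17337503,17337743,
    17337759,17341583,17341599,17341839,17341855,17342707,17342711,17343987,17343991,17363107,17363111,17364387,
    17364391,17391811,17391831,17393091,17393111,17393727,17394047,17395843,17395863,17395906,17395926,17397123,
    17397143,17397186,17397206,17399562,17399642,17403023,17403039,17403279,17403295,17407119,17407135,17407375,
    17407391,17408243,17408247,17409523,17409527,17428643,17428647,17429923,17429927,17434687,17435007,17436610,
    17436630,17440975,17440991,17442255,17442271,17445007,17445023,17445427,17445431,17445491,17445495,17446287,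
    17446303,17446451,17446455,17446515,17446519,17455167,17455487,17457090,17457110,17457359,17457375,17458639,
    17458655,17461391,17461407,17461811,17461815,17461875,17461879,17462671,17462687,17462835,17462839,17462899,
    17462903,17466127,17466207,17466307,17466327,17471247,17471327,17471427,17471447,17473791,17475071])]"
  by (rule certificate[of 2 "[1]" "[1]" "[4]" "[6]" 1 2 6 1832]) (simp_all only: cert_rules)

lemma cert12: "good_groups [(False,False,0,[1082151,1084803,16911395,16911715,16931875,16932195]),(True,False,0,
    [1082211,1088643,16920707,16920727,16921987,16922007])]"
  by (rule certificate[of 2 "[1,3,5,2,4]" "[2,1,5,4,3]" "[1,1,1,1,1]" "[1,4,6,6,6]" 2 0 26 88]) (simp_all only:
    cert_rules)

lemma cert13: "good_groups [(False,False,0,[1208991,1220391,19281463,19309535,19343158,19346983,19506167,19528922,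
    19561718]),(False,True,0,[1211559,1219743,19281703,19342903,19346998,19386218,19506047,19517402,19555295]),(False,
    False,1,[19297063,19342963]),(False,True,1,[19034743,19096438,19343218,19362343]),(True,False,1,[19035943,
    19101238,19341943,19362418]),(True,True,1,[19296883,19346023])]"
  by (rule certificate[of 2 "[1,3,5,2,4]" "[2,4,1,3,5]" "[4,1,6,4,1]" "[1,1,4,5,1]" 2 0 24 259]) (simp_all only:
    cert_rules)

lemma cert14: "good_groups [(False,False,0,[4203063,4229175]),(False,True,0,[4203318,4204083,4204338,4233267]),(False,
    False,1,[264719,4194975,4196598,4196850]),(False,True,-1,[4230198,4234290])]"
  by (rule certificate[of 2 "[2,4,1,5,3]" "[1,3,2,5,4]" "[1,1,1,1,1]" "[4,5,6,7,1]" 1 0 6 89]) (simp_all only: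
    cert_rules)

lemma cert15: "good_groups [(False,False,0,[4205119,4237375])]"
  by (rule certificate[of 2 "[2,4,1,5,3]" "[1,2,4,5,3]" "[1,1,1,1,1]" "[1,1,4,6,29]" 4 0 66 25]) (simp_all only:
    cert_rules)

lemma cert16: "good_groups [(False,False,0,[1057375,4229135]),(False,True,0,[1059187,4235315]),(False,False,-1,
    [16910711]),(False,True,-1,[16934339])]"
  by (rule certificate[of 2 "[2,4,1,5,3]" "[1,3,2,5,4]" "[1,1,1,1,1]" "[4,1,6,1,4]" 1 0 6 89]) (simp_all only:
    cert_rules)

lemma cert17: "good_groups [(False,False,0,[4202655,16815519]),(False,True,0,[264434,4204995,16820055,17364442,
    17462770]),(False,False,1,[4203123,4203378])]"
  by (rule certificate[of 2 "[2,4,1,5,3]" "[2,1,5,3,4]" "[1,1,1,1,1]" "[4,1,1,6,1]" 1 0 25 264]) (simp_all only: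
    cert_rules)

lemma cert18: "good_groups [(False,False,0,[19571711,19572735])]"
  by (rule certificate[of 2 "[1,3,2,5,4]" "[2,4,1,5,3]" "[1,5,4,7,6]" "[1,1,1,1,1]" 4 0 418 24]) (simp_all only:
    cert_rules)

lemma cert19: "good_groups [(False,False,0,[4234599])]"
  by (rule certificate[of 2 "[2,4,1,5,3]" "[1,3,4,2,5]" "[1,1,1,1,1]" "[4,6,6,4,6]" 1 0 6 72]) (simp_all only:
    cert_rules)

lemma cert20: "good_groups [(False,False,0,[4230499])]"
  by (rule certificate[of 2 "[2,4,1,5,3]" "[1,2,4,5,3]" "[1,21,1,4,4]" "[5,96,6,1,1]" 3 0 28 106]) (simp_all only:
    cert_rules)

lemma cert21: "good_groups [(False,False,0,[16931187,16931455,19507187]),(False,True,0,[17344375,19128170,19441535,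
    19521482]),(True,False,0,[16917975,16951255,19048415,19463642,19561970]),(True,True,0,[17406451,19556303]),(False,
    False,-1,[1058399]),(True,False,-1,[1059191])]"
  by (rule certificate[of 2 "[2,4,1,5,3]" "[3,1,5,2,4]" "[1,1,1,1,4]" "[1,1,1,6,1]" 4 0 265 24]) (simp_all only:
    cert_rules)

lemma cert22: "good_groups [(False,False,0,[4203363])]"
  by (rule certificate[of 2 "[2,4,1,5,3]" "[1,3,4,5,2]" "[1,5,1,4,1]" "[6,6,1,16,4]" 1 0 345 6]) (simp_all only:
    cert_rules)

lemma cert23: "good_groups [(False,False,0,[1087267,1088919,16911399,16911719,16931879,16932199]),(False,True,0,
    [1084567,1087335,16937091,16937111,16938371,16938391])]"
  by (rule certificate[of 2 "[1,3,5,2,4]" "[2,1,5,3,4]" "[1,1,1,1,1]" "[4,1,6,6,6]" 2 0 26 89]) (simp_all only: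
    cert_rules)

lemma cert24: "good_groups [(False,False,0,[1059391,1059455,1085386,1089482,1090546,1090550,16788095,16814026,
    16814042,16818122,16818138,16819186,16819190,16820210,16820214,16910911,16910975,16931391,16941631,16941695,
    16946751,16946815,16950031,16950111,16950211,16950231,16951055,16951135,16951235,17310710,17311730,17344767,
    17345023,17351626,17351642,17356746,17356762,17363146,17363162,17364426,17366166,17366402,17366422,17392626,
    17392630,17393650,17393654,17410303,17410559,17417162,17417178,17422282,17422298,17428682,17428698,17429978,
    17431682,17431702,17431958,17445106,17445110,17446386,17447986,17447990,17448306,17448310,17461490,17461494,
    17462774,17464370,17464374,17464690,17464694,17474547,17474551,17475571,17475575]),(False,False,1,[19014455,
    19014515,19015475,19015479,19018550,19018610,19019570,19019574,19030835,19030839,19030899,19031863,19034930,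
    19034994,19084070,19084130,19085090,19085094,19100450,19100454,19100514,19100518,19276595,19276599,19276659,
    19277619,19277683,19277687,19280690,19280694,19280754,19280758,19281714,19281782,19294007,19294071,19297138,
    19297142,19298102,19298166,19346210,19346214,19347234,19347302,19362598,19362662,19363622,19363686])]"
  by (rule certificate[of 2 "[2,1,4,3,6,5]" "[2,3,1,5,6,4]" "[5,4,1,1,1,1]" "[1,1,1,1,6,7]" 3 0 115 1228]) (simp_all
    only: cert_rules)

lemma cert25: "good_groups [(False,False,0,[1193631,1195431,1209999,1219983,16921231,17352847,17352946,17363506,
    19032575,19038170,19046390,19135910,19308530,19398050,19529570,19566047,19566455,19570127]),(False,True,0,
    [1211811,1215903,1216359,1220451,16944931,17445667,19294463,19300298,19438079,19464038,19503359,19570547]),(False,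
    False,1,[17338147,17353267,19018291,19018531,19019383,19019623,19036003,19079731,19079986,19081078,19083811,
    19083826,19084903,19097203,19097458,19101298,19297843,19359283,19363363,19363378]),(False,False,-1,[19035703,
    19096183,19100278,19101223,19342198,19358263,19358578,19362358]),(False,True,-1,[19280743,19281523,19297123,
    19347043])]"
  by (rule certificate[of 2 "[1,3,5,2,4,6]" "[2,3,1,6,4,5]" "[4,5,1,1,6,7]" "[1,1,1,1,1,1]" 1 0 4 1795]) (simp_all
    only: cert_rules)

lemma cert26: "good_groups [(False,False,0,[271158,271923,272178,1081907,1082162,1084610,1087286,1087703,1088726,
    4204147,4327639,4327795,4328662,4328818,4339138,4349122,4349302,4351447,4355542,4357322,4361462,4757747,4771622,
    4819151,4820786,16810611,16816599,17409847]),(False,True,0,[270903,1083587,1087031,4203127,4203382,4204402,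
    4335043,4348099,4348279,4760435,4771274,4824566,4847462,4858679,4863794,16810866,16812483,16813506,16815735,
    16815990,16817622,17402359]),(False,False,-1,[17039,264438,264690,1057010,1057730,1058294,1058774,4196959,4229759,
    4233791,4237559,4237811,4341194,4361714,16810143,16819971,16918591,16923811,16940455,16949491,17342671,17394127,
    17399242,17441011,17442775,17446870])]"
  by (rule certificate[of 2 "[2,3,1,6,4,5]" "[1,4,2,5,3,6]" "[1,1,1,1,1,1]" "[4,1,5,6,1,7]" 1 0 6 1192]) (simp_all
    only: cert_rules)

lemma cert27: "good_groups [(False,False,0,[16938655]),(False,True,0,[16949095])]"
  by (rule certificate[of 2 "[2,3,1,5,6,4]" "[2,4,5,1,6,3]" "[4,1,1,1,6,1]" "[1,1,1,1,1,1]" 3 0 64 98]) (simp_all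
    only: cert_rules)

lemma cert28: "good_groups [(False,False,0,[19044607,19501042]),(False,True,0,[19505142,19565815]),(True,False,0,
    [19398042,19566067]),(True,True,0,[19135642,19302655])]"
  by (rule certificate[of 2 "[2,1,5,6,3,4]" "[3,5,6,1,4,2]" "[1,1,92,1,6,1]" "[1,1,4,5,1,1]" 1 0 424 291]) (simp_all
    only: cert_rules)

lemma cert29: "good_groups [(False,False,0,[4338634,4355034,4364751,17396682,17420042,17435087]),(False,True,0,
    [4336119,17394167]),(True,False,0,[4360671,17442575]),(True,True,0,[4352499,4362034,4366134,17410007,17436470,
    17448150])]"
  by (rule certificate[of 2 "[2,3,1,6,4,5]" "[4,5,6,1,2,3]" "[1,1,1,1,1,1]" "[1,19,7,4,1,6]" 1 0 26 392]) (simp_all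
    only: cert_rules)

lemma cert30: "good_groups [(False,False,0,[17342311]),(False,True,0,[17422963]),(False,False,1,[17462119]),(False,
    True,1,[17422495])]"
  by (rule certificate[of 2 "[2,1,5,6,4,3]" "[3,5,4,1,6,2]" "[1,5,1,7,4,1]" "[1,1,6,1,1,6]" 1 0 21 106]) (simp_all
    only: cert_rules)

lemma cert31: "good_groups [(False,False,0,[16911414]),(False,True,0,[16785654,16786959]),(True,False,0,[16787394]),
    (True,True,0,[16787511,16937154]),(False,False,-1,[16810806]),(True,False,-1,[16817346])]"
  by (rule certificate[of 2 "[2,4,1,6,3,5]" "[2,3,1,6,4,5]" "[1,1,1,1,1,1]" "[1,1,4,6,1,1]" 2 0 104 293]) (simp_all
    only: cert_rules)

lemma cert32: "good_groups [(False,False,0,[4341542,4350962,17399590,17403862,17466163,17472727]),(False,True,0,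
    [17336383,17392255])]"
  by (rule certificate[of 2 "[2,3,1,6,4,5]" "[3,5,4,1,6,2]" "[1,1,1,1,1,1]" "[4,1,1,1,6,1]" 2 0 89 106]) (simp_all
    only: cert_rules)

lemma cert33: "good_groups [(False,False,0,[17310271,17338306,17343283]),(True,False,0,[17336563,17468611]),(True,
    True,0,[17317666])]"
  by (rule certificate[of 2 "[2,3,1,6,4,5]" "[4,5,6,3,1,2]" "[1,4,1,5,1,1]" "[1,6,1,1,1,1]" 1 0 64 74]) (simp_all
    only: cert_rules)

lemma cert34: "good_groups [(False,False,0,[4204559])]"
  by (rule certificate[of 2 "[2,4,1,6,3,7,5]" "[1,2,3,5,4,7,6]" "[1,4,1,5,1,1,1]" "[1,1,1,1,1,7,6]" 6 0 357 18])
    (simp_all only: cert_rules)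

lemma cert35: "good_groups [(False,False,0,[4229471,4235319,4236663]),(False,True,0,[4233231,4233567,4236659])]"
  by (rule certificate[of 2 "[2,1,5,7,3,4,6]" "[3,5,4,1,7,2,6]" "[1,1,1,5,1,1,4]" "[1,1,4,1,1,1,6]" 2 0 418 426])
    (simp_all only: cert_rules)

lemma cert36: "good_groups [(False,False,0,[16948639])]"
  by (rule certificate[of 2 "[2,1,4,7,6,3,5]" "[3,4,1,5,2,7,6]" "[1,18,1,4,4,1,6]" "[1,1,1,1,1,1,1]" 3 0 264 1378])
    (simp_all only: cert_rules)

lemma cert37: "good_groups [(False,False,0,[17471999]),(False,True,0,[17475455])]"
  by (rule certificate[of 2 "[2,1,5,7,3,4,6]" "[3,5,6,1,7,2,4]" "[4,1,1,6,1,1,1]" "[1,1,1,1,1,1,1]" 1 0 16 458])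
    (simp_all only: cert_rules)

lemma cert38: "good_groups [(False,False,0,[1208975,1216295]),(False,True,0,[1211815,1215887]),(False,False,1,
    [19280679,19342899]),(False,True,1,[19019319,19096434,19343222,19363367]),(True,False,1,[19019559,19100274,
    19341879,19363382]),(True,True,1,[19281459,19347047])]"
  by (rule certificate[of 2 "[2,4,1,7,6,3,5]" "[1,4,6,5,2,7,3]" "[1,1,1,4,1,7,25]" "[1,1,6,4,1,1,1]" 6 0 345 105])
    (simp_all only: cert_rules)

lemma cert39: "good_groups [(False,False,0,[16943167]),(True,False,0,[16949455])]"
  by (rule certificate[of 2 "[1,4,5,6,2,7,3]" "[2,6,1,3,5,7,4]" "[1,1,22,1,1,28,1]" "[1,1,1,28,6,4,90]" 5 0 1641 6])
    (simp_all only: cert_rules)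

lemma cert40: "good_groups [(False,False,0,[4227875]),(True,False,0,[4230275])]"
  by (rule certificate[of 2 "[1,3,5,2,8,4,6,7]" "[2,1,6,7,8,3,4,5]" "[1,1,4,5,1,1,1,1]" "[1,6,16,4,4,1,4,4]" 2 0 288
    26]) (simp_all only: cert_rules)

lemma cert41: "good_groups [(False,False,0,[17422863]),(False,True,0,[17436063]),(True,False,0,[17436519]),(True,True,
    0,[17462799])]"
  by (rule certificate[of 2 "[1,4,6,2,7,8,3,5]" "[2,5,1,7,8,3,4,6]" "[1,1,4,1,1,4,1,21]" "[1,112,1,112,64,1,6,1]" 3 0
    18 1423]) (simp_all only: cert_rules)

lemma cert42: "good_groups [(False,False,0,[4751,66207,1049231,1050866,1051126,1190095,1195210,1206735,1211850,
    1214707,1214967,1215730,1215990,1223167,16777887,16787807,16810230,16812607,16813910,16815602,16816767,16817922,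
    16820467,16820727,16918751,16923866,16935391,16940506,16947443,16947703,16948466,16948726,16951551,17343247,
    17343327,17363722,17363802,17409807,17409887,17430282,17430362,17434867,17435127,17435890,17436150,17443327,
    17448906,17455347,17455607,17456370,17456630,17459455,17465306,17474527,17475535,19040767,19122831,19135882,
    19307007,19389071,19397770,19435510,19439602,19440591,19441631,19450431,19454591,19461066,19462106,19463331,
    19463591,19506143,19507151,19526618,19527626,19545231,19561871,19569907,19570167]),(False,False,1,[75315,1057586,
    1058419,1058614,16786995,16908915,16909110,16921430,16921970,16930610,16934743,16937730,16938358,17402319,
    17407798,17420134,17458035]),(False,True,1,[74295,74610,75638,1057399,16785975,16786290,16787318,16918275,
    16930423,17338226,17340639,17358626,17442615])]"
  by (rule certificate[of 2 "[2,1]" "[2,1]" "[72,7]" "[1,4]" 2 2 29 268]) (simp_all only: cert_rules)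

lemma cert43: "good_groups [(False,False,0,[1084470,1084790,1088562,1088882,16910531,16910551,16931011,16931031,
    17334911,17335286,17340031,17340406,17366054,17366374,17400383,17400818,17405503,17405938,17431586,17431906,
    17468471,17468791,17472563,17472883]),(False,False,1,[1057335,16786039,16786294,16787314,16917251,16930359,
    17406175,17441591,17442611]),(False,True,1,[1057590,1058355,1058610,16787059,16908851,16909106,16921346,16921974,
    16930614,16933719,16937814,16938354,17336783,17402063,17458039]),(False,False,2,[66191,1049247,1050870,1051122,
    16777871,16787471,16810226,16812671,16813826,16815606,16816703,16818006,16820471,16820723,17344271,17364746,
    17408783,17429258,17434871,17435123,17435894,17436146,17443071,17474511])]"
  by (rule certificate[of 2 "[2,1]" "[2,1]" "[4,1]" "[72,7]" 2 2 19 418]) (simp_all only: cert_rules)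

lemma cert44: "good_groups [(False,False,0,[68086,1056927,1058207,16779766,16787651,16787671,16813106,16813426,
    16910351,16930831,16935119,16940234,16944374,17315471,17317031,17364631,17397391,17398951,17464471]),(False,True,
    0,[1059267,1059287,16779506,16785551,16786831,16817206,16817526,16941251,16941271,16943351,17354534,17396383,
    17399203,17403698,17429123,17429143,17448323,17448343]),(False,False,1,[75319,75574,1057395,16786999,16787254,
    16916531,16918359,16918991,16920626,16922454,16924106,16930419,16930674,16943603,16944626,19309439,19395434,
    19555319,19559414]),(False,False,-1,[1058423,1058678,16785971,16786226,16908919,16909174,16932919,16934659,
    16937014,16938754])]"
  by (rule certificate[of 2 "[2,1]" "[2,1]" "[1,4]" "[6,1]" 1 2 25 77976]) (simp_all only: cert_rules)

lemma cert45: "good_groups [(False,False,0,[67826,74359,74614,75634,1083967,1188415,1188850,1190367,1195482,1195810,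
    1219059,1220082,1221427,16918079,16918514,16924514,17312243,17314463,17314778,17317283,17340895,17342243,17342326,
    17357215,17357363,17424226,17464514,19040511,19047411,19048319,19087146,19098239,19126943,19134119,19134314,
    19135626,19310399,19360319,19435506,19520063,19529123,19538751,19545503,19545906,19559999,19560434]),(False,True,
    0,[75379,1091827,16950131,17338211,17344451,17353331,17364611,17459059,17463139,17464451,19396259,19396394,
    19539959,19543679,19544054,19545959,19556339,19562339,19565811]),(False,False,1,[4767,1206495,1211610,1218807,
    1219830,17336543,17344351,17352863,17353946,17364826,17408863,17429338,17455351,17455603,17456374,17456626,
    17457971,17459711,17462051,17462066,17475551,19044863,19081791,19133091,19135898,19302911,19384991,19397786,
    19501046,19505138,19516031,19528871,19542591,19545891,19561631,19569911,19570163]),(False,False,-1,[1057650,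
    17356943,17357431]),(False,True,-1,[17407843,17445731])]"
  by (rule certificate[of 2 "[1,2]" "[2,1]" "[18,7]" "[1,4]" 1 2 103 1430]) (simp_all only: cert_rules)

lemma cert46: "good_groups [(False,False,0,[4230551]),(True,False,0,[4233059])]"
  by (rule certificate[of 2 "[1,4,5,7,2,3,8,6]" "[2,4,5,1,7,6,3,8]" "[1,1,1,1,1,1,1,1]" "[6,6,6,4,6,6,6,6]" 2 0 1187
    25]) (simp_all only: cert_rules)

lemma cert47: "good_groups [(False,False,0,[4232999]),(False,True,0,[4234391])]"
  by (rule certificate[of 2 "[1,3,6,2,7,8,4,5]" "[2,3,4,7,6,8,5,1]" "[1,1,1,1,1,1,1,1]" "[6,6,6,6,6,6,6,4]" 3 0 4263
    22]) (simp_all only: cert_rules)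

lemma cert48: "good_groups [(False,False,0,[4227943]),(True,False,0,[4234627])]"
  by (rule certificate[of 2 "[1,4,6,3,2,8,5,7]" "[2,4,5,3,1,8,7,6]" "[1,1,1,1,1,1,1,1]" "[6,6,6,6,4,6,6,6]" 2 0 1443
    25]) (simp_all only: cert_rules)

text \<open>The one-point case with K = 3. The second loop is t^-2 a t^3 a: the digit 1 needs three
  shifts to come round, after two shifts back.\<close>

lemma cert49: "good_groups [(False,False,0,[19460751,19460767,19461775,19461791,19526287,19526303,19527311,
    19527327])]"
  by (rule certificate[of 2 "[1]" "[1]" "[4]" "[6]" 1 3 6 31912]) (simp_all only: cert_rules)

lemma cert50: "good_groups [(False,False,0,[16815911]),(False,True,0,[16817303])]"
  by (rule certificate[of 2 "[1,4,6,8,2,5,3,9,7]" "[2,4,5,8,6,7,9,1,3]" "[1,1,1,1,1,1,1,1,1]" "[6,6,6,6,6,6,6,4,6]" 2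
    0 4259 25]) (simp_all only: cert_rules)

lemma cert51: "good_groups [(False,False,0,[16810787]),(True,False,0,[16813187])]"
  by (rule certificate[of 2 "[1,4,7,6,2,3,9,5,8]" "[2,4,5,7,9,6,8,3,1]" "[1,1,1,1,1,1,1,1,1]" "[6,6,6,6,6,6,6,6,4]" 2
    0 21923 25]) (simp_all only: cert_rules)

text \<open>The one-point case with p = 3. Here the second loop must end in a^-1 to restore the
  digit 0. The relators include a^3 t a^3 t^-1 and a^3 t a^-3 t^-1.\<close>

lemma cert52: "good_groups [(False,False,0,[66051,66135,271143,272163,1058831,1059167,1082147,1084547,1087271,1088663,
    4194819,4194903,4203367,4204387,4328599,4328803,4339075,4349059,4349287,4355479,16810851,16813443,16815975,
    16817559,16916535,16917879,16932915,16934259,16949311,16950655,19079971,19343143])]"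
  by (rule certificate[of 3 "[1]" "[1]" "[4]" "[6]" 1 2 6 1833]) (simp_all only: cert_rules)

lemma cert53: "good_groups [(False,False,0,[16810855]),(True,False,0,[16817539])]"
  by (rule certificate[of 2 "[1,4,5,7,2,3,11,10,8,6,9]" "[2,4,5,7,6,9,3,11,10,8,1]" "[1,1,1,1,1,1,1,1,1,1,1]" "[6,6,6,
    6,6,6,6,6,6,6,4]" 2 0 16547 25]) (simp_all only: cert_rules)

lemma cert54: "good_groups [(False,False,0,[16813463]),(True,False,0,[16815971])]"
  by (rule certificate[of 2 "[1,4,6,3,2,10,5,11,8,9,7]" "[2,4,5,11,3,10,7,8,6,9,1]" "[1,1,1,1,1,1,1,1,1,1,1]" "[6,6,6,
    6,6,6,6,6,6,6,4]" 2 0 21923 25]) (simp_all only: cert_rules)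

lemma cert55: "good_groups [(False,False,0,[4227879]),(True,False,0,[4234371])]"
  by (rule certificate[of 2 "[1,4,7,10,2,5,8,11,3,6,9]" "[2,4,6,3,10,1,11,5,9,8,7]" "[1,1,1,1,1,1,1,1,1,1,1]" "[1,1,1,
    6,1,4,6,1,6,6,6]" 5 0 361 106]) (simp_all only: cert_rules)

lemma cert56: "good_groups [(False,False,0,[4227939]),(True,False,0,[4230531])]"
  by (rule certificate[of 2 "[1,10,8,6,4,2,11,9,7,5,3]" "[2,10,3,4,1,11,6,9,8,7,5]" "[1,1,1,1,1,1,1,1,1,1,1]" "[6,6,1,
    6,4,1,6,1,1,1,6]" 4 0 5783 6]) (simp_all only: cert_rules)

lemma cert57: "good_groups [(False,False,0,[4339343]),(True,False,0,[4362083]),(False,True,-1,[4336079]),(True,True,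
    -1,[4360691])]"
  by (rule certificate[of 2 "[1,2,3]" "[2,3,1]" "[6,19,4]" "[1,26,1]" 1 2 4 8034]) (simp_all only: cert_rules)

lemma cert58: "good_groups [(False,False,0,[68211,1051023,16786390,16911734]),(False,True,0,[16785935,16920790]),
    (True,False,0,[67743,1051191,16931890]),(True,True,0,[16786930,16787507,16938434]),(False,False,1,[1082230,
    1087939,16813270,16815667]),(True,False,1,[1081975,1088962,16812247,16815922])]"
  by (rule certificate[of 2 "[2,3,1]" "[1,3,2]" "[291,1,1]" "[4,4,6]" 2 2 18 114838]) (simp_all only: cert_rules)

lemma cert59: "good_groups [(False,False,0,[18995,4196767,4196854,4368179,4860159,4865994,19294003]),(False,True,0,
    [18575,18674,4196983,4334207,4891599,17337586,17363746,19015543,19019638,19036018,19101538,19363618]),(False,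
    False,1,[4204342]),(False,True,1,[271218]),(False,False,2,[4234294]),(False,True,2,[4230514])]"
  by (rule certificate[of 2 "[2,3,1]" "[3,1,2]" "[72,7,1]" "[4,1,4]" 2 2 101 1032]) (simp_all only: cert_rules)

lemma cert60: "good_groups [(False,False,0,[272835,4203478,4203919]),(False,True,0,[270582]),(True,False,0,[270495,
    272322,4204759]),(True,True,0,[4204018]),(False,False,1,[4230358]),(False,True,1,[4227958]),(True,False,1,
    [4234690]),(True,True,1,[4233010]),(False,False,-1,[270963,4204087]),(False,False,2,[4337878,4348375]),(False,
    True,2,[4348978])]"
  by (rule certificate[of 2 "[2,3,1]" "[2,3,1]" "[99,1,4]" "[72,6,1]" 2 2 25 1826]) (simp_all only: cert_rules)

lemma cert61: "good_groups [(False,False,0,[272439,4203103]),(False,True,0,[271887,4204915]),(False,False,-1,[4333783,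
    4349398]),(False,True,-1,[4347955])]"
  by (rule certificate[of 2 "[2,3,1]" "[2,3,1]" "[1,291,1]" "[24,7,4]" 2 2 74 1699]) (simp_all only: cert_rules)

lemma cert62: "good_groups [(False,False,0,[4759331,4769951,4846130,17422903,17446759]),(False,True,0,[4771235,
    4824479,17422834,17429095]),(True,False,0,[4770419,4879139,17364598,17403751,17422735]),(True,True,0,[4770038,
    4781603,4879991,17423527]),(False,False,-1,[19080823,19084918,19298083]),(False,True,-1,[19035763,19101283,
    19359538])]"
  by (rule certificate[of 2 "[2,3,1]" "[2,3,1]" "[1,1,1]" "[24,6,4]" 2 2 25 7590]) (simp_all only: cert_rules)

lemma cert63: "good_groups [(False,False,0,[16917055,16951159]),(True,False,0,[16934527,16950067])]"
  by (rule certificate[of 2 "[2,3,1]" "[2,3,1]" "[4,24,19]" "[7,1,1]" 3 2 127 1033]) (simp_all only: cert_rules)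

lemma cert64: "good_groups [(False,False,0,[4230295]),(False,True,0,[4232995])]"
  by (rule certificate[of 2 "[12,3,9,11,1,6,2,7,8,10,5,4]" "[1,4,2,6,3,5,7,11,9,10,8,12]" "[1,1,1,1,1,1,1,1,1,1,1,1]"
    "[6,6,1,4,1,6,1,6,1,1,1,6]" 1 0 4259 6]) (simp_all only: cert_rules)

lemma cert65: "good_groups [(False,False,0,[4233063]),(False,True,0,[4234647])]"
  by (rule certificate[of 2 "[12,4,10,1,2,7,3,8,9,11,6,5]" "[1,3,7,5,6,4,8,11,9,2,10,12]" "[1,1,1,1,1,1,1,1,1,1,1,1]"
    "[6,1,1,6,1,6,4,1,1,6,1,6]" 3 0 1445 74]) (simp_all only: cert_rules)

lemma cert66: "good_groups [(False,False,0,[17338215,17403747]),(False,True,0,[17357367,17422899]),(False,False,1,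
    [17445735,19048255,19133290,19310463,19395235,19542655,19545955,19559410,19562343]),(False,True,1,[17422479,
    19098175,19133095,19360383,19395370,19539955,19543030,19556343,19558975]),(False,False,-1,[17446755]),(False,True,
    -1,[17357199])]"
  by (rule certificate[of 2 "[1,2,3,4]" "[2,4,1,3]" "[99,24,6719,99]" "[1,4751,1,1]" 2 2 456 89216]) (simp_all only:
    cert_rules)

lemma cert67: "good_groups [(False,False,0,[16917494,16933439,17463154]),(False,True,0,[17419466]),(True,False,0,
    [16940834,16950071,17445686]),(True,True,0,[17358298])]"
  by (rule certificate[of 2 "[2,1,4,3]" "[3,4,2,1]" "[4,1,1,1]" "[1,6,1,1]" 1 2 90 8135305]) (simp_all only:
    cert_rules)

lemma cert68: "good_groups [(False,False,0,[17364534]),(False,True,0,[17310706,17366146]),(True,True,0,[17418738]),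
    (False,False,1,[19084854,19298087,19342967]),(False,True,1,[19034739,19343154,19345959]),(False,False,-1,
    [19014451,19018546,19084066])]"
  by (rule certificate[of 2 "[2,4,1,3]" "[1,4,2,3]" "[1,1,1,4]" "[6,1,6,1]" 1 2 6 5069184]) (simp_all only:
    cert_rules)

lemma cert69: "good_groups [(False,False,0,[67830,1056911,1058191,16779510,16787907,16787927,16817202,16817522,
    16910687,16931167,17315487,17317027,17354594,17397407,17398947,17403766,17430147,17430167,17448067,17448087]),
    (True,False,0,[68082,1059011,1059031,16779762,16785567,16786847,16813110,16813430,16946627,16946647,17314447,
    17317287,17342258,17363587,17363607,17396367,17399207,17424166,17464707,17464727]),(False,False,1,[74550,75383,
    1057331,1058674,16786230,16787063,16909170,16917335,16917875,16930355,16937010,16938838]),(False,True,1,[74355,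
    75570,1057654,1058359,16786035,16787250,16908855,16920630,16922370,16930678,16933635,16934263])]"
  by (rule certificate[of 2 "[2,1]" "[2,1]" "[99,4]" "[6,1]" 2 3 26 1890918]) (simp_all only: cert_rules)

lemma cert70: "good_groups [(False,False,0,[17311359,17407938]),(True,False,0,[17472963]),(True,True,0,[17317734]),
    (False,True,-1,[17311734,17431938]),(False,False,-2,[19034934,19293047,19346274])]"
  by (rule certificate[of 2 "[1,3,4,2]" "[2,4,1,3]" "[4,1,1,4]" "[1,1,1,6]" 3 2 18 469120]) (simp_all only:
    cert_rules)

lemma cert71: "good_groups [(False,False,0,[1084466,1084786,1088566,1088886,16910787,16910807,16931267,16931287,
    17334847,17335282,17339967,17340402,17366050,17366370,17400447,17400822,17405567,17405942,17431590,17431910,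
    17468467,17468787,17472567,17472887]),(False,False,1,[17406431,17441587]),(False,True,1,[17336527,17459063])]"
  by (rule certificate[of 2 "[2,1]" "[2,1]" "[291,1]" "[4643,7]" 2 3 19 100963]) (simp_all only: cert_rules)

lemma cert72: "good_groups [(False,False,0,[19047415,19103530,19365738,19538815,19545970,19562358]),(False,True,0,
    [19309555,19555135])]"
  by (rule certificate[of 2 "[1,3,2,4]" "[2,1,4,3]" "[1699,1,291,79]" "[1,399,1,6]" 4 2 26 4617]) (simp_all only:
    cert_rules)

lemma cert73: "good_groups [(False,False,0,[4351990]),(True,True,0,[4357990])]"
  by (rule certificate[of 2 "[1,3,4,2]" "[2,4,1,3]" "[1,1,99,4]" "[6,4,1,1]" 2 2 74 8129114]) (simp_all only:
    cert_rules)

lemma cert74: "good_groups [(False,False,0,[1206479,16940250,16944370,16947699,17358630]),(False,True,0,[1190111,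
    1211866,1215986,16943607,17342262]),(True,False,0,[1195466,1214711,1220086,16919007,17420130]),(True,True,0,
    [1218803,16923850,16935375,16948470,17403762]),(False,False,1,[17338162]),(False,True,1,[17424230]),(True,False,1,
    [17407862]),(True,True,1,[17354530])]"
  by (rule certificate[of 2 "[2,1,4,3]" "[3,4,1,2]" "[1,1,24,28]" "[24,1,1,7]" 4 2 31 4232]) (simp_all only:
    cert_rules)

lemma cert75: "good_groups [(False,False,0,[1190351,1219826,16924122,16947447,17403702]),(False,True,0,[1215734,
    1219063,16918735,16940490,17358690]),(True,False,0,[1211594,1214963,16935135,16944630,17342322]),(True,True,0,
    [1195226,1206751,16943347,16948722,17420070]),(False,False,1,[17354598]),(False,True,1,[17338230]),(True,False,1,
    [17424162]),(True,True,1,[17407794])]"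
  by (rule certificate[of 2 "[2,1,4,3]" "[3,4,1,2]" "[291,1,1,1]" "[6,4,1,1]" 3 2 26 115238]) (simp_all only:
    cert_rules)

lemma cert76: "good_groups [(False,False,0,[1222451,16924518,16933878,16934463,17366826,17423562,17432426]),(False,
    True,0,[1188854,1195874,1222519,17463090,17469426,17473526]),(True,False,0,[1188479,1189874,1212194,16950135,
    17354202]),(True,True,0,[1205887,16934898,16940838,17445750]),(False,False,1,[17446710]),(False,True,1,
    [17358042]),(True,False,1,[17462130]),(True,True,1,[17419722])]"
  by (rule certificate[of 2 "[2,1,4,3]" "[3,4,2,1]" "[1,1,291,1]" "[6,7,4,1]" 2 2 79 24739]) (simp_all only:
    cert_rules)

lemma cert77: "good_groups [(False,False,0,[16912346,17315786]),(False,True,0,[16949471,17408963]),(True,True,0,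
    [16947263,16949186,17311991,17448386]),(False,True,1,[17340623,17441651])]"
  by (rule certificate[of 2 "[2,1,4,3]" "[3,4,1,2]" "[1,6,28,1]" "[1,98,1,31]" 1 2 16 1401384]) (simp_all only:
    cert_rules)

lemma cert78: "good_groups [(False,False,0,[1195814,1204799,16917490,16951155,17463158]),(False,True,0,[1212262,
    1221491,16918518,16933503,17353930]),(True,False,0,[1206262,1221431,16918143,16940898,17445682]),(True,True,0,
    [1189439,1205234,16924450,16951095,17423834]),(False,False,-1,[17358282]),(False,True,-1,[17462070]),(True,False,
    -1,[17419482]),(True,True,-1,[17446770])]"
  by (rule certificate[of 2 "[2,1,4,3]" "[3,4,2,1]" "[291,1,4,4]" "[1,6,4,1]" 4 2 74 28834]) (simp_all only:
    cert_rules)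

lemma cert79: "good_groups [(False,False,0,[17352950]),(True,True,0,[17429042]),(False,False,1,[19079990,19084835,
    19297911]),(False,True,1,[19034915,19079795,19345970])]"
  by (rule certificate[of 2 "[2,4,1,3]" "[1,4,2,3]" "[1,1,1,291]" "[99,1571,4,6]" 3 2 258 7178]) (simp_all only:
    cert_rules)

lemma cert80: "good_groups [(False,False,0,[17338166,17420066])]"
  by (rule certificate[of 2 "[1,3,2,4]" "[2,1,4,3]" "[24,1,4,7]" "[4,1,1,4]" 1 2 74 1440]) (simp_all only: cert_rules)

lemma cert81: "good_groups [(False,False,0,[1222911,16951807,19048435,19087210,19310583,19349290,19539775,19545910,
    19556223,19562290])]"
  by (rule certificate[of 2 "[1,3,2,4]" "[2,4,1,3]" "[4,72,7,4]" "[1,4,1,1]" 3 2 105 1064]) (simp_all only: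
    cert_rules)

lemma cert82: "good_groups [(False,False,0,[16917119,17423578,17462134]),(False,True,0,[16924454,16933874,16951091,
    17354186,17446706])]"
  by (rule certificate[of 2 "[2,1,4,3]" "[3,4,2,1]" "[4,1,1,4]" "[1,6,1,1]" 3 2 105 311912]) (simp_all only:
    cert_rules)

lemma cert83: "good_groups [(False,False,0,[17338151]),(False,True,0,[17418803]),(False,False,1,[1092087,17445671,
    19398026,19439606,19566071]),(False,True,1,[1088127,17418383,19306751]),(False,False,2,[17406415]),(False,True,2,
    [17442679])]"
  by (rule certificate[of 2 "[2,1,4,3]" "[1,3,2,4]" "[1,18,7,1]" "[1,1,4,1]" 1 2 296 91481]) (simp_all only:
    cert_rules)

lemma cert84: "good_groups [(False,False,0,[19134115,19134250,19309375,19343935,19538935,19545895,19560063,19560438]),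
    (False,True,0,[19047295,19081855,19396263,19396458,19543615,19544050,19555315,19562275])]"
  by (rule certificate[of 2 "[1,3,2,4]" "[2,4,1,3]" "[1187,4,99,7]" "[1,1,1,1]" 4 2 5 18985]) (simp_all only:
    cert_rules)

lemma cert85: "good_groups [(False,False,0,[16934902]),(True,True,0,[16940902])]"
  by (rule certificate[of 2 "[2,1,4,3]" "[3,4,2,1]" "[72,1,6,1]" "[291,4,4,1]" 4 2 16 22024]) (simp_all only:
    cert_rules)

lemma cert86: "good_groups [(False,False,0,[74291,74546,76351,1192607,1195427,1219999,1220387,19016191,19021786,
    19046386,19047231,19133226,19135906,19503615,19529506,19538931,19543026,19570143,19570483]),(False,False,1,
    [19080819,19084899,19292979,19297059,19297907]),(False,True,1,[19014519,19019634,19035767,19035939,19036022,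
    19079799,19080054,19101219,19101302,19101474,19359602,19362354,19363682])]"
  by (rule certificate[of 3 "[1,2]" "[2,1]" "[73,7]" "[1,4]" 2 2 5 1155]) (simp_all only: cert_rules)

lemma cert87: "good_groups [(False,False,0,[16819775]),(True,False,0,[16820447])]"
  by (rule certificate[of 2 "[2,1,5,3,4]" "[3,4,1,5,2]" "[1,291,4,291,4]" "[1,1,4,6,1]" 5 2 106 121494]) (simp_all
    only: cert_rules)

lemma cert88: "good_groups [(False,False,0,[1192906,1192922,1193946,1209290,1209306,1210314,1214671,1214927,1214943,
    1218783,1219023,1219039,16921546,16921562,16922570,16922586,16937930,16937946,16938954,16938970,16943311,16943327,
    16943567,16943583,16947407,16947423,16947663,16947679,17337590,17337842,17337846,17341682,17341686,17341938,
    17341942,17403122,17403126,17403378,17403382,17407218,17407222,17407474,17407478]),(False,True,0,[1190131,1190387,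
    1190391,1206519,1206771,1206775,1216306,1216310,1216374,1220402,1220406,1220466,16918771,16918775,16919027,
    16919031,16935155,16935159,16935411,16935415,16944946,16944950,16945010,16945014,16949042,16949046,16949106,
    16949110,17363750,17363810,17363814,17364770,17364774,17364834,17364838,17429282,17429286,17429346,17429350,
    17430306,17430310,17430370,17430374])]"
  by (rule certificate[of 2 "[1,4,5,2,3]" "[2,5,1,4,3]" "[1,1,1,1,1]" "[1,6,1,4,4]" 3 2 424 5015722]) (simp_all only:
    cert_rules)

lemma cert89: "good_groups [(False,False,0,[17419687]),(True,False,0,[17430055])]"
  by (rule certificate[of 2 "[2,4,1,5,3]" "[1,4,5,3,2]" "[1,99,1,1,98]" "[4,1,19,24,24]" 3 2 24 1400842]) (simp_all
    only: cert_rules)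

lemma cert90: "good_groups [(False,False,0,[17357407]),(False,True,0,[1091199,17446495]),(True,False,0,[17456995]),
    (True,True,0,[1092063,17456527])]"
  by (rule certificate[of 2 "[2,1,5,3,4]" "[3,4,5,1,2]" "[1,99,99,6,1]" "[1,19,7,1,4]" 3 2 124 22771]) (simp_all
    only: cert_rules)

lemma cert91: "good_groups [(False,False,0,[1193615,1210015,19018359,19048399,19081074,19097462,19310559,19362339,
    19463386,19561714]),(False,True,0,[1211555,1215647,19097139,19359347,19386154,19451866,19539919,19556319]),(True,
    False,0,[1216355,1220455,19083879,19296819,19441651,19507191,19528906,19545334]),(True,True,0,[1195175,1219727,
    19019619,19036007,19101234,19124074,19363442,19441471,19507071,19517386]),(False,False,-1,[19096119,19100214,
    19358327,19362422]),(False,True,-1,[19280499,19346019]),(True,False,-1,[19280739,19297127]),(True,True,-1,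
    [19034679,19100199,19342194,19358582])]"
  by (rule certificate[of 2 "[1,4,5,2,3]" "[2,5,1,4,3]" "[1,24,399,1,1]" "[1,7,1,4,6]" 4 2 66 22016]) (simp_all only:
    cert_rules)

lemma cert92: "good_groups [(False,False,0,[17351311,17447971])]"
  by (rule certificate[of 2 "[2,4,1,5,3]" "[1,5,4,2,3]" "[4,1,1,1,1]" "[4,72,6,1,1]" 5 2 72 28710]) (simp_all only:
    cert_rules)

lemma cert93: "good_groups [(False,False,0,[18847,1051187,4236274,16779679,19292983,19297078]),(False,True,0,[18591,
    18930,1089498,16779423,19030903,19034998,19281778,19347298]),(True,False,0,[18678,19063,1050767,1091574,16779895,
    19035958,19101478,19276663,19362658]),(True,True,0,[19059,4231114,16779891,19293043,19346278]),(False,False,1,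
    [16816323]),(False,True,1,[272242]),(True,False,1,[271222,16810551]),(False,False,2,[4230518]),(False,True,2,
    [4234610])]"
  by (rule certificate[of 2 "[2,4,1,5,3]" "[1,5,4,2,3]" "[1,24,1,19,1]" "[4,99,1,7,4]" 4 2 451 17269]) (simp_all
    only: cert_rules)

lemma cert94: "good_groups [(False,False,0,[4228054,4232719,4360255,16908815,16912130,16930774,16950751]),(False,True,
    0,[4227599,4366579,16930319,16935295]),(True,False,0,[4235479,4366543,16941827,16947583]),(True,True,0,[4233154,
    4235459,4335679,16909250,16932694,16941911,16950775]),(False,False,1,[16910387]),(False,True,1,[16930871]),(True,
    False,1,[16916675]),(True,True,1,[16933079]),(False,False,-1,[4233271]),(False,True,-1,[4229171])]"
  by (rule certificate[of 2 "[2,4,1,5,3]" "[1,4,5,3,2]" "[24,19,1,1,1]" "[4,1,99,4,6]" 2 2 98 1417]) (simp_all only: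
    cert_rules)

lemma cert95: "good_groups [(False,False,0,[1091135,1091570,19015539,19035954,19101542,19135654,19362594,19499263]),
    (False,True,0,[17353891,19084134,19294067,19529574,19566451]),(True,False,0,[1091807,19031859,19297074,19300314,
    19565791]),(True,True,0,[1085402,17363491,19018614,19031927,19032319,19085154,19298162,19304434]),(False,False,-1,
    [17343351]),(True,False,-1,[17406195])]"
  by (rule certificate[of 2 "[2,4,1,5,3]" "[1,4,5,3,2]" "[1,18,7,1,4]" "[4,1,1,1,1]" 3 2 354 66391]) (simp_all only:
    cert_rules)

lemma cert96: "good_groups [(False,False,0,[17422943,17424218,17441631]),(False,True,0,[17445471]),(True,False,0,
    [17455311,17456999]),(True,True,0,[17456271,17457014]),(False,False,1,[17408883]),(True,False,1,[17340663])]"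
  by (rule certificate[of 2 "[2,4,1,5,3]" "[1,4,5,3,2]" "[1,291,1,1,1]" "[4,72,4,7,99]" 4 2 22 98903]) (simp_all
    only: cert_rules)

lemma cert97: "good_groups [(False,False,0,[68215,17340919,17364583,17406199,17455567,19097398,19280503,19310543,
    19362403]),(False,True,0,[16922070,17457010,19097143,19346038,19358323,19390250,19455962,19539935]),(True,False,0,
    [67999,16932210,17358682,17408887,17409907,17423779,17442655,19100263,19296823,19358518,19441655,19529162,
    19545590]),(True,True,0,[19034983,19281763,19347058,19507007]),(False,True,1,[17429110]),(True,False,1,
    [17422582]),(False,False,-1,[1083863,1084886,17340799,17342422,17357302,17358247,17468887]),(True,False,-1,
    [1087091,1087346,17393215,17399650,17430115,17430130,17471347])]"
  by (rule certificate[of 2 "[1,4,2,5,3]" "[2,5,1,4,3]" "[4,1,4,99,6]" "[1,1,1,99,6]" 2 2 256 22915104]) (simp_all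
    only: cert_rules)

lemma cert98: "good_groups [(False,False,0,[262815,264799,4194959]),(False,False,1,[4233587]),(False,True,1,
    [4229495])]"
  by (rule certificate[of 2 "[2,4,1,5,3]" "[1,4,5,3,2]" "[1,6,1,7,1]" "[4,1,7,1,6]" 2 2 19 26610072]) (simp_all only:
    cert_rules)

lemma cert99: "good_groups [(False,False,0,[1090111]),(True,False,0,[1091791]),(False,False,1,[17408819]),(True,False,
    1,[17336567])]"
  by (rule certificate[of 2 "[1,4,2,5,3]" "[2,4,1,3,5]" "[291,24,399,1,1]" "[1,6,1,99,99]" 4 2 424 94826]) (simp_all
    only: cert_rules)

lemma cert100: "good_groups [(False,False,0,[18934,18999,1190135,1193930,1210330,1214687,1216370,1220470,4196511,
    4360439,17429962,17446390,19277623,19281718,19347238]),(False,True,0,[18831,1206515,1218767,4196594,4196979,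
    4352207]),(False,False,-1,[272246]),(False,True,-1,[4203314]),(False,False,-2,[4234614]),(False,True,-2,
    [4230194])]"
  by (rule certificate[of 2 "[2,3,1]" "[1,3,2]" "[1,4751,1]" "[24,115,419]" 1 3 477 18794]) (simp_all only:
    cert_rules)

lemma cert101: "good_groups [(False,False,0,[272435,4204127,17442295]),(False,True,0,[270863,4204919,17409487]),
    (False,False,1,[4350147]),(False,True,1,[4327479,4328898])]"
  by (rule certificate[of 2 "[2,3,1]" "[1,3,2]" "[1,4751,1]" "[25231,72,74]" 2 3 1802 1830]) (simp_all only:
    cert_rules)

lemma cert102: "good_groups [(False,False,0,[4758687,4835826,4846119,17358243]),(False,True,0,[4824871,4835743,
    17429106]),(True,False,0,[4836519,4878963,17357046,17364579]),(True,True,0,[4781622,4835959,4880167]),(False,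
    False,-1,[19096374,19296887,19362407]),(False,True,-1,[19034919,19341939,19346034])]"
  by (rule certificate[of 2 "[2,3,1]" "[1,3,2]" "[1,1,1]" "[72,99,6]" 2 3 18 122024]) (simp_all only: cert_rules)

lemma cert103: "good_groups [(False,False,0,[271318,272855,4202639,17354586,17441731,17459039]),(False,True,0,
    [4202742,17317066]),(True,False,0,[271775,4204482,4204739,17311951,17445826,17455583]),(True,True,0,[271858,
    17456946]),(False,False,1,[271991,4203059]),(False,False,-1,[4230614]),(False,True,-1,[4227894]),(True,False,-1,
    [4234434]),(True,True,-1,[4233074]),(False,False,-2,[4327875,4354242]),(False,True,-2,[4328502])]"
  by (rule certificate[of 2 "[2,3,1]" "[1,3,2]" "[24,116879,1]" "[18,1,6]" 2 3 26 8040]) (simp_all only: cert_rules)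

lemma cert104: "good_groups [(False,False,0,[4341159,4365455,16923815,16948623]),(True,False,0,[4357539,4361375,
    16940195,16944543])]"
  by (rule certificate[of 2 "[1,4,6,3,2,5]" "[2,4,1,3,5,6]" "[1,1,4,4,1,1]" "[1,6,1,4,4,1]" 2 2 25 5081482])
    (simp_all only: cert_rules)

lemma cert105: "good_groups [(False,False,0,[1051251,16779663]),(True,False,0,[1050783,16779831]),(False,False,1,
    [16816579]),(True,False,1,[16810615])]"
  by (rule certificate[of 2 "[1,4,6,3,2,5]" "[2,6,1,4,3,5]" "[4,1,1,6,1,19]" "[1,1,72,6,1,1]" 1 2 1575 1890])
    (simp_all only: cert_rules)

lemma cert106: "good_groups [(False,False,0,[4350527]),(True,False,0,[4367159]),(False,False,2,[4355727]),(True,False,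
    2,[4362087])]"
  by (rule certificate[of 2 "[1,2,3,4,5,6]" "[2,4,1,6,3,5]" "[27199,419,7,1571,6719,4]" "[1,1,1,1,1,6287]" 3 2 5
    1105061]) (simp_all only: cert_rules)

lemma cert107: "good_groups [(False,False,0,[4340903,4365711,16924071,16948367]),(True,False,0,[4357283,4361631,
    16940451,16944287])]"
  by (rule certificate[of 2 "[1,4,5,6,2,3]" "[2,4,1,5,6,3]" "[1,1,1,1,1,1]" "[1578,28,1,298,127,6]" 3 2 22 30240])
    (simp_all only: cert_rules)

lemma cert108: "good_groups [(False,False,0,[16937615,17418639]),(False,True,0,[16944935,17446695]),(False,False,-1,
    [17403687,17418807])]"
  by (rule certificate[of 2 "[1,3,2,5,4,6]" "[2,4,1,6,3,5]" "[72,24,1,28,1,7]" "[1,1,72,1,24,124]" 4 2 79 1194])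
    (simp_all only: cert_rules)

lemma cert109: "good_groups [(False,False,0,[19278079,19283914,19437823,19463974]),(False,True,0,[17422838,17430134,
    19308534,19398054,19566031,19566391]),(False,False,-1,[19080759,19100259,19280439,19281699,19347062,19359542])]"
  by (rule certificate[of 2 "[2,1,6,3,4,5]" "[3,5,6,1,4,2]" "[291,1,1,1,1,1]" "[1,72,4,7,4,1]" 4 2 79 26215])
    (simp_all only: cert_rules)

lemma cert110: "good_groups [(False,False,0,[1051255,16779407]),(True,False,0,[1051039,16779827]),(False,False,-1,
    [16812503]),(True,False,-1,[16815731])]"
  by (rule certificate[of 2 "[1,4,5,6,2,3]" "[2,3,1,6,4,5]" "[4,18,1,1,1827,1]" "[1,18,1,1,6,4]" 5 2 384 78434])
    (simp_all only: cert_rules)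

lemma cert111: "good_groups [(False,False,0,[16908895,16932610]),(True,False,0,[16946947]),(True,True,0,[16909270]),
    (False,False,1,[16910707]),(True,False,1,[16917955])]"
  by (rule certificate[of 2 "[1,4,2,6,3,5]" "[2,3,1,6,4,5]" "[4,1,99,419,1,399]" "[1,7,1,1,7,291]" 2 2 127 26871])
    (simp_all only: cert_rules)

lemma cert112: "good_groups [(False,False,0,[17055,262799,264694,1057014,1057750,1058290,1058754,4196879,4228034,
    4229695,4233174,4233855,4237555,4237815,4335839,4340954,4352479,4357594,4364531,4364791,4365554,4365814,4368639,
    4876543,4882394,4891615,16810127,16815503,16818947,16819031,16918911,16924067,16934975,16940199,16949495,16950771,
    17312223,17317338,17343967,17393887,17399002,17408223,17457399,17458135,17458675,17459139,17462230,17463234]),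
    (False,False,1,[271987,1081971,1082166,1084630,1087282,1087959,1088706,4327475,4327895,4328642,4328822,4339158,
    4349142,4349298,4350167,4355522,4824886,4825911,4837222,4875123,16810547,16816343,17340915,17358026,17445746]),
    (False,True,1,[270967,1083843,1087095,4204406,4333763,4347959,4348355,4757727,4781862,4819191,4820466,4836826,
    4880182,16810870,16812227,16813526,16815671,16815986,16817602,17344371])]"
  by (rule certificate[of 2 "[2,3,1,5,6,4]" "[4,5,6,1,3,2]" "[18,28,1,1,1,1]" "[1,1,24,4,7,4]" 2 2 408 74343])
    (simp_all only: cert_rules)

lemma cert113: "good_groups [(False,False,0,[16938639,16944271,16944999])]"
  by (rule certificate[of 2 "[2,1,5,6,4,3]" "[1,3,4,2,6,5]" "[1,4,1,6,7,1]" "[4,1,1,1,1,1]" 3 2 96 1108091074])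
    (simp_all only: cert_rules)

lemma cert114: "good_groups [(False,False,0,[17357327,17363495,17461775]),(False,True,0,[17419427,17435807,17436515]),
    (False,False,1,[17353895]),(False,True,1,[17429027])]"
  by (rule certificate[of 2 "[2,1,4,6,3,5]" "[2,4,1,3,6,5]" "[1,1187,1,1,1,19]" "[99,1187,1,291,291,7]" 6 2 317
    65759]) (simp_all only: cert_rules)

lemma cert115: "good_groups [(False,False,0,[4227679]),(True,False,0,[4236739]),(False,False,1,[4229491])]"
  by (rule certificate[of 2 "[1,3,5,2,6,4]" "[2,4,1,5,3,6]" "[291,1,24,1,28,1]" "[1,18,1,6,1,4]" 5 2 406 1064])
    (simp_all only: cert_rules)

lemma cert116: "good_groups [(False,False,0,[4335823]),(True,False,0,[4360435])]"
  by (rule certificate[of 2 "[1,4,6,3,2,5]" "[2,6,1,3,4,5]" "[1,4,1,4,1,1]" "[1,4,1,1,6,4]" 3 2 266 383576])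
    (simp_all only: cert_rules)

lemma cert117: "good_groups [(False,False,0,[271154,4758943,4770423,4775331,4781686,4839922,4880163,17364515]),(False,
    True,0,[4770207,4781667,4824867,4879987,17354147])]"
  by (rule certificate[of 2 "[1,3,4,2,5,6]" "[2,1,5,6,4,3]" "[6,1,4751,1,6287,25151]" "[99,1,19,1,1,24]" 1 2 4
    90160]) (simp_all only: cert_rules)

lemma cert118: "good_groups [(False,False,0,[4352223]),(True,False,0,[4364535])]"
  by (rule certificate[of 2 "[1,4,5,2,3,6]" "[2,3,1,5,6,4]" "[18,1,6,4,7,7]" "[1,4,1,1,4,1]" 6 2 5 75570]) (simp_all
    only: cert_rules)

lemma cert119: "good_groups [(False,False,0,[17342687,17351327,17356447,17408207,17416847,17421967,17441015,17447975,
    17448295,17457395,17464355,17464675])]"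
  by (rule certificate[of 2 "[2,1,5,6,4,3]" "[3,5,4,1,6,2]" "[1,99,1,99,99,1]" "[1,24,1,1,4,7]" 5 2 290 119681842])
    (simp_all only: cert_rules)

lemma cert120: "good_groups [(False,False,0,[4232799]),(True,False,0,[4236759]),(False,False,-1,[4233591])]"
  by (rule certificate[of 2 "[1,4,2,6,3,5]" "[2,3,1,6,4,5]" "[4,1,4,1,4,4]" "[1,1,6,6,1,1]" 1 2 106 115208])
    (simp_all only: cert_rules)

lemma cert121: "good_groups [(False,False,0,[16922255,16944527,16944995,19278335,19283930,19304438,19397798,19499519,
    19529510,19569887,19570487])]"
  by (rule certificate[of 2 "[2,1,5,6,4,3]" "[1,3,4,2,5,6]" "[1,4,1,6,7,1]" "[1,1,1,1,1,1]" 3 2 96 1108091074])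
    (simp_all only: cert_rules)

lemma cert122: "good_groups [(False,False,0,[4860415,4866010,4876799,4882378,4892623,4892639])]"
  by (rule certificate[of 2 "[1,2,5,6,3,4]" "[2,4,1,6,3,5]" "[4,99,24,7,19,6]" "[1,1,1,1,1,1]" 5 2 458 18632])
    (simp_all only: cert_rules)

lemma cert123: "good_groups [(False,False,0,[4335167,4335602,4341602,19031923,19085158,19298098]),(False,True,0,
    [4367219]),(False,False,1,[4761395,4771034,4823519,4879154]),(False,True,1,[4753907,4754678,4759346,4771682,
    4846370,4876151])]"
  by (rule certificate[of 2 "[1,3,4,2,5,6]" "[2,1,5,6,4,3]" "[24,1,1,1,18,31]" "[4,1,1,6,7,1]" 1 2 74 1440])
    (simp_all only: cert_rules)

lemma cert124: "good_groups [(False,False,0,[16922271]),(True,False,0,[16949091])]"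
  by (rule certificate[of 2 "[2,4,1,6,3,5]" "[1,3,2,5,4,6]" "[1,4,1,1679,1,1]" "[4,72,124,1,1,6]" 6 2 6 272778])
    (simp_all only: cert_rules)

lemma cert125: "good_groups [(False,False,0,[4335231]),(True,False,0,[4368243])]"
  by (rule certificate[of 2 "[1,4,5,2,3,6]" "[2,3,1,5,6,4]" "[4643,1,19,291,24,28]" "[1,72,1,7,1,1]" 6 2 127 20237])
    (simp_all only: cert_rules)

lemma cert126: "good_groups [(False,False,0,[16948383])]"
  by (rule certificate[of 2 "[2,4,1,6,3,5]" "[2,5,1,3,6,4]" "[1,1,1,18,19,1]" "[4,1,419,399,18,7]" 6 2 295 5471])
    (simp_all only: cert_rules)

lemma cert127: "good_groups [(False,False,0,[273023,4235226,4237302,16924506,16932810,16940810,16942070,16945110,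
    16947186])]"
  by (rule certificate[of 2 "[2,3,1,5,6,4]" "[2,4,1,6,3,5]" "[18,7,4,6,7,1]" "[1,1,1,4,1,4]" 1 2 119 100488])
    (simp_all only: cert_rules)

lemma cert128: "good_groups [(False,False,0,[272182,4759335,4774134,4835487,4840615,4846194,4878967,17429031,
    17466231]),(False,True,0,[4824223,4835955,4846183,4879143,17406015,17419431])]"
  by (rule certificate[of 2 "[1,3,4,2,5,6]" "[2,1,5,6,4,3]" "[72,4751,1,1,6287,1167]" "[28,1,1,99,419,1]" 1 2 1535
    22524]) (simp_all only: cert_rules)

lemma cert129: "good_groups [(False,False,0,[16912214,16947031]),(True,False,0,[16930399]),(True,True,0,[16930754]),
    (False,False,1,[16934359]),(True,False,1,[16931191])]"
  by (rule certificate[of 2 "[1,4,2,6,3,5]" "[2,4,1,5,3,6]" "[99,24,1,1827,1,1]" "[74,1,1,4,28,24]" 2 2 288 1827])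
    (simp_all only: cert_rules)

lemma cert130: "good_groups [(False,False,0,[17357042,17363570]),(False,True,0,[17418742,17430070]),(False,False,1,
    [19018535,19019315,19083890,19096370,19341875,19363431])]"
  by (rule certificate[of 2 "[2,1,4,6,3,5]" "[2,4,1,3,6,5]" "[4,1,1,1,1,1]" "[4,1,1,6,7,1]" 3 2 18 30974519])
    (simp_all only: cert_rules)

text \<open>The one-point case with p = 5; it kills for instance a^5 t a^5 t^-1.\<close>

lemma cert131: "good_groups [(False,False,0,[4203303,4204323,4230183,4234275,16785411,16786775])]"
  by (rule certificate[of 5 "[1]" "[1]" "[4]" "[6]" 1 2 6 1833]) (simp_all only: cert_rules)

lemma cert132: "good_groups [(False,False,0,[4202738]),(True,True,0,[4203458]),(False,False,1,[4227890]),(True,True,1,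
    [4230338]),(False,False,2,[4328498]),(False,True,2,[4327619,4337858])]"
  by (rule certificate[of 2 "[2,4,1,7,6,3,5]" "[1,4,6,5,2,7,3]" "[1,72,1,1,19,1,4]" "[291,1,6,1827,1,24,7]" 6 2 18
    459530]) (simp_all only: cert_rules)

lemma cert133: "good_groups [(False,False,0,[4335606]),(True,True,0,[4357986]),(False,False,1,[4823287,4879158]),
    (False,True,1,[4758774,4837218,4875127]),(True,False,1,[4759350,4825975,4846434]),(True,True,1,[4823263,
    4836570])]"
  by (rule certificate[of 2 "[2,4,1,5,7,3,6]" "[1,5,7,3,4,2,6]" "[18,1,1,1827,1,1,99]" "[4,19,1,1,18,6,1]" 2 2 294
    6562]) (simp_all only: cert_rules)

lemma cert134: "good_groups [(False,False,0,[4357338]),(True,True,0,[4365558])]"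
  by (rule certificate[of 2 "[2,4,1,6,3,7,5]" "[1,5,4,6,7,2,3]" "[1,1,1,72,1,28,99]" "[4,7,4,1,1,1,1]" 6 2 509 1072])
    (simp_all only: cert_rules)

lemma cert135: "good_groups [(False,False,0,[67727]),(True,False,0,[68147]),(False,False,-1,[1081911,1084866]),(True,
    False,-1,[1087683]),(True,True,-1,[1082226]),(False,False,-2,[16922050]),(True,True,-2,[16911730])]"
  by (rule certificate[of 2 "[2,4,1,6,3,7,5]" "[1,5,4,6,7,2,3]" "[1,6,1,19,1,1,4]" "[99,4,1,7,291,1,1]" 4 2 448
    1400053]) (simp_all only: cert_rules)

lemma cert136: "good_groups [(False,False,0,[67983]),(True,False,0,[68151]),(False,False,1,[1087027]),(False,True,1,
    [1087350]),(True,False,1,[1083607,1088982]),(False,True,2,[16932214]),(True,False,2,[16938454])]"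
  by (rule certificate[of 2 "[2,4,1,7,6,3,5]" "[1,4,6,5,2,7,3]" "[1,1,1,1,4,1,1]" "[1,1,1,1,6,1,1]" 2 2 74
    478716125]) (simp_all only: cert_rules)

lemma cert137: "good_groups [(False,False,0,[4237695])]"
  by (rule certificate[of 2 "[1,3,5,2,6,4,7]" "[2,5,1,4,7,3,6]" "[1,72,1,1827,1,1,1]" "[1,4,1,4,1,28,6]" 6 2 90
    100981]) (simp_all only: cert_rules)

lemma cert138: "good_groups [(False,False,0,[4334582]),(True,True,0,[4357922]),(False,False,1,[4823543,4862774]),
    (False,True,1,[4753871,4758770,4837154]),(True,False,1,[4755254,4780898,4826999]),(True,True,1,[4836554,
    4859699])]"
  by (rule certificate[of 2 "[1,4,6,5,2,7,3]" "[2,5,1,7,6,4,3]" "[291,1,1,291,1,72,1827]" "[1,72,1,4,72,7,1]" 6 2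
    1443 410]) (simp_all only: cert_rules)

lemma cert139: "good_groups [(False,False,0,[4352503])]"
  by (rule certificate[of 2 "[2,4,1,5,7,3,6]" "[1,5,7,3,4,2,6]" "[1,1571,1,1,28,99,1]" "[1679,1,1,28,4,1,4]" 4 2 2007
    105971]) (simp_all only: cert_rules)

lemma cert140: "good_groups [(False,False,0,[16818751]),(True,False,0,[16820431])]"
  by (rule certificate[of 2 "[1,4,7,3,2,5,6]" "[2,6,1,4,3,7,5]" "[1,4,1,1,1,4,1]" "[4,6,1,4,1,4,1]" 5 2 294 1517064])
    (simp_all only: cert_rules)

lemma cert141: "good_groups [(False,False,0,[1192591,1216291]),(False,True,0,[1195171,1215631]),(False,False,1,
    [19080755,19280675]),(False,True,1,[19018295,19080050,19100195,19359606]),(True,False,1,[19019555,19079735,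
    19100210,19363446]),(True,True,1,[19083875,19280435])]"
  by (rule certificate[of 2 "[2,4,1,6,3,7,5]" "[1,5,4,6,7,2,3]" "[1,1,1,6,1,19,1]" "[4,1,1,6,1,1,6]" 6 2 96 5603493])
    (simp_all only: cert_rules)

lemma cert142: "good_groups [(False,False,0,[4335863,17343427,17393911]),(False,True,0,[4338650,4355018,4364495,
    17314762,17354506,17396698,17420122,17434831,17458015]),(True,False,0,[4352243,4362038,4366130,17311987,17408983,
    17436466,17448130,17456950,17464534]),(True,True,0,[4360415,17441551,17455327])]"
  by (rule certificate[of 2 "[1,4,2,3,7,5,6]" "[2,5,1,3,6,4,7]" "[1,1,1,1,18,28,1]" "[1,1,1,4,6,1,4]" 6 2 410
    304678]) (simp_all only: cert_rules)

lemma cert143: "good_groups [(False,False,0,[4368895])]"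
  by (rule certificate[of 2 "[2,4,1,5,7,3,6]" "[1,3,4,6,2,7,5]" "[6,1,1,7,6,1,7]" "[4,1,1,1,1,1,1]" 1 2 72 1532786])
    (simp_all only: cert_rules)

lemma cert144: "good_groups [(False,False,0,[19015935,19042290,19463970]),(False,True,0,[19565775]),(True,False,0,
    [19566387]),(True,True,0,[19021770,19135650,19433727])]"
  by (rule certificate[of 2 "[1,4,5,2,6,3,7]" "[2,5,1,3,6,7,4]" "[1679,1,1,1,303679,1,1679]" "[1,1571,1,6,31,107071,
    1]" 3 2 418 304257245]) (simp_all only: cert_rules)

lemma cert145: "good_groups [(False,False,0,[19309519]),(False,True,0,[19390314,19440511,19455946]),(True,False,0,
    [19440631,19463626,19561974]),(True,True,0,[19555279])]"
  by (rule certificate[of 2 "[1,4,6,7,2,3,5]" "[2,5,1,7,3,4,6]" "[6287,1,1,297103,25151,1,1]" "[1,1,1,4751,1679,6,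
    99]" 4 2 1522 130853362]) (simp_all only: cert_rules)

lemma cert146: "good_groups [(False,False,0,[4335859])]"
  by (rule certificate[of 2 "[2,4,1,7,6,3,5]" "[1,5,7,2,4,3,6]" "[1,6,1,4,19,1,1]" "[4,1,1,399,1,1679,7]" 4 2 124
    88316]) (simp_all only: cert_rules)

lemma cert147: "good_groups [(False,False,0,[19122847,19561615]),(False,True,0,[19463587,19561887]),(True,False,0,
    [19450495,19528867]),(True,True,0,[19126927,19520127])]"
  by (rule certificate[of 2 "[1,3,5,2,7,4,6]" "[2,5,1,4,6,3,7]" "[99,4,1,1,1,18,7]" "[6,1,1,4,4,1,4]" 4 2 268 5474])
    (simp_all only: cert_rules)

lemma cert148: "good_groups [(False,False,0,[17343287]),(True,False,0,[17402099]),(False,False,1,[17457935]),(False,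
    True,1,[17436530]),(True,False,1,[17358602,17434847])]"
  by (rule certificate[of 2 "[1,4,7,3,2,5,6]" "[2,6,1,5,3,7,4]" "[4,6,74,1,1,1,508]" "[1,19,1,24,1,74,1]" 2 2 266
    415]) (simp_all only: cert_rules)

lemma cert149: "good_groups [(False,False,0,[19047375,19545330]),(False,True,0,[19440447,19451850]),(True,False,0,
    [19440627,19463370]),(True,True,0,[19124010,19538895])]"
  by (rule certificate[of 2 "[1,2,5,7,6,3,4]" "[2,4,1,7,6,3,5]" "[4,99,1,1,297535,1,1]" "[1,1,1,18,72,24,32547]" 3 2
    1443 1802]) (simp_all only: cert_rules)

lemma cert150: "good_groups [(False,False,0,[4227215,4230914]),(True,False,0,[4236035]),(True,True,0,[4227314]),
    (False,False,1,[4227635]),(True,False,1,[4229315])]"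
  by (rule certificate[of 2 "[2,4,1,6,7,5,3]" "[1,5,4,7,3,2,6]" "[1,1,1,1699,4,1,4671]" "[6,6799,25151,1571,1,31,1]"
    1 2 6 1957834]) (simp_all only: cert_rules)

lemma cert151: "good_groups [(False,False,0,[19038154,19397794,19433983]),(False,True,0,[19294719]),(True,False,0,
    [19569871]),(True,True,0,[19042294,19464034,19570551])]"
  by (rule certificate[of 2 "[1,3,6,2,7,4,5]" "[2,5,1,3,6,7,4]" "[99,4,1,1,99,1,99]" "[1,1,1,6,1,99,1]" 3 2 66
    1835562]) (simp_all only: cert_rules)

lemma cert152: "good_groups [(False,False,0,[17342247]),(True,False,0,[17418867]),(False,False,1,[17462055]),(True,
    False,1,[17418399])]"
  by (rule certificate[of 2 "[2,1,4,3]" "[2,4,1,3]" "[75919,1679,1,19007]" "[1,1,28,6719]" 3 3 26592063 425164607])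
    (simp_all only: cert_rules)

lemma cert153: "good_groups [(False,False,0,[4351615]),(True,False,0,[4368247])]"
  by (rule certificate[of 2 "[1,3,4,2]" "[2,4,1,3]" "[291,1,24,399]" "[72,1,1,6]" 3 3 90 7590]) (simp_all only:
    cert_rules)

lemma cert154: "good_groups [(False,False,0,[1088063]),(True,False,0,[1091831]),(False,False,-1,[17441655]),(False,
    True,-1,[17442675]),(True,False,-1,[17406159]),(True,True,-1,[17340879]),(False,False,-2,[17315802]),(False,True,
    -2,[17409987]),(True,True,-2,[17312247,17464770])]"
  by (rule certificate[of 2 "[2,1,4,3]" "[1,3,2,4]" "[18979,1,1,124]" "[74383,99,1,7]" 4 3 7 277923]) (simp_all only:
    cert_rules)

lemma cert155: "good_groups [(False,False,0,[17353119]),(True,False,0,[17463075]),(False,False,-1,[17353335]),(True,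
    False,-1,[17407779])]"
  by (rule certificate[of 2 "[2,1,4,3]" "[1,3,2,4]" "[1,1571,7,1]" "[419,6,1,4]" 3 3 21 1058402]) (simp_all only:
    cert_rules)

lemma cert156: "good_groups [(False,False,0,[17343447,17464790]),(True,False,0,[17393907]),(True,True,0,[17397722]),
    (False,False,1,[17457975]),(True,False,1,[17402079])]"
  by (rule certificate[of 2 "[2,1,5,6,3,4,8,7]" "[2,4,1,6,3,8,5,7]" "[99,24,1679,1,419,1827,1827,1]" "[1,1,1,18,1,1,
    19007,99]" 1 2 16 5724]) (simp_all only: cert_rules)

lemma cert157: "good_groups [(False,False,0,[16786934]),(True,True,0,[16787414]),(False,False,1,[16815926]),(True,
    True,1,[16817366]),(False,False,2,[16931894]),(True,True,2,[16937174])]"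
  by (rule certificate[of 2 "[2,4,1,6,8,3,5,7]" "[1,5,7,3,6,2,8,4]" "[1,1,1,1,1,1,1,1]" "[4,1,1,6,1,6,6,1]" 2 2 66
    29493656]) (simp_all only: cert_rules)

lemma cert158: "good_groups [(False,False,0,[4341514,4358719]),(True,False,0,[4367119]),(True,True,0,[4359154])]"
  by (rule certificate[of 2 "[1,3,6,2,7,8,4,5]" "[2,5,1,3,6,4,8,7]" "[1,1,1,1,6,1,1,7]" "[1,1,1,4,24,4,1,6]" 4 2 288
    6064806]) (simp_all only: cert_rules)

lemma cert159: "good_groups [(False,False,0,[4341594,4368223]),(True,False,0,[4363903]),(True,True,0,[4364274])]"
  by (rule certificate[of 2 "[1,4,6,3,2,7,8,5]" "[2,6,1,3,7,5,4,8]" "[1,1,18,1,1,7,4,1]" "[1,1,1,4,1,7,1,4]" 2 2 95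
    100917005]) (simp_all only: cert_rules)

lemma cert160: "good_groups [(False,False,0,[17311295,17403842]),(True,False,0,[17317670,17468867])]"
  by (rule certificate[of 2 "[2,4,1,5,8,7,3,6]" "[4,5,6,7,1,2,8,3]" "[6,4,1,1,1,28,1,1]" "[6,1,6,7,1,1,6,1]" 2 2 104
    29289]) (simp_all only: cert_rules)

lemma cert161: "good_groups [(False,False,0,[17353103]),(True,False,0,[17446691]),(False,False,-1,[17353271]),(True,
    False,-1,[17403683])]"
  by (rule certificate[of 2 "[1,3,6,2,8,4,7,5]" "[2,5,1,7,3,8,6,4]" "[4,72,1,28,6,1,1,28]" "[1,18,1,7,1,1,1,1]" 6 2
    125 397248]) (simp_all only: cert_rules)

lemma cert162: "good_groups [(False,False,0,[19384975,19545247]),(False,True,0,[19389087,19454527]),(True,False,0,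
    [19463335,19515967]),(True,True,0,[19529127,19545487])]"
  by (rule certificate[of 2 "[1,2,5,6,3,4,7,8]" "[2,4,1,5,7,3,8,6]" "[4,6,4,1167,99,72,99,7]" "[1,1,1,1,1,1,1,1]" 2 2
    4 1628]) (simp_all only: cert_rules)

lemma cert163: "good_groups [(False,False,0,[16785650]),(True,True,0,[16786370]),(False,False,1,[16810802]),(True,
    True,1,[16813250]),(False,False,2,[16911410]),(True,True,2,[16920770])]"
  by (rule certificate[of 2 "[2,4,1,6,7,3,8,5]" "[1,5,7,2,8,3,4,6]" "[1,6,1,7,6,1,7,1]" "[4,1,6,1,6,6,1,1]" 2 2 18
    30804120]) (simp_all only: cert_rules)

lemma cert164: "good_groups [(False,False,0,[17342307]),(True,False,0,[17357427]),(False,False,1,[17462115]),(True,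
    False,1,[17356959])]"
  by (rule certificate[of 2 "[1,3,6,2,7,4,5,8]" "[2,5,1,8,4,7,3,6]" "[6,28,1,18,31,1,98,399]" "[1,1,1,1571,124,1,419,
    1]" 1 2 4 24744]) (simp_all only: cert_rules)

lemma cert165: "good_groups [(False,False,0,[270943,272759,4348275,4351427,17406335,17471283]),(False,True,0,[271967,
    272755,4327799,4328918,4335063,4349378,17336703,17471351])]"
  by (rule certificate[of 2 "[2,4,1,3,6,7,8,5]" "[1,2,5,6,8,3,4,7]" "[1,1,1,1,1,4,72,19]" "[28,6,1,115,1,26,1,1]" 2 2
    6 76343]) (simp_all only: cert_rules)

lemma cert166: "good_groups [(False,False,0,[1084031]),(True,False,0,[1092083]),(False,False,1,[17458995,17463143]),
    (True,False,1,[17336799,17422751]),(False,False,2,[17407847]),(True,False,2,[17422967])]"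
  by (rule certificate[of 2 "[1,3,6,2,7,4,5,8]" "[2,5,1,8,4,7,3,6]" "[6,19,1,1,1,4643,1,1827]" "[1,1,1,291,419,99,
    1167,1]" 1 2 4 24588]) (simp_all only: cert_rules)

lemma cert167: "good_groups [(False,False,0,[17467903]),(False,True,0,[17475391])]"
  by (rule certificate[of 2 "[1,4,2,7,5,3,8,6]" "[2,5,1,6,4,8,3,7]" "[26767,1699,25151,1,1167,1,28,1]" "[1,419,1,1,1,
    24,31,1]" 4 2 305315 266205]) (simp_all only: cert_rules)

lemma cert168: "good_groups [(False,False,0,[4365471])]"
  by (rule certificate[of 2 "[1,4,5,2,7,3,8,9,6]" "[2,4,1,7,3,6,9,5,8]" "[1,1,4,1,1,1,4,1,1]" "[1,24,1,6,1,4,1,1,4]"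
    4 2 6568 2083490]) (simp_all only: cert_rules)

lemma cert169: "good_groups [(False,False,0,[17357298]),(True,True,0,[17364594]),(False,False,1,[19019379,19097394,
    19363427]),(False,True,1,[19083894,19097207,19358259]),(True,False,1,[19035699,19101287,19358514]),(True,True,1,
    [19018599,19084914,19298147]),(False,True,2,[17363574]),(True,False,2,[17422578])]"
  by (rule certificate[of 2 "[2,5,1,8,9,4,3,6,7]" "[2,6,8,1,3,7,9,5,4]" "[24,1,1,98,1,79,7,1,4]" "[1,1,18,1,19,1,4,7,
    31]" 6 2 460 1485]) (simp_all only: cert_rules)

lemma cert170: "good_groups [(False,False,0,[4361615])]"
  by (rule certificate[of 2 "[2,1,4,5,7,8,3,9,6]" "[3,5,7,1,4,2,6,8,9]" "[1,1,1,99,6,1,19,1,1]" "[99,1,1,1,1167,1,4,6,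
    6]" 6 2 73 5109410]) (simp_all only: cert_rules)

lemma cert171: "good_groups [(False,False,0,[4341155])]"
  by (rule certificate[of 2 "[2,3,1,7,6,9,8,4,5]" "[1,4,6,5,2,7,3,8,9]" "[1,99,1,4,1,1,1,72,7]" "[4,1167,1,1,1827,
    7971,1,28,7]" 6 2 77 106482]) (simp_all only: cert_rules)

lemma cert172: "good_groups [(False,False,0,[264607,4196915,4227231,4227318,4235010,4351551]),(False,True,0,[264823,
    4196495,4237059,4367223]),(False,False,1,[4227699,4232819]),(False,True,1,[4229571,4229591])]"
  by (rule certificate[of 2 "[1,4,6,8,2,9,3,5,7]" "[2,3,1,5,6,4,9,7,8]" "[291,1,1,6,1,1,1,7,1]" "[1,1,1,99,291,4,4,4,
    1]" 3 2 7216 386436488]) (simp_all only: cert_rules)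

lemma cert173: "good_groups [(False,False,0,[4204895])]"
  by (rule certificate[of 2 "[1,3,6,2,5,8,4,9,7]" "[2,5,1,7,3,8,6,4,9]" "[1,1,1,1,1,1,6,1,7]" "[1,1,1,1,1,6,1,7,4]" 4
    2 24 369631840]) (simp_all only: cert_rules)

lemma cert174: "good_groups [(False,False,0,[4365727])]"
  by (rule certificate[of 2 "[2,3,1,5,8,9,6,4,7]" "[1,4,6,9,2,8,3,5,7]" "[1,4,1,18,1,1827,1,1,1]" "[4,1,1,4,28,6,1,1,
    1]" 2 2 1693 18883184]) (simp_all only: cert_rules)

lemma cert175: "good_groups [(False,False,0,[4361359])]"
  by (rule certificate[of 2 "[2,1,4,5,7,8,3,9,6]" "[3,5,4,1,7,2,6,9,8]" "[1,1,99,99,24,6,19,7,1]" "[1,1,1167,1,291,1,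
    1,1,26]" 6 2 72 5042850]) (simp_all only: cert_rules)

lemma cert176: "good_groups [(False,False,0,[4336115])]"
  by (rule certificate[of 2 "[2,3,1,5,8,4,6,10,7,9]" "[1,4,6,8,2,9,3,7,5,10]" "[1,1,1,1,4,72,1827,1,4,1]" "[4,1,1827,
    7,1,1,1,1,1,4]" 4 2 351 366396]) (simp_all only: cert_rules)

lemma cert177: "good_groups [(False,False,0,[17467647]),(True,False,0,[17474367])]"
  by (rule certificate[of 2 "[2,4,1,5,3]" "[1,4,5,3,2]" "[1,419,7,1167,4643]" "[1679,1,7,1,1]" 3 3 501 4329269])
    (simp_all only: cert_rules)

lemma cert178: "good_groups [(False,False,0,[17357987]),(True,False,0,[17363555])]"
  by (rule certificate[of 2 "[2,4,1,5,3]" "[1,2,5,3,4]" "[1,1,1,74,124]" "[24,98,298,4,1]" 5 3 18 78503]) (simp_all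
    only: cert_rules)

lemma cert179: "good_groups [(False,False,0,[17310335,17342402]),(True,False,0,[17472707]),(True,True,0,[17317730]),
    (False,False,1,[17344307]),(True,False,1,[17336819])]"
  by (rule certificate[of 2 "[2,1,6,5,8,3,9,4,10,7]" "[3,5,7,1,9,2,8,10,4,6]" "[18,1,1,26,7,28,7,1,1,1]" "[1,1,26,1,7,
    1,7,1,1,1]" 1 2 1674 354445]) (simp_all only: cert_rules)

lemma cert180: "good_groups [(False,False,0,[4340938]),(True,True,0,[4361458])]"
  by (rule certificate[of 2 "[2,4,1,5,3,9,8,6,10,7]" "[1,5,4,7,8,2,3,6,10,9]" "[1,1,1,6,1167,1,1,1,291,1]" "[99,419,
    1679,6,1,1,4751,4,4,18575]" 5 2 1568 4991648]) (simp_all only: cert_rules)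

lemma cert181: "good_groups [(False,False,0,[4203023,4835895,4847158,4863783,16812383]),(False,True,0,[264591,4820367,
    4836775]),(True,False,0,[4204595,4820775,4835727,16819571]),(True,True,0,[264759,4835830,4847143,4863543]),(False,
    True,-1,[4232755]),(True,True,-1,[4229335])]"
  by (rule certificate[of 2 "[2,4,1,7,6,9,3,5,10,8]" "[1,5,7,3,9,2,8,4,6,10]" "[1,1,1,1,1,1,1,1,1,1]" "[24,4,24,7,18,
    1,4,1,7,7]" 1 2 373 115242]) (simp_all only: cert_rules)

lemma cert182: "good_groups [(False,False,0,[4357898,4358783,4359158]),(False,True,0,[4368143])]"
  by (rule certificate[of 2 "[2,5,1,8,6,3,4,10,7,9]" "[3,6,8,1,9,10,2,4,5,7]" "[1,4,1,4,1,4,1,1,24,7]" "[4,1,18,7,291,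
    1,1,1,1,1]" 4 2 359 104649]) (simp_all only: cert_rules)

lemma cert183: "good_groups [(False,False,0,[264335,4367299,4754575,4770034,4780579]),(False,True,0,[4204047,4329418,
    4770355,4862755,16816479]),(True,False,0,[264755,4327999,4362178,4770979,4862515]),(True,True,0,[4204599,4755235,
    4769935,4780594,16819575]),(False,False,-1,[4227639]),(True,False,-1,[4233411])]"
  by (rule certificate[of 2 "[2,4,1,5,3,9,6,7,10,8]" "[2,5,6,1,8,3,4,9,10,7]" "[6,31,18,18,7,1,1,1,7,6]" "[1,1,1,1,7,
    4,1,18,4,1]" 1 2 19 360294]) (simp_all only: cert_rules)

lemma cert184: "good_groups [(False,False,0,[17353206]),(True,True,0,[17430066]),(False,False,1,[19081014,19281527,
    19346979]),(False,True,1,[19096179,19345974,19359287]),(True,False,1,[19084839,19297847,19342134]),(True,True,1,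
    [19034979,19281767,19346994]),(False,False,2,[17418486]),(False,True,2,[17429046])]"
  by (rule certificate[of 2 "[1,3,6,2,5,8,4,9,10,7]" "[2,5,1,8,10,6,3,9,4,7]" "[6,127,1,1,7,1704,6819,1,79,26879]"
    "[1,1,1,1,1,108799,1,4,6,1714431]" 4 2 98 472471]) (simp_all only: cert_rules)

lemma cert185: "good_groups [(False,False,0,[17392191]),(False,True,0,[17399654]),(True,False,0,[17407958,17468631])]"
  by (rule certificate[of 2 "[2,6,1,9,4,8,5,3,10,7]" "[4,5,7,6,1,10,2,9,3,8]" "[6,19,1,1,4,1,1,1,1,1]" "[1,1,99,1,1,6,
    1,4,291,7]" 2 2 104 315232]) (simp_all only: cert_rules)

lemma cert186: "good_groups [(False,False,0,[17340479,17466167,17471287]),(True,False,0,[17401919,17402239,17466227]),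
    (False,False,2,[17343951,17458679]),(True,False,2,[17409503,17442291])]"
  by (rule certificate[of 2 "[1,2,5,7,9,3,10,4,6,8]" "[2,4,1,5,7,8,3,6,10,9]" "[1,1,1,1,1,1,1,6,1,7]" "[1,1,1,1,6,1,1,
    6,4,1]" 6 2 26 32909980]) (simp_all only: cert_rules)

lemma cert187: "good_groups [(False,False,0,[17471743]),(True,False,0,[17474431])]"
  by (rule certificate[of 2 "[2,5,1,9,8,10,6,3,7,4]" "[4,6,7,1,9,3,2,10,8,5]" "[1,99,1,1,1,104,399,1,19,1]" "[291,1,1,
    1,392,26,7,4,79,7]" 1 2 316 1482230]) (simp_all only: cert_rules)

lemma cert188: "good_groups [(False,False,0,[17394143,17399258]),(False,True,0,[17393871,17398986]),(True,False,0,
    [17445846,17459159]),(True,True,0,[17441751,17463254]),(False,True,1,[17402103]),(True,True,1,[17408823])]"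
  by (rule certificate[of 2 "[2,5,1,6,7,8,3,10,4,9]" "[2,6,8,1,10,4,5,3,7,9]" "[99,1571,1,1,4,6,1,399,1,399]" "[1,
    1679,1,1,1,1679,1,1,6,7]" 2 2 1024 1445986912]) (simp_all only: cert_rules)

lemma cert189: "good_groups [(False,False,0,[17353202]),(False,True,0,[17364530]),(False,False,1,[19018355,19081010,
    19345955]),(False,True,1,[19083830,19096115,19359351]),(True,False,1,[19034675,19083815,19342130]),(True,True,1,
    [19018595,19084850,19298151]),(False,True,2,[17363510]),(True,False,2,[17418482])]"
  by (rule certificate[of 2 "[1,3,6,2,7,9,4,5,8,10]" "[2,5,1,4,3,10,6,8,7,9]" "[24,19,1,1,1,1,7,1,98,19]" "[1,1,1,99,
    1,1,1,4,24,19]" 2 2 343 1098498]) (simp_all only: cert_rules)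

lemma cert190: "good_groups [(False,False,0,[16818815]),(True,False,0,[16820687])]"
  by (rule certificate[of 2 "[1,4,5,3,2,8,10,9,7,6]" "[2,6,1,8,10,9,3,7,4,5]" "[99,72,1,1,1827,72,7,24,1,1827]" "[1,1,
    1,1,1,72,1,1,1,6]" 5 2 26 1296809]) (simp_all only: cert_rules)

lemma cert191: "good_groups [(False,False,0,[1090175]),(True,False,0,[1092047]),(False,False,1,[17409843]),(True,
    False,1,[17336823])]"
  by (rule certificate[of 2 "[1,4,2,8,10,3,9,6,5,7]" "[2,5,1,6,10,9,3,8,4,7]" "[4,106,79,7,1,1,18,1,115,24]" "[1,1,1,
    1,6,1,1,6,1,104]" 6 2 86 6313]) (simp_all only: cert_rules)

lemma cert192: "good_groups [(False,False,0,[17338326,17472983]),(True,False,0,[17393279]),(True,True,0,[17399586]),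
    (False,False,1,[17406455]),(True,False,1,[17409911])]"
  by (rule certificate[of 2 "[2,1,4,6,8,5,3,10,7,9]" "[3,5,7,1,8,2,4,6,10,9]" "[1,1,1,1,6,7,4,1,1,1]" "[1,1,1,4,6,1,1,
    1,1,1]" 2 2 102 1932696152]) (simp_all only: cert_rules)

lemma cert193: "good_groups [(False,False,0,[17311967,17317082,17442755,17446850]),(True,False,0,[17312207,17317322,
    17458115,17462210]),(False,False,1,[17340659]),(True,False,1,[17343347])]"
  by (rule certificate[of 2 "[1,2,5,7,9,3,10,4,6,8]" "[2,4,1,3,10,8,5,6,7,9]" "[4,99,4,1,99,1,1,1,291,1]" "[1,1,1,1,1,
    6,4,7,4,1]" 4 2 408 369740168]) (simp_all only: cert_rules)

lemma cert194: "good_groups [(False,False,0,[270479,271298,4235839]),(True,False,0,[272579,4237519]),(True,True,0,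
    [270578]),(False,False,1,[270899]),(False,False,-1,[4230594]),(True,True,-1,[4227954])]"
  by (rule certificate[of 2 "[2,5,1,3,4,9,8,10,7,6]" "[2,6,4,1,8,10,3,5,7,9]" "[1,24,99,7,1,6,6,7,7,1]" "[24,1,1,1,4,
    24,1,1,31,1]" 4 2 29 1206236]) (simp_all only: cert_rules)

lemma cert195: "good_groups [(False,False,0,[16819839]),(True,False,0,[16820703])]"
  by (rule certificate[of 2 "[1,4,6,8,2,5,3,10,9,7]" "[2,5,1,3,4,8,10,7,6,9]" "[4,6,4,1,1,7,1,1,1,1]" "[1,1,1,1,6,1,4,
    1,1,1]" 3 2 418 31230613]) (simp_all only: cert_rules)

lemma cert196: "good_groups [(False,False,0,[4203935,4204391,4350591,4350966,4357926]),(False,True,0,[4205015,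
    4368183]),(False,False,-1,[4204151])]"
  by (rule certificate[of 2 "[2,5,1,8,7,4,3,10,6,9]" "[3,6,8,1,9,10,2,4,5,7]" "[1,1,4,4,4,1,1,1,4,1]" "[1,6,1,1,18,1,
    1,1,19,7]" 6 2 290 1455960]) (simp_all only: cert_rules)

lemma cert197: "good_groups [(False,False,0,[16921247]),(True,False,0,[16949027])]"
  by (rule certificate[of 2 "[1,4,7,8,2,3,9,5,6,10]" "[2,6,1,5,8,7,3,10,4,9]" "[1,1,419,1,1,1,399,1,1,1]" "[1,19,1,24,
    1827,99,1,1,6,1]" 4 2 298 130928]) (simp_all only: cert_rules)

lemma cert198: "good_groups [(False,False,0,[271759,4230998,4237143]),(False,True,0,[271862]),(True,False,0,[272342,
    272599,4232607]),(True,True,0,[4232690]),(False,False,1,[4233687]),(False,True,1,[4233078]),(True,False,1,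
    [4232823,4234710]),(False,False,-1,[271927])]"
  by (rule certificate[of 2 "[2,4,1,6,7,3,10,5,8,9]" "[1,4,5,3,2,9,6,7,8,10]" "[4,6,1,1,6,28,7,1,1,1]" "[18,1,1,1,1,
    28,1,1,18,7]" 2 2 19 379432]) (simp_all only: cert_rules)

lemma cert199: "good_groups [(False,False,0,[4352247])]"
  by (rule certificate[of 2 "[2,3,1,6,4,7,8,10,5,9]" "[1,4,6,8,2,9,3,7,5,10]" "[1,1,1,1,4,1,1,4,1,1]" "[1,1,1,6,4,1,1,
    1,1,1]" 6 2 357 1126208899]) (simp_all only: cert_rules)

lemma cert200: "good_groups [(False,False,0,[4352383]),(False,True,0,[4360575]),(True,False,0,[4367863]),(True,True,0,
    [4367823])]"
  by (rule certificate[of 2 "[2,4,1,8,3,7,9,11,10,5,6]" "[1,5,4,9,11,2,3,6,10,7,8]" "[24,1,1,1,7,1,24,99,1,1,399]"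
    "[1679,1,1,6,99,24,1,19,4,7,1]" 5 2 461 302134941]) (simp_all only: cert_rules)

lemma cert201: "good_groups [(False,False,0,[4357978,4367199]),(True,False,0,[4363839]),(True,True,0,[4364278])]"
  by (rule certificate[of 2 "[2,4,1,8,3,7,9,11,10,5,6]" "[1,5,4,9,11,2,3,6,10,7,8]" "[1,1,24,1,1,1,7,1,99,99,4]" "[4,
    1167,1,1,1571,1,399,1,1,6,99]" 1 2 1074 92310540]) (simp_all only: cert_rules)

lemma cert202: "good_groups [(False,False,0,[4364511])]"
  by (rule certificate[of 2 "[2,4,1,8,3,7,9,11,10,5,6]" "[1,5,4,9,11,2,3,6,10,7,8]" "[4,1,1,1,1,4,1,1,1,1,1]" "[1,1,1,
    1,1,6,1,1,1,1,1]" 2 2 266 1892289072]) (simp_all only: cert_rules)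

lemma cert203: "good_groups [(False,False,0,[4364767])]"
  by (rule certificate[of 2 "[2,4,1,8,10,3,5,9,7,11,6]" "[1,4,6,9,2,10,3,5,11,8,7]" "[6,4,1,18,7,99,6,7,1,1,19]" "[1,
    1,1,1,1,6,1,1,1,6,1]" 2 2 266 30255715]) (simp_all only: cert_rules)

lemma cert204: "good_groups [(False,False,0,[4339674]),(True,True,0,[4366194]),(False,False,1,[4780902,4826995]),
    (False,True,1,[4775782,4840650,4859763]),(True,False,1,[4758007,4824946,4862838]),(True,True,1,[4757967,
    4824306])]"
  by (rule certificate[of 3 "[1,2,4,5,3]" "[2,3,1,5,4]" "[1,6,1891,1,1]" "[1,31,1,4,4]" 3 2 114 16989]) (simp_all
    only: cert_rules)

lemma cert205: "good_groups [(False,False,0,[4754831,4774130,4840871]),(False,True,0,[4835891,4862759]),(True,False,0,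
    [4847207,4863539]),(True,True,0,[4755239,4780658,4835471])]"
  by (rule certificate[of 2 "[2,3,1,6,4,5]" "[4,5,6,1,2,3]" "[1,1,6287,1,6287,4751]" "[1,18575,297103,7,1,4]" 4 3 31
    1743359]) (simp_all only: cert_rules)

lemma cert206: "good_groups [(False,False,0,[4770191,4820771]),(False,True,0,[4775075,4839926,4862519]),(True,False,0,
    [4770359,4847222,4863779]),(True,True,0,[4780643,4820111])]"
  by (rule certificate[of 2 "[2,3,1,6,4,5]" "[4,6,5,2,1,3]" "[1,6287,1,1679,18575,1]" "[1,1,4643,7,1,4]" 4 3 115
    27227123]) (simp_all only: cert_rules)

lemma cert207: "good_groups [(False,False,0,[264351,4196919,4336095]),(False,True,0,[264819,4196751,4364787]),(False,
    False,-1,[4227703]),(False,True,-1,[4233667])]"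
  by (rule certificate[of 2 "[2,1,7,9,8,10,5,3,6,4,12,11]" "[3,5,4,1,6,2,10,9,11,12,7,8]" "[18,7,1,7,24,1,1,19,6,1,1,
    4]" "[1,115,6,1,6,1,1,1,1,4,1,1]" 1 2 106 2084044]) (simp_all only: cert_rules)

lemma cert208: "good_groups [(False,False,0,[4335999]),(False,True,0,[4364671]),(True,False,0,[4367859]),(True,True,0,
    [4367839])]"
  by (rule certificate[of 2 "[2,4,1,8,9,3,5,12,7,6,10,11]" "[3,1,7,9,2,8,12,11,6,4,5,10]" "[1187,1167,1,1,4,1571,1,4,
    1,19,1,4]" "[399,1,1,7,4643,1,72,1,1,72,28,1]" 4 2 319 1578]) (simp_all only: cert_rules)

lemma cert209: "good_groups [(False,False,0,[297535,304114]),(False,True,0,[305359]),(True,False,0,[305395]),(True,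
    True,0,[298954,303679]),(False,False,1,[4875059]),(False,True,1,[4753655,4755314,4781858,4880246]),(True,False,1,
    [4753631,4754930,4775714,4840922]),(True,True,1,[4825907])]"
  by (rule certificate[of 2 "[1,4,7,5,2,11,8,3,6,10,9,12]" "[2,6,1,9,11,3,10,12,8,4,7,5]" "[419,1,1,1,1,28,1,1,1,291,
    419,19]" "[1,24,7,1,1,1,1,4,291,99,1,1]" 3 2 1578 28895]) (simp_all only: cert_rules)

lemma cert210: "good_groups [(False,False,0,[4338335,4354703,17353231,17418847]),(False,True,0,[17435791,17461855]),
    (True,False,0,[4362023,4366115,17436451,17456935]),(True,True,0,[17445391,17456287])]"
  by (rule certificate[of 2 "[2,3,1,6,10,8,5,4,12,7,9,11]" "[2,5,6,1,11,8,3,12,4,7,9,10]" "[1,1,1,26,19,7,1,7,1,24,1,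
    1]" "[19,4,4,1,6,1,1,1,19,1,6,1]" 6 2 25 383399]) (simp_all only: cert_rules)

lemma cert211: "good_groups [(False,False,0,[4339658]),(True,True,0,[4362098]),(False,False,1,[4780838,4819187]),
    (False,True,1,[4775114,4841318,4858739]),(True,False,1,[4760375,4824950,4862834]),(True,True,1,[4757711,
    4820210])]"
  by (rule certificate[of 2 "[1,4,7,5,2,8,3,10,6,12,9,11]" "[2,6,1,4,5,10,3,11,7,12,9,8]" "[1,4,1,1,1,1,1,1,1,1,1,4]"
    "[1,1,1,1,4,4,1,4,6,1,1,1]" 1 2 6754 7905032636931]) (simp_all only: cert_rules)

lemma cert212: "good_groups [(False,False,0,[16812047]),(True,False,0,[16818227])]"
  by (rule certificate[of 2 "[2,5,1,8,3,4,12,11,10,7,9,6]" "[2,6,7,1,10,3,12,11,4,8,5,9]" "[24,1,7,1,1,1167,291,6,19,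
    6,1,4]" "[392,28,1,1,79,1,1,99,1,1,6,1]" 2 2 351 4714]) (simp_all only: cert_rules)

lemma cert213: "good_groups [(False,False,0,[1057295]),(True,False,0,[1058867]),(False,False,-1,[16910391]),(True,
    False,-1,[16933059])]"
  by (rule certificate[of 2 "[2,4,1,8,10,3,5,9,13,12,6,11,7]" "[1,5,7,2,11,3,8,10,4,9,13,6,12]" "[99,4,1,99,1,4,1,1,
    24,1,1,4,7]" "[99,1,4,1,1,1,1,1,1,1,4,1,1]" 5 2 1167 439787359]) (simp_all only: cert_rules)

lemma cert214: "good_groups [(False,False,0,[4341210]),(True,True,0,[4365810]),(False,False,1,[4771686,4876147]),
    (False,True,1,[4761459,4781926,4880178]),(True,False,1,[4757983,4771290,4824562]),(True,True,1,[4758003,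
    4824882])]"
  by (rule certificate[of 2 "[2,4,1,8,10,3,5,9,13,12,6,11,7]" "[1,5,7,2,11,3,8,10,4,9,13,6,12]" "[99,1,1,4,1,1,24,1,1,
    1,7,1,4]" "[4,99,1,99,4,99,1,291,1,1,1,1,1]" 5 2 4264 88672]) (simp_all only: cert_rules)

lemma cert215: "good_groups [(False,False,0,[4357578]),(True,True,0,[4361718]),(False,False,1,[4819407,4837158]),
    (False,True,1,[4819447,4847398,4863798]),(True,False,1,[4820470,4836810,4859703]),(True,True,1,[4820790,
    4826935])]"
  by (rule certificate[of 2 "[1,4,5,2,7,3,6]" "[2,4,1,5,3,6,7]" "[4,1,18,1,1,1,19007]" "[1,6,1,2082959,1,6,75919]" 2
    3 24 435775]) (simp_all only: cert_rules)

lemma cert216: "good_groups [(False,False,0,[4204022]),(True,True,0,[4204502]),(False,False,1,[4233014]),(True,True,1,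
    [4234454]),(False,False,2,[4348982]),(False,True,2,[4348119,4354262])]"
  by (rule certificate[of 2 "[2,4,1,6,3,7,5]" "[1,5,4,6,7,2,3]" "[1,1,1,99,1,72,399]" "[28,1679,116879,19087,6,1,1]"
    1 3 1384 6763043]) (simp_all only: cert_rules)

lemma cert217: "good_groups [(False,False,0,[16786015]),(True,False,0,[16787827])]"
  by (rule certificate[of 2 "[2,4,1,8,9,3,5,10,12,6,7,14,11,13]" "[1,5,2,9,7,8,3,12,11,4,6,14,10,13]" "[1,1,1,1,1,4,6,
    1,1827,1,1,1,4,1]" "[4,1,4,1,7,1,99,28,7,1,1,99,1,99]" 5 2 8048 1215740]) (simp_all only: cert_rules)

lemma cert218: "good_groups [(False,False,0,[16816143]),(True,False,0,[16818231])]"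
  by (rule certificate[of 3 "[2,4,1,6,3,7,5]" "[1,5,4,6,7,2,3]" "[1,1,1,103,25,1,23]" "[5,1183,5,99,1,1,6]" 4 2 394
    2047194]) (simp_all only: cert_rules)

lemma cert219: "good_groups [(False,False,0,[4235903]),(True,False,0,[4237775])]"
  by (rule certificate[of 3 "[1,3,5,2,4,7,6]" "[2,5,1,7,6,3,4]" "[1,359,1,103,1,1,355]" "[1,6,1,1,1,4,4]" 5 2 362
    117398]) (simp_all only: cert_rules)

lemma cert220: "good_groups [(False,False,0,[4236863]),(True,False,0,[4237535])]"
  by (rule certificate[of 3 "[2,4,1,6,3,7,5]" "[1,5,4,6,7,2,3]" "[1,1,4,1,1635,1,1167]" "[103,1,1,103,6,7,99]" 6 2 87
    416247]) (simp_all only: cert_rules)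

lemma cert221: "good_groups [(False,False,0,[297599,305138]),(False,True,0,[304767]),(True,False,0,[305651]),(True,
    True,0,[298970,305631]),(False,False,1,[4876083]),(False,True,1,[4755318,4761463,4781922,4880242]),(True,False,1,
    [4753887,4759026,4775386,4841250]),(True,True,1,[4823539])]"
  by (rule certificate[of 2 "[2,1,6,7,9,3,4,14,5,11,10,13,12,8,16,15]" "[3,4,1,8,2,11,12,15,10,5,16,6,7,9,13,14]"
    "[72,1,7,4,1,1,1,1,1,4,1,1,1,28,18,1]" "[74,1,124,1,4,1,1,1,1,1,1,1,1,1,4,1]" 3 2 21 77211148]) (simp_all only:
    cert_rules)

lemma cert222: "good_groups [(False,False,0,[4762111,4890610]),(False,True,0,[4889087]),(True,False,0,[4892659]),
    (True,True,0,[4783978,4892543])]"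
  by (rule certificate[of 2 "[2,5,1,9,3,8,10,13,7,4,6,14,11,15,16,12]" "[4,6,7,1,9,12,2,3,15,5,16,11,14,8,13,10]"
    "[72,1,1,1,1,1,1,1,1,399,24,1,1,1,7,1]" "[79,1,1,26,1,19,1,1,6,1,1,1,1,1,1,1]" 2 2 19047 21964]) (simp_all only:
    cert_rules)

lemma cert223: "good_groups [(False,False,0,[4360399])]"
  by (rule certificate[of 2 "[2,3,1,8,4,7,9,5,6]" "[1,4,6,8,2,9,3,7,5]" "[1,1,1,419,1,6287,7,1,99]" "[99,6287,1,72,1,
    4751,1,7,1]" 5 3 1596 92832264]) (simp_all only: cert_rules)

lemma cert224: "good_groups [(False,False,0,[17354151]),(True,False,0,[17430051]),(False,False,-1,[17364519]),(True,
    False,-1,[17419683])]"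
  by (rule certificate[of 2 "[1,4,5,8,2,9,3,6,7]" "[2,6,1,8,3,7,5,9,4]" "[1,26767,24,1,1599,1,1,99,99]" "[1,1,29247,
    6719,1827,1,1,1,7]" 5 3 7520 419647]) (simp_all only: cert_rules)

lemma cert225: "good_groups [(False,False,0,[4360655])]"
  by (rule certificate[of 2 "[2,3,1,5,8,9,6,4,7]" "[1,4,6,9,2,8,3,5,7]" "[1,1,1,291,25231,18575,291,99,7]" "[99,1,1,1,
    1,4751,1,1,4751]" 4 3 1847 103727865655]) (simp_all only: cert_rules)

lemma cert226: "good_groups [(False,False,0,[4357287])]"
  by (rule certificate[of 2 "[2,3,1,8,9,5,4,7,6]" "[1,4,6,7,2,5,3,9,8]" "[1,291,1,6,26879,6799,1,1,1]" "[18575,1,4,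
    419,1,107151,25231,1,26]" 4 3 64 1333103145]) (simp_all only: cert_rules)

lemma cert227: "good_groups [(False,False,0,[4759399,4847218,4863843]),(False,True,0,[4780647,4824207]),(True,False,0,
    [4774287,4840051]),(True,True,0,[4774390,4840611,4862583]),(False,False,1,[4820835,4879207]),(False,True,1,
    [4775079,4839670,4878903]),(True,False,1,[4774455,4839583,4846198]),(True,True,1,[4820127,4846179])]"
  by (rule certificate[of 2 "[2,4,1,5,3]" "[3,5,2,1,4]" "[98,1,99,6,469247]" "[1,290,27279,1,1]" 5 4 24 1847960])
    (simp_all only: cert_rules)

lemma cert228: "good_groups [(False,False,0,[4754847,4774386,4840867]),(False,True,0,[4774303,4839987]),(True,False,0,
    [4781671,4879923]),(True,True,0,[4755303,4781682,4880227]),(False,False,1,[4847203,4863603]),(False,True,1,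
    [4774519,4780662,4839567]),(True,False,1,[4758927,4775335,4839666]),(True,True,1,[4824931,4862823])]"
  by (rule certificate[of 2 "[2,4,1,5,3]" "[2,3,5,1,4]" "[104,499,1,1,6]" "[1,127631,28,1,7]" 4 4 29 4888527])
    (simp_all only: cert_rules)

lemma cert229: "good_groups [(False,False,0,[17423783]),(True,False,0,[17430119])]"
  by (rule certificate[of 2 "[2,4,1,5,3]" "[2,5,4,1,3]" "[1,1699,29247,1,18]" "[428175,26,1,1,26]" 5 4 1801 5037418])
    (simp_all only: cert_rules)

lemma cert230: "good_groups [(False,False,0,[4759395,4847154,4863847]),(False,True,0,[4771239,4824463]),(True,False,0,
    [4774515,4839823]),(True,True,0,[4770294,4847139,4863607]),(False,False,1,[4820839,4879203]),(False,True,1,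
    [4781607,4835574,4879927]),(True,False,1,[4774047,4839991,4846134]),(True,True,1,[4820383,4836771])]"
  by (rule certificate[of 2 "[2,4,1,6,8,3,5,10,7,9]" "[3,5,2,1,9,8,4,6,10,7]" "[1,4,24,7,1,1,1,1679,4751,4]" "[1,1,
    392,1,419,419,419,99,1,1]" 2 3 1421 490650]) (simp_all only: cert_rules)

lemma cert231: "good_groups [(False,False,0,[4754591,4770290,4846115]),(False,True,0,[4774451,4839839]),(True,False,0,
    [4770983,4878899]),(True,True,0,[4755299,4781618,4880231]),(False,False,1,[4836515,4862579]),(False,True,1,
    [4774031,4780598,4840055]),(True,False,1,[4758671,4780583,4835570]),(True,True,1,[4824935,4862819])]"
  by (rule certificate[of 2 "[2,5,1,7,6,3,9,4,10,8]" "[2,3,6,1,8,9,4,5,10,7]" "[1,1,6,18575,6,31,1,1,18575,1]" "[1679,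
    1,106,1,6799,1,1,6287,6799,4751]" 6 3 18 80568457]) (simp_all only: cert_rules)

lemma cert232: "good_groups [(False,False,0,[301695]),(False,True,0,[303050,303743]),(True,False,0,[304118,305655]),
    (True,True,0,[305615]),(False,False,-1,[4754934,4775778,4840906,4859767]),(False,True,-1,[4826931]),(True,False,
    -1,[4823503]),(True,True,-1,[4753911,4759410,4847394,4863862])]"
  by (rule certificate[of 3 "[2,3,1,5,8,9,6,4,7]" "[1,4,6,9,2,8,3,5,7]" "[419,1,1,1571,103,1439,1,1,7]" "[103,1,1,99,
    1,5,99,1,1]" 6 2 344 24126808]) (simp_all only: cert_rules)

lemma cert233: "good_groups [(False,False,0,[17344311]),(False,True,0,[17402355]),(False,False,1,[17458959]),(False,
    True,1,[17424138,17435103,17436534])]"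
  by (rule certificate[of 3 "[2,1,5,7,9,3,10,4,6,8]" "[3,4,1,2,8,9,6,10,5,7]" "[1,1,1,1,1639,1,415,1,1,1]" "[423,399,
    1,1,399,4,423,1695,1423,6]" 4 2 345 72112013145]) (simp_all only: cert_rules)

lemma cert234: "good_groups [(False,False,0,[4352463]),(True,False,0,[4360695])]"
  by (rule certificate[of 2 "[1,4,5,2,3,6]" "[2,5,1,3,6,4]" "[1190463,1,1214719,291,1712703,108799]" "[305407,1,1,1,7,
    1]" 5 4 463 7364709536747487]) (simp_all only: cert_rules)

lemma cert235: "good_groups [(False,False,0,[17357991]),(True,False,0,[17429091]),(False,False,1,[17363559]),(True,
    False,1,[17423523])]"
  by (rule certificate[of 2 "[2,4,1,6,3,5]" "[1,3,5,2,4,6]" "[1,1,1,100927,1,1]" "[434751,6431295,297535,6457599,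
    305407,7]" 1 4 21952 5886291951552]) (simp_all only: cert_rules)

lemma cert236: "good_groups [(False,False,0,[4334143]),(True,False,0,[4367155])]"
  by (rule certificate[of 2 "[1,4,5,2,3,6]" "[2,5,1,3,6,4]" "[6,4,399,303679,6799,25151]" "[1,1,1,1,1,26]" 1 4 4
    358777496]) (simp_all only: cert_rules)

lemma cert237: "good_groups [(False,False,0,[4348479]),(False,True,0,[4349914]),(True,False,0,[4366294,4367319])]"
  by (rule certificate[of 2 "[2,3,1,8,9,4,5,6,7,12,13,14,15,10,11,20,21,16,17,18,19,23,24,22]" "[4,6,8,10,1,12,2,14,3,
    16,5,18,7,20,9,22,11,23,13,24,15,17,19,21]" "[1,1,1,1,1,99,6287,1679,1,6287,1,1,1,1,291,1,1,419,1,19,291,1,99,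
    99]" "[24,1,1,1,1,1679,24,1,99,1,99,1,7,1679,1,1,1,1,1,1,291,7,1,1]" 4 2 374 521766]) (simp_all only: cert_rules)

lemma cert238: "good_groups [(False,False,0,[4232591]),(False,True,0,[4232694]),(True,False,0,[4235094,4236119]),
    (False,False,-1,[4232759]),(True,False,-1,[4233431])]"
  by (rule certificate[of 2 "[2,4,1,8,7,3,13,12,11,5,6,10,9]" "[1,5,7,3,11,2,8,10,4,12,13,6,9]" "[1,4751,18575,291,1,
    1,24,1,1,1,1,7,1]" "[1679,1,7,1,1679,291,24,399,1,1,6,1,99]" 6 3 502 30646243126]) (simp_all only: cert_rules)

lemma cert239: "good_groups [(False,False,0,[16787039]),(True,False,0,[16787831])]"
  by (rule certificate[of 2 "[2,5,1,7,4,3,6]" "[3,6,5,1,7,4,2]" "[1,1571,1,1,1,1,6719]" "[1607935,1607823,1,4643,1167,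
    291,31]" 4 4 1270 77395421]) (simp_all only: cert_rules)

lemma cert240: "good_groups [(False,False,0,[301631,19505983]),(False,True,0,[303066,305375,19047391,19529178,
    19545586]),(True,False,0,[305142,305399,19128106,19521498,19538911]),(True,True,0,[304703,19506163]),(False,False,
    -1,[4759030,4775370,4841314,4858743]),(False,True,-1,[4823283]),(True,False,-1,[4823247]),(True,True,-1,[4759414,
    4760439,4847458,4863858])]"
  by (rule certificate[of 2 "[1,4,2,6,7,3,5]" "[2,5,1,3,4,7,6]" "[1739007,404031,6857727,1,291,1,291]" "[1,107151,1,
    319,1,6,1]" 4 4 297 109295732979]) (simp_all only: cert_rules)

lemma cert241: "good_groups [(False,False,0,[4356058]),(True,True,0,[4366198]),(False,False,1,[4825971,4846438]),
    (False,True,1,[4775718,4819167,4840666]),(True,False,1,[4757751,4820850,4879222]),(True,True,1,[4824310,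
    4875063])]"
  by (rule certificate[of 2 "[1,2,5,8,6,3,7,9,4,10,13,14,19,20,17,18,21,22,11,12,15,16,23,24,25,26,27,28,29,30]" "[2,
    4,1,10,11,13,3,15,17,7,16,5,18,6,12,8,14,9,23,25,27,29,28,19,30,20,24,21,26,22]" "[4,24,1,115,1,99,7,6287,104,4,
    99,1,1,24,99,1,1,1,1,1,1,7,99,99,291,1,99,1,291,291]" "[1,1,4,1,291,1,1,1,1,1,1,291,1,1,1,1,1,1,1,1,1,1,1,291,1,1,
    1,6287,1,99]" 2 2 306 5920]) (simp_all only: cert_rules)

lemma cert242: "good_groups [(False,False,0,[16943487]),(True,False,0,[16950735])]"
  by (rule certificate[of 2 "[1,3,6,2,7,4,5,8]" "[2,5,1,8,4,7,3,6]" "[434751,1712703,1,1,1188415,1190143,1,7]" "[1,1,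
    1,1,6799,303679,7,76351]" 4 4 103 25810340503]) (simp_all only: cert_rules)

lemma cert243: "good_groups [(False,False,0,[4339359]),(True,False,0,[4366179])]"
  by (rule certificate[of 2 "[4,5,6,10,11,12,1,2,3,14,15,13,16,17,18,33,31,32,7,8,9,19,20,21,23,24,22,25,26,27,30,28,
    29]" "[2,3,1,14,15,13,22,23,24,28,29,30,21,19,20,5,6,4,31,32,33,10,11,12,7,8,9,25,26,27,16,17,18]" "[6,99,99,1,1,
    1,1,1167,1,1,1,1,99,99,399,1,1,419,1,1,99,6,1,1,1,1167,1,1,1,1,1,4,1]" "[1,1,1,1,1,1,1,399,1,99,1,1,99,1,1,1,1,24,
    99,1,1,26,399,1,1167,4,6,1,1,1,1,399,1]" 4 2 1385 334749533]) (simp_all only: cert_rules)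

lemma cert244: "good_groups [(False,False,0,[4348543]),(False,True,0,[4349898]),(True,False,0,[4362198,4368343])]"
  by (rule certificate[of 3 "[2,4,1,5,3]" "[1,5,4,2,3]" "[1,5,1,5667,7]" "[103,1,4,1,18831]" 5 3 469 308677069])
    (simp_all only: cert_rules)

lemma cert245: "good_groups [(False,False,0,[4328063,4329434,4366274]),(False,True,0,[4368323])]"
  by (rule certificate[of 2 "[2,3,1,10,13,16,19,15,21,22,4,7,11,5,27,28,6,9,17,8,20,33,30,12,35,14,31,25,26,18,36,24,
    34,23,29,32]" "[4,6,8,12,1,18,2,14,3,7,23,15,20,16,5,9,29,10,11,32,17,22,35,24,13,26,27,28,36,30,19,34,21,25,31,
    33]" "[1,1,1,24,1,1,7,1,1,1,1,1,1,24,4,1,7,1,1,1,1,1,4,1,1,1,1,1,1,1,1,1,1,1,1,1]" "[7,7,4,6,4,6,1,19,1,4,1,4,1,1,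
    1,6,1,4,1,1,1,1,1,1,1,1,1,1,1,1,1,1,1,1,1,1]" 2 2 1622 7926585841101]) (simp_all only: cert_rules)

lemma cert246: "good_groups [(False,False,0,[4340899])]"
  by (rule certificate[of 2 "[1,4,5,3,2,9,10,8,7,6]" "[2,6,1,7,8,5,3,4,9,10]" "[24,26767,74303,1,1,1,74303,6719,26767,
    1]" "[1,1,1,1,101007,305407,7,1,297535,108799]" 1 4 2034 5746773792]) (simp_all only: cert_rules)

lemma cert247: "good_groups [(False,False,0,[4357543])]"
  by (rule certificate[of 2 "[1,4,5,3,2,9,10,8,7,6]" "[2,6,1,7,8,5,3,4,9,10]" "[19087,1,1,7,6799,1,1679,29327,1,1]"
    "[1,1,18575,1679,291,1,1,1,6,76351]" 5 4 103 6453556087]) (simp_all only: cert_rules)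

lemma cert248: "good_groups [(False,False,0,[4355743]),(True,False,0,[4366183])]"
  by (rule certificate[of 2 "[2,4,1,10,13,15,3,9,16,20,22,17,25,5,28,6,7,29,8,24,27,31,11,12,35,14,19,33,37,18,30,23,
    21,36,38,26,40,39,34,32]" "[1,5,8,11,6,2,18,9,3,16,12,4,23,17,19,13,27,7,22,31,10,15,34,26,28,35,14,30,38,25,32,
    20,36,21,24,40,37,39,29,33]" "[1,291,419,1,99,1,1,99,1,1,99,1,1,1,1,1571,1,1599,1,6,419,1,1,19,1,1,291,399,1,1,
    1571,1,1679,1,79,1571,1,1,1,1]" "[4,99,1,1,291,1,1,1,99,1,99,1,99,291,1,419,1,1,99,99,1,1,7,4,99,1,99,1,1,1,1,1,
    1679,1,1,1,1679,1679,1,1]" 4 2 1160 22909814816]) (simp_all only: cert_rules)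

lemma cert249: "good_groups [(False,False,0,[4236927]),(True,False,0,[4237791])]"
  by (rule certificate[of 2 "[2,6,1,12,14,16,10,15,3,21,17,18,4,11,5,20,19,7,8,9,13]" "[4,7,10,11,1,13,19,2,12,5,3,8,
    15,16,20,18,6,14,9,21,17]" "[1,106,6719,1,1699,1,1,1,1679,419,1,1,124,1,31,115,399,1,6,99,6]" "[26,1,1,1,1,1,1,31,
    1679,304127,7,1679,499,1,1,7,24,1,1,1,1]" 6 3 1087 6294682]) (simp_all only: cert_rules)

lemma cert250: "good_groups [(False,False,0,[4827647]),(False,True,0,[4849450,4884991]),(True,False,0,[4886518,
    4892663]),(True,True,0,[4892479])]"
  by (rule certificate[of 2 "[2,1,4,3,13,14,15,16,22,21,23,24,27,28,26,25,6,5,8,7,33,34,35,36,10,9,11,12,43,44,41,42,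
    17,18,19,20,29,30,31,32,37,38,40,39]" "[5,6,7,8,17,18,19,20,3,4,1,2,22,21,24,23,16,15,13,14,33,34,35,36,29,30,31,
    32,11,12,9,10,37,38,39,40,28,27,25,26,42,41,44,43]" "[1,1,1,1,1,1,18,1,4,1,1,1,1,115,1,124,1,4,1,1,1,1,4643,1,18,
    1,1,1,1,291,1,28,1827,74,74,124,28,18,1,1,18,1,19,4643]" "[1,18,4,4,1,1,1,1,1,1,72,4,1,7,1,124,1,1,1,18,1,1,1,6,1,
    1,1,1,1,1,18,1,19,1,1,7,1,1,1,1,1,1,1,99]" 3 2 1538 8218831]) (simp_all only: cert_rules)

lemma cert251: "good_groups [(False,False,0,[17416863,17464359])]"
  by (rule certificate[of 2 "[1,4,5,3,2,6]" "[2,4,1,6,3,5]" "[6859007,107151,1,1,31,19007]" "[1,1699,1,26,18575,1]" 1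
    5 394022 33511449962]) (simp_all only: cert_rules)

lemma cert252: "good_groups [(False,False,0,[4352063]),(False,True,0,[4366559]),(True,False,0,[4366583]),(True,True,0,
    [4364351])]"
  by (rule certificate[of 2 "[3,4,5,6,1,2,9,10,11,12,7,8,13,14,15,16,17,18,23,24,19,20,21,22,30,29,25,26,28,27,33,34,
    35,36,31,32,37,38,39,40,41,42,43,44,46,45,48,47]" "[7,8,9,10,11,12,19,20,21,22,23,24,1,2,3,4,5,6,31,32,33,34,35,
    36,13,14,15,16,18,17,43,44,45,46,47,48,25,26,27,28,29,30,37,38,39,40,41,42]" "[1,1,1,1,1,1,1,1,1,1,1,1,1,1,1,1,1,
    1,1,1,1,1,1,1,1,1,1,1,1,1,1,1,1,1,1,1,1,1,1,1,1,1,1,1,1,1,1,1]" "[1,1,1,1,1,1,1,1,1,1,1,1,1,1,1,6,1,6,1,1,1,1,1,1,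
    1,6,1,1,1,1,4,1,4,1,4,1,1,1,1,1,1,1,1,1,1,1,1,1]" 4 2 109226 617962579153834937122728191]) (simp_all only:
    cert_rules)

lemma cert253: "good_groups [(False,False,0,[16937631]),(True,False,0,[16949031])]"
  by (rule certificate[of 3 "[2,4,1,3,7,5,8,6]" "[1,3,5,6,2,7,4,8]" "[362895,1,1,6559,1466943,1827,1,1]" "[5671,1,1,1,
    90767,23103,103,6719]" 6 3 1294489 20653318809]) (simp_all only: cert_rules)

lemma cert254: "good_groups [(False,False,0,[4338319,4354719,17353311,17356431,17418767,17421983]),(False,True,0,
    [17436047,17462879]),(True,False,0,[4362019,4366119,17436455,17448291,17456931,17464679]),(True,True,0,[17446415,
    17456543])]"
  by (rule certificate[of 3 "[1,3,4,2,7,5,6,8]" "[2,4,1,6,3,8,5,7]" "[99,1,1,1,18,1,29,5]" "[1,73,74,1,1,1162,1,1]" 1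
    3 1894 484059747]) (simp_all only: cert_rules)

lemma cert255: "good_groups [(False,False,0,[4827391]),(False,True,0,[4849514,4891519]),(True,False,0,[4890614,
    4891639]),(True,True,0,[4888831])]"
  by (rule certificate[of 2 "[2,4,1,5,12,14,3,7,11,20,22,21,25,28,6,31,8,33,9,26,10,38,41,43,44,13,35,46,48,15,17,16,
    32,18,50,19,40,52,36,47,34,23,53,24,29,55,27,54,30,45,37,51,39,49,42]" "[1,5,8,10,13,2,16,18,3,9,4,24,27,12,7,6,
    23,35,17,38,39,21,11,15,45,37,47,20,14,31,46,49,29,40,50,32,19,26,34,22,52,36,28,54,30,25,51,55,33,48,53,44,42,41,
    43]" "[1,1571,419,7,1,1,6719,1,1,1,399,1,291,1,1,24,31,19,1,72,419,6,4,1,1,31,1,25123,1,399,4,1,99,1,291,1,79,1,7,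
    1,4,1699,1,6,1,399,99,26,1,1,1,1,1,1,1]" "[99,99,1,1,1,1,99,104,1599,99,1,26,1,1,1,1,99,19,1,1,6,99,1,115,1,1,1,
    98,1,1,1,24,1,7,4,1,7,72,1,1,1,419,115,1,99,291,6,1,7,19,1,1,79,1,104]" 4 2 67751 18876573]) (simp_all only:
    cert_rules)

lemma cert256: "good_groups [(False,False,0,[1058319]),(True,False,0,[1058871]),(False,False,1,[16930867]),(True,
    False,1,[16916695])]"
  by (rule certificate[of 2 "[2,6,1,12,15,18,17,14,3,25,26,24,4,10,23,5,11,9,16,13,7,8,30,29,28,27,22,21,19,20]" "[4,
    7,10,14,1,19,15,2,23,13,3,8,12,17,16,11,5,27,26,6,25,24,21,9,20,22,29,18,30,28]" "[1,104,1,1,1,18575,1,1,4671,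
    18687,6,1,1,1,419,1607935,1,1,1,419,1,1,26767,7,424,1,419,31,6719,1]" "[108687,1,104,1,1,25151,1607935,319,19,
    1571,1,291,4643,4671,1739007,1,6850815,1,1,1,1,1,1,4751,27279,1,99,1,1,1]" 4 3 100387 69633254819]) (simp_all
    only: cert_rules)

lemma cert257: "good_groups [(False,False,0,[4356042]),(True,True,0,[4362102]),(False,False,1,[4819443,4846374]),
    (False,True,1,[4775130,4819423,4841254]),(True,False,1,[4761399,4820854,4879218]),(True,True,1,[4820214,
    4876087])]"
  by (rule certificate[of 2 "[2,3,1,10,13,16,12,14,18,7,4,17,11,5,8,9,6,15]" "[4,6,8,12,1,13,2,18,3,14,9,15,11,10,5,
    16,7,17]" "[1,1,1,1,98,1,1876543,1214719,1,1,1,297535,428607,119710719,1,1738895,1167,7479871]" "[24,25732095,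
    428607,434751,1,1,1,1,6719,1614399,18575,1,1,1,108799,7,1,1]" 1 5 1539433 21124081133209]) (simp_all only:
    cert_rules)

lemma cert258: "good_groups [(False,False,0,[4761855,4886514]),(False,True,0,[4891455]),(True,False,0,[4891635]),
    (True,True,0,[4783914,4884735])]"
  by (rule certificate[of 3 "[2,1,3,4,6,5,8,7,10,9,12,11,13,14,15,16,18,17,19,20,22,21,24,23,25,26,27,28,29,30]" "[11,
    12,13,14,15,16,17,18,19,20,23,24,25,26,27,28,29,30,21,22,1,2,3,4,5,6,7,8,10,9]" "[1,22687,104591,26239,1,1695,
    418431,1,1,6287,6287,1,23167,27039,108159,6559,1695,401983,1679,99,6287,1,1,6287,27199,99,1713727,26239,432639,
    27039]" "[23167,1,1,1,27199,1,1,1,99,1,1,99,6783,1695,1,1,1,1,1,1,25231,1,1,1,1,1,1,1,6,1]" 2 3 534760106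
    36878143593100855978]) (simp_all only: cert_rules)

lemma cert259: "good_groups [(False,False,0,[4334578]),(True,True,0,[4341538]),(False,False,1,[4760371,4862770]),
    (False,True,1,[4753615,4754674,4771618]),(True,False,1,[4753651,4755250,4780834]),(True,True,1,[4771018,
    4858675])]"
  by (rule certificate[of 3 "[2,6,1,12,15,18,10,16,3,25,19,20,4,30,11,5,35,24,22,7,28,8,33,9,13,31,23,29,26,21,14,40,
    36,27,34,17,41,32,37,42,50,44,38,45,43,56,49,47,39,48,54,53,51,55,46,52]" "[4,7,10,14,1,13,21,2,12,26,3,28,29,32,
    18,24,5,20,6,31,38,9,8,25,30,40,11,42,43,44,45,46,15,16,19,22,17,51,23,53,27,55,56,52,54,37,33,34,35,36,49,39,50,
    41,47,48]" "[1,1,1,419,355,355,25151,1167,1,419455,1,5775,1,108095,18575,27039,1,1204863,6543,1,401983,1,100767,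
    6543,1,1,1,1,1,419455,105023,1,1,1,19,1,6303,1,1,1,1,1,1,1,401983,1,25,1,75327,1,5775,1,1,1,105023,107135]"
    "[25151,1,1,1,1,415,19007,1,1,1,6303,19007,401983,401983,29,1,1,1,1,297535,1,6543,1571,1,1,1,99,26271,1,1,100991,
    105023,1,402047,1,1,6815,419,6303,100751,1,1,1,1,1,100991,25,6543,1,99,5791,1,1,1,6783,1]" 2 3 71098355
    565060949698256233]) (simp_all only: cert_rules)

text \<open>The combined action has 32 * 2^6 states, but with symbolic digits each relator is run
  only once from each of the 32 points.\<close>

lemma cert260: "good_groups [(False,False,0,[4341606]),(True,True,0,[4351986])]"
  by (rule certificate[of 2 "[5,6,7,8,3,4,2,1,18,17,19,20,28,27,25,26,9,10,12,11,29,30,32,31,13,14,15,16,21,22,24,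
    23]" "[3,4,1,2,9,10,11,12,23,24,21,22,5,6,7,8,13,14,15,16,29,30,31,32,17,18,19,20,25,26,27,28]" "[1,1217012735,
    447385599,311528325119,1679,1,1,111290623,27955199,311070719,113961484287,1,457584148479,1,1,1,1,439002111,1,1,
    28095692799,1,25837567,304228607,28490481663,446833663,1,114523521023,28062138367,27822335,1,447390719]" "[1,
    19015935,113986650111,1,1,1,1780629503,111322111,6955583,1,1,6,1,111322111,1,1,1655324671,7122592767,7156043775,1,
    1795868999679,1787334655,1,19435519,1,1,1,1,1,1,26879,1]" 1 6 20296012492941
    1570553746564621931081178057533358764595]) (simp_all only: cert_rules)

text \<open>The arguments are the rotation and three flags for inverting a, inverting t and
  inverting the relator; together they carry the coded word to one of the thirteen.\<close>

lemma exc1: "good (wd 271139)"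
  by (rule good_if_exceptional[of "(Suc (Suc (Suc (Suc (Suc (Suc (Suc (Suc 0))))))))" False True False]) (simp add:
    word_rules)

lemma exc2: "good (wd 271207)"
  by (rule good_if_exceptional[of "(Suc (Suc (Suc (Suc (Suc (Suc (Suc (Suc 0))))))))" False True False]) (simp add:
    word_rules)

lemma exc3: "good (wd 272167)"
  by (rule good_if_exceptional[of "(Suc (Suc (Suc (Suc (Suc (Suc (Suc (Suc 0))))))))" False True False]) (simp add:
    word_rules)

lemma exc4: "good (wd 272227)"
  by (rule good_if_exceptional[of "(Suc (Suc (Suc (Suc (Suc (Suc 0))))))" True True True]) (simp add: word_rules)

lemma exc5: "good (wd 4328483)"
  by (rule good_if_exceptional[of "(Suc (Suc 0))" False False False]) (simp add: word_rules)

lemma exc6: "good (wd 4328579)"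
  by (rule good_if_exceptional[of "(Suc (Suc (Suc (Suc (Suc (Suc (Suc 0)))))))" False False False]) (simp add:
    word_rules)

lemma exc7: "good (wd 4328807)"
  by (rule good_if_exceptional[of "(Suc (Suc (Suc (Suc (Suc (Suc (Suc (Suc (Suc (Suc 0))))))))))" False True False])
    (simp add: word_rules)

lemma exc8: "good (wd 4328855)"
  by (rule good_if_exceptional[of "(Suc (Suc (Suc (Suc (Suc (Suc (Suc (Suc (Suc (Suc 0))))))))))" False True False])
    (simp add: word_rules)

lemma exc9: "good (wd 4337795)"
  by (rule good_if_exceptional[of "(Suc (Suc (Suc (Suc (Suc (Suc (Suc 0)))))))" False False False]) (simp add:
    word_rules)

lemma exc10: "good (wd 4339095)"
  by (rule good_if_exceptional[of "(Suc (Suc (Suc (Suc (Suc (Suc (Suc (Suc (Suc (Suc 0))))))))))" False True False])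
    (simp add: word_rules)

lemma exc11: "good (wd 4348967)"
  by (rule good_if_exceptional[of "(Suc (Suc (Suc (Suc (Suc 0)))))" False True False]) (simp add: word_rules)

lemma exc12: "good (wd 4349079)"
  by (rule good_if_exceptional[of "(Suc (Suc (Suc (Suc (Suc (Suc (Suc (Suc (Suc (Suc 0))))))))))" False True False])
    (simp add: word_rules)

lemma exc13: "good (wd 4349283)"
  by (rule good_if_exceptional[of "(Suc (Suc 0))" True False False]) (simp add: word_rules)

lemma exc14: "good (wd 4349315)"
  by (rule good_if_exceptional[of "(Suc (Suc (Suc (Suc (Suc (Suc (Suc 0)))))))" False False False]) (simp add:
    word_rules)

lemma exc15: "good (wd 4354199)"
  by (rule good_if_exceptional[of "(Suc (Suc (Suc (Suc (Suc (Suc (Suc (Suc (Suc (Suc 0))))))))))" False True False])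
    (simp add: word_rules)

lemma exc16: "good (wd 4355459)"
  by (rule good_if_exceptional[of "(Suc (Suc (Suc (Suc (Suc (Suc (Suc 0)))))))" False False False]) (simp add:
    word_rules)

lemma exc17: "good (wd 4230179)"
  by (rule good_if_exceptional[of "(Suc (Suc (Suc (Suc (Suc (Suc (Suc (Suc (Suc (Suc 0))))))))))" False True False])
    (simp add: word_rules)

lemma exc18: "good (wd 4230503)"
  by (rule good_if_exceptional[of "(Suc (Suc (Suc (Suc (Suc (Suc (Suc (Suc (Suc (Suc 0))))))))))" False True False])
    (simp add: word_rules)

lemma exc19: "good (wd 4234279)"
  by (rule good_if_exceptional[of "(Suc (Suc (Suc (Suc (Suc (Suc (Suc (Suc (Suc (Suc 0))))))))))" False True False])
    (simp add: word_rules)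

lemma exc20: "good (wd 4234595)"
  by (rule good_if_exceptional[of "(Suc (Suc (Suc (Suc (Suc (Suc (Suc 0)))))))" True True True]) (simp add:
    word_rules)

text \<open>The coded words are a^n t a^m t^-1. Rotation by n gives \<open>bs_word m (-n)\<close>,
  and the arguments are m, -n and n. Pairs with a common factor are killed by certificates
  instead.\<close>

lemma bs1: "good (wd 291)"
  by (rule good_if_bs[of "1" "-1" "(Suc 0)"], code_simp) (simp add: word_rules)

lemma bs2: "good (wd 295)"
  by (rule good_if_bs[of "-1" "-1" "(Suc 0)"], code_simp) (simp add: word_rules)

lemma bs3: "good (wd 1059)"
  by (rule good_if_bs[of "1" "-2" "(Suc (Suc 0))"], code_simp) (simp add: word_rules)

lemma bs4: "good (wd 1063)"
  by (rule good_if_bs[of "-1" "-2" "(Suc (Suc 0))"], code_simp) (simp add: word_rules)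

lemma bs5: "good (wd 4131)"
  by (rule good_if_bs[of "1" "-3" "(Suc (Suc (Suc 0)))"], code_simp) (simp add: word_rules)

lemma bs6: "good (wd 4135)"
  by (rule good_if_bs[of "-1" "-3" "(Suc (Suc (Suc 0)))"], code_simp) (simp add: word_rules)

lemma bs7: "good (wd 16515)"
  by (rule good_if_bs[of "2" "-3" "(Suc (Suc (Suc 0)))"], code_simp) (simp add: word_rules)

lemma bs8: "good (wd 16535)"
  by (rule good_if_bs[of "-2" "-3" "(Suc (Suc (Suc 0)))"], code_simp) (simp add: word_rules)

lemma bs9: "good (wd 16419)"
  by (rule good_if_bs[of "1" "-4" "(Suc (Suc (Suc (Suc 0))))"], code_simp) (simp add: word_rules)

lemma bs10: "good (wd 16423)"
  by (rule good_if_bs[of "-1" "-4" "(Suc (Suc (Suc (Suc 0))))"], code_simp) (simp add: word_rules)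

lemma bs11: "good (wd 65571)"
  by (rule good_if_bs[of "1" "-5" "(Suc (Suc (Suc (Suc (Suc 0)))))"], code_simp) (simp add: word_rules)

lemma bs12: "good (wd 65575)"
  by (rule good_if_bs[of "-1" "-5" "(Suc (Suc (Suc (Suc (Suc 0)))))"], code_simp) (simp add: word_rules)

lemma bs13: "good (wd 262659)"
  by (rule good_if_bs[of "3" "-4" "(Suc (Suc (Suc (Suc 0))))"], code_simp) (simp add: word_rules)

lemma bs14: "good (wd 262743)"
  by (rule good_if_bs[of "-3" "-4" "(Suc (Suc (Suc (Suc 0))))"], code_simp) (simp add: word_rules)

lemma bs15: "good (wd 262275)"
  by (rule good_if_bs[of "2" "-5" "(Suc (Suc (Suc (Suc (Suc 0)))))"], code_simp) (simp add: word_rules)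

lemma bs16: "good (wd 262295)"
  by (rule good_if_bs[of "-2" "-5" "(Suc (Suc (Suc (Suc (Suc 0)))))"], code_simp) (simp add: word_rules)

lemma bs17: "good (wd 262179)"
  by (rule good_if_bs[of "1" "-6" "(Suc (Suc (Suc (Suc (Suc (Suc 0))))))"], code_simp) (simp add: word_rules)

lemma bs18: "good (wd 262183)"
  by (rule good_if_bs[of "-1" "-6" "(Suc (Suc (Suc (Suc (Suc (Suc 0))))))"], code_simp) (simp add: word_rules)

lemma bs19: "good (wd 1049091)"
  by (rule good_if_bs[of "3" "-5" "(Suc (Suc (Suc (Suc (Suc 0)))))"], code_simp) (simp add: word_rules)

lemma bs20: "good (wd 1049175)"
  by (rule good_if_bs[of "-3" "-5" "(Suc (Suc (Suc (Suc (Suc 0)))))"], code_simp) (simp add: word_rules)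

lemma bs21: "good (wd 1048611)"
  by (rule good_if_bs[of "1" "-7" "(Suc (Suc (Suc (Suc (Suc (Suc (Suc 0)))))))"], code_simp) (simp add: word_rules)

lemma bs22: "good (wd 1048615)"
  by (rule good_if_bs[of "-1" "-7" "(Suc (Suc (Suc (Suc (Suc (Suc (Suc 0)))))))"], code_simp) (simp add: word_rules)

lemma bs23: "good (wd 4196355)"
  by (rule good_if_bs[of "4" "-5" "(Suc (Suc (Suc (Suc (Suc 0)))))"], code_simp) (simp add: word_rules)

lemma bs24: "good (wd 4196695)"
  by (rule good_if_bs[of "-4" "-5" "(Suc (Suc (Suc (Suc (Suc 0)))))"], code_simp) (simp add: word_rules)

lemma bs25: "good (wd 4194435)"
  by (rule good_if_bs[of "2" "-7" "(Suc (Suc (Suc (Suc (Suc (Suc (Suc 0)))))))"], code_simp) (simp add: word_rules)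

lemma bs26: "good (wd 4194455)"
  by (rule good_if_bs[of "-2" "-7" "(Suc (Suc (Suc (Suc (Suc (Suc (Suc 0)))))))"], code_simp) (simp add: word_rules)

lemma bs27: "good (wd 4194339)"
  by (rule good_if_bs[of "1" "-8" "(Suc (Suc (Suc (Suc (Suc (Suc (Suc (Suc 0))))))))"], code_simp) (simp add:
    word_rules)

lemma bs28: "good (wd 4194343)"
  by (rule good_if_bs[of "-1" "-8" "(Suc (Suc (Suc (Suc (Suc (Suc (Suc (Suc 0))))))))"], code_simp) (simp add:
    word_rules)

lemma bs29: "good (wd 16777731)"
  by (rule good_if_bs[of "3" "-7" "(Suc (Suc (Suc (Suc (Suc (Suc (Suc 0)))))))"], code_simp) (simp add: word_rules)

lemma bs30: "good (wd 16777815)"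
  by (rule good_if_bs[of "-3" "-7" "(Suc (Suc (Suc (Suc (Suc (Suc (Suc 0)))))))"], code_simp) (simp add: word_rules)

lemma bs31: "good (wd 16777251)"
  by (rule good_if_bs[of "1" "-9" "(Suc (Suc (Suc (Suc (Suc (Suc (Suc (Suc (Suc 0)))))))))"], code_simp) (simp add:
    word_rules)

lemma bs32: "good (wd 16777255)"
  by (rule good_if_bs[of "-1" "-9" "(Suc (Suc (Suc (Suc (Suc (Suc (Suc (Suc (Suc 0)))))))))"], code_simp) (simp add:
    word_rules)

lemmas certs = cert1 cert2 cert3 cert4 cert5 cert6 cert7 cert8 cert9 cert10 cert11 cert12 cert13 cert14 cert15
  cert16 cert17 cert18 cert19 cert20 cert21 cert22 cert23 cert24 cert25 cert26 cert27 cert28 cert29 cert30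
  cert31 cert32 cert33 cert34 cert35 cert36 cert37 cert38 cert39 cert40 cert41 cert42 cert43 cert44 cert45
  cert46 cert47 cert48 cert49 cert50 cert51 cert52 cert53 cert54 cert55 cert56 cert57 cert58 cert59 cert60
  cert61 cert62 cert63 cert64 cert65 cert66 cert67 cert68 cert69 cert70 cert71 cert72 cert73 cert74 cert75
  cert76 cert77 cert78 cert79 cert80 cert81 cert82 cert83 cert84 cert85 cert86 cert87 cert88 cert89 cert90
  cert91 cert92 cert93 cert94 cert95 cert96 cert97 cert98 cert99 cert100 cert101 cert102 cert103 cert104 cert105
  cert106 cert107 cert108 cert109 cert110 cert111 cert112 cert113 cert114 cert115 cert116 cert117 cert118
  cert119 cert120 cert121 cert122 cert123 cert124 cert125 cert126 cert127 cert128 cert129 cert130 cert131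
  cert132 cert133 cert134 cert135 cert136 cert137 cert138 cert139 cert140 cert141 cert142 cert143 cert144
  cert145 cert146 cert147 cert148 cert149 cert150 cert151 cert152 cert153 cert154 cert155 cert156 cert157
  cert158 cert159 cert160 cert161 cert162 cert163 cert164 cert165 cert166 cert167 cert168 cert169 cert170
  cert171 cert172 cert173 cert174 cert175 cert176 cert177 cert178 cert179 cert180 cert181 cert182 cert183
  cert184 cert185 cert186 cert187 cert188 cert189 cert190 cert191 cert192 cert193 cert194 cert195 cert196
  cert197 cert198 cert199 cert200 cert201 cert202 cert203 cert204 cert205 cert206 cert207 cert208 cert209
  cert210 cert211 cert212 cert213 cert214 cert215 cert216 cert217 cert218 cert219 cert220 cert221 cert222
  cert223 cert224 cert225 cert226 cert227 cert228 cert229 cert230 cert231 cert232 cert233 cert234 cert235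
  cert236 cert237 cert238 cert239 cert240 cert241 cert242 cert243 cert244 cert245 cert246 cert247 cert248
  cert249 cert250 cert251 cert252 cert253 cert254 cert255 cert256 cert257 cert258 cert259 cert260

text \<open>The leaves of the search trees. A relator missing here would leave an open goal
  \<open>good (wd ...)\<close> in the enumeration, so completeness of the list is checked along the
  way.\<close>

lemmas good_facts = certs[unfolded good_groups.simps goods.simps] exc1 exc2 exc3 exc4 exc5 exc6 exc7 exc8 exc9
  exc10 exc11 exc12 exc13 exc14 exc15 exc16 exc17 exc18 exc19 exc20 bs1 bs2 bs3 bs4 bs5 bs6 bs7 bs8 bs9 bs10
  bs11 bs12 bs13 bs14 bs15 bs16 bs17 bs18 bs19 bs20 bs21 bs22 bs23 bs24 bs25 bs26 bs27 bs28 bs29 bs30 bs31 bs32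

text \<open>After the prefix a^n t at most 11 - n letters remain and the exponent sum is 1, whence
  the counters 10 - n and 12 - n.\<close>

definition starts :: "nat \<Rightarrow> bool" where
  "starts n \<longleftrightarrow> (\<exists>k. decn k [] = replicate n (Ga, True) @ [(Gt, True)] \<and>
     EXT good n k (Gt, True) n (10 - n) (12 - n))"

lemma startsI:
  "EXT good m k (Gt, True) m x y \<Longrightarrow> m = n \<Longrightarrow> x = 10 - n \<Longrightarrow> y = 12 - n \<Longrightarrow>
    decn k [] = replicate n (Ga, True) @ [(Gt, True)] \<Longrightarrow> starts n"
  unfolding starts_def by blast

lemma enum1: "starts 1"
  by (rule startsI[of "(Suc 0)" "num.Bit0 (num.Bit1 (num.Bit0 (num.Bit0 (num.One))))" "(Suc (Suc (Suc (Suc (Suc (Suc (Suc (Suc (Suc 0)))))))))" "(Suc (Suc (Suc (Suc (Suc (Suc (Suc (Suc (Suc (Suc (Suc 0)))))))))))"], simp only: EXT_rules X_rules simp_thms good_facts)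
    (simp_all add: numeral_eq_Suc)

lemma enum2: "starts 2"
  by (rule startsI[of "(Suc (Suc 0))" "num.Bit0 (num.Bit1 (num.Bit0 (num.Bit0 (num.Bit0 (num.Bit0 (num.One))))))" "(Suc (Suc (Suc (Suc (Suc (Suc (Suc (Suc 0))))))))" "(Suc (Suc (Suc (Suc (Suc (Suc (Suc (Suc (Suc (Suc 0))))))))))"], simp only: EXT_rules X_rules simp_thms good_facts)
    (simp_all add: numeral_eq_Suc)

lemma enum3: "starts 3"
  by (rule startsI[of "(Suc (Suc (Suc 0)))" "num.Bit0 (num.Bit1 (num.Bit0 (num.Bit0 (num.Bit0 (num.Bit0 (num.Bit0 (num.Bit0 (num.One))))))))" "(Suc (Suc (Suc (Suc (Suc (Suc (Suc 0)))))))" "(Suc (Suc (Suc (Suc (Suc (Suc (Suc (Suc (Suc 0)))))))))"], simp only: EXT_rules X_rules simp_thms good_facts)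
    (simp_all add: numeral_eq_Suc)

lemma enum4: "starts 4"
  by (rule startsI[of "(Suc (Suc (Suc (Suc 0))))" "num.Bit0 (num.Bit1 (num.Bit0 (num.Bit0 (num.Bit0 (num.Bit0 (num.Bit0 (num.Bit0 (num.Bit0 (num.Bit0 (num.One))))))))))" "(Suc (Suc (Suc (Suc (Suc (Suc 0))))))" "(Suc (Suc (Suc (Suc (Suc (Suc (Suc (Suc 0))))))))"], simp only: EXT_rules X_rules simp_thms good_facts)
    (simp_all add: numeral_eq_Suc)

lemma enum5: "starts 5"
  by (rule startsI[of "(Suc (Suc (Suc (Suc (Suc 0)))))" "num.Bit0 (num.Bit1 (num.Bit0 (num.Bit0 (num.Bit0 (num.Bit0 (num.Bit0 (num.Bit0 (num.Bit0 (num.Bit0 (num.Bit0 (num.Bit0 (num.One))))))))))))" "(Suc (Suc (Suc (Suc (Suc 0)))))" "(Suc (Suc (Suc (Suc (Suc (Suc (Suc 0)))))))"], simp only: EXT_rules X_rules simp_thms good_facts)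
    (simp_all add: numeral_eq_Suc)

lemma enum6: "starts 6"
  by (rule startsI[of "(Suc (Suc (Suc (Suc (Suc (Suc 0))))))" "num.Bit0 (num.Bit1 (num.Bit0 (num.Bit0 (num.Bit0 (num.Bit0 (num.Bit0 (num.Bit0 (num.Bit0 (num.Bit0 (num.Bit0 (num.Bit0 (num.Bit0 (num.Bit0 (num.One))))))))))))))" "(Suc (Suc (Suc (Suc 0))))" "(Suc (Suc (Suc (Suc (Suc (Suc 0))))))"], simp only: EXT_rules X_rules simp_thms good_facts)
    (simp_all add: numeral_eq_Suc)

lemma enum7: "starts 7"
  by (rule startsI[of "(Suc (Suc (Suc (Suc (Suc (Suc (Suc 0)))))))" "num.Bit0 (num.Bit1 (num.Bit0 (num.Bit0 (num.Bit0 (num.Bit0 (num.Bit0 (num.Bit0 (num.Bit0 (num.Bit0 (num.Bit0 (num.Bit0 (num.Bit0 (num.Bit0 (num.Bit0 (num.Bit0 (num.One))))))))))))))))" "(Suc (Suc (Suc 0)))" "(Suc (Suc (Suc (Suc (Suc 0)))))"], simp only: EXT_rules X_rules simp_thms good_facts)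
    (simp_all add: numeral_eq_Suc)

lemma enum8: "starts 8"
  by (rule startsI[of "(Suc (Suc (Suc (Suc (Suc (Suc (Suc (Suc 0))))))))" "num.Bit0 (num.Bit1 (num.Bit0 (num.Bit0 (num.Bit0 (num.Bit0 (num.Bit0 (num.Bit0 (num.Bit0 (num.Bit0 (num.Bit0 (num.Bit0 (num.Bit0 (num.Bit0 (num.Bit0 (num.Bit0 (num.Bit0 (num.Bit0 (num.One))))))))))))))))))" "(Suc (Suc 0))" "(Suc (Suc (Suc (Suc 0))))"], simp only: EXT_rules X_rules simp_thms good_facts)
    (simp_all add: numeral_eq_Suc)

lemma enum9: "starts 9"
  by (rule startsI[of "(Suc (Suc (Suc (Suc (Suc (Suc (Suc (Suc (Suc 0)))))))))" "num.Bit0 (num.Bit1 (num.Bit0 (num.Bit0 (num.Bit0 (num.Bit0 (num.Bit0 (num.Bit0 (num.Bit0 (num.Bit0 (num.Bit0 (num.Bit0 (num.Bit0 (num.Bit0 (num.Bit0 (num.Bit0 (num.Bit0 (num.Bit0 (num.Bit0 (num.Bit0 (num.One))))))))))))))))))))" "(Suc 0)" "(Suc (Suc (Suc 0)))"], simp only: EXT_rules X_rules simp_thms good_facts)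
    (simp_all add: numeral_eq_Suc)

lemma enum10: "starts 10"
  by (rule startsI[of "(Suc (Suc (Suc (Suc (Suc (Suc (Suc (Suc (Suc (Suc 0))))))))))" "num.Bit0 (num.Bit1 (num.Bit0 (num.Bit0 (num.Bit0 (num.Bit0 (num.Bit0 (num.Bit0 (num.Bit0 (num.Bit0 (num.Bit0 (num.Bit0 (num.Bit0 (num.Bit0 (num.Bit0 (num.Bit0 (num.Bit0 (num.Bit0 (num.Bit0 (num.Bit0 (num.Bit0 (num.Bit0 (num.One))))))))))))))))))))))" "0" "(Suc (Suc 0))"], simp only: EXT_rules X_rules simp_thms good_facts)
    (simp_all add: numeral_eq_Suc)

section \<open>The classification\<close>

lemma good_if_EXT:
  assumes ext: "EXT good n k (Gt, True) n (10 - n) (12 - n)" and k: "decn k [] = replicate n (Ga, True) @ [(Gt, True)]"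
    and n: "0 < n" "n \<le> 10" and red: "reduced ((Gt, True) # u)" and nr: "no_run n u"
    and last: "fst (last ((Gt, True) # u)) = Gt" and t: "t_exp_sum u = -1" and len: "length u \<le> 11 - n"
  shows "good (replicate n (Ga, True) @ (Gt, True) # u)"
proof -
  have "vc n (Gt, True) (n - 0) (10 - n) (12 - n) u"
    \<comment> \<open>\<open>vc_if\<close> is used with run counter 0, since the prefix ends in t,
      and with remaining length 11 - n.\<close>
    by (rule vc_if[OF n(1) red _ _ _ last len]) (use nr n t in \<open>simp_all add: of_nat_diff\<close>)
  then have "good (decn k [] @ u)" using ext unfolding EXT_def by simp
  then show ?thesis by (simp add: k)
qed

text \<open>The normal form leaves words a^n t u with n between 1 and 10, which the ten search trees
  exhaust; \<open>good\<close> then returns from the normal form to \<open>r\<close>.\<close>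

lemma all_good:
  assumes cr: "cyclically_reduced r" and len: "length r \<le> 12" and t: "t_exp_sum r = 0" and np: "\<not> is_power_of_a r"
  shows "good r"
proof -
  obtain n u where n: "n > 0" and v: "variant r (replicate n (Ga, True) @ (Gt, True) # u)" and nr: "no_run n u"
    and last: "fst (last ((Gt, True) # u)) = Gt"
    using normal_variant[OF cr t np] by metis
  let ?w = "replicate n (Ga, True) @ (Gt, True) # u"
  have l: "length u + n + 1 \<le> 12" using variant_props(2)[OF v] len by simp
  have "reduced ?w" using variant_props(1)[OF v cr] by (simp add: cyclically_reduced_def)
  then have red: "reduced ((Gt, True) # u)"
  proof (induction n)
    case (Suc n)
    then show ?case using reduced_tl by (metis append_Cons replicate_Suc)
  qed simp
  have "t_exp_sum (replicate m (Ga, True) @ x) = t_exp_sum x" for m x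
    by (induction m) (simp_all add: t_exp_sum_Cons)
  then have t: "t_exp_sum u = -1" using variant_props(3)[OF v t] by (simp add: t_exp_sum_Cons)
  \<comment> \<open>The letter t after the leading run has to be compensated in \<open>u\<close>, so
    the word has at least n + 2 letters.\<close>
  have "u \<noteq> []" using t by (auto simp: t_exp_sum_def)
  then have n10: "n \<le> 10" using l by (cases u) auto
  have lu: "length u \<le> 11 - n" using l by simp
  have "n = 1 \<or> n = 2 \<or> n = 3 \<or> n = 4 \<or> n = 5 \<or> n = 6 \<or> n = 7 \<or> n = 8 \<or> n = 9 \<or> n = 10"
    using n n10 by presburger
  then have "starts n"
    using enum1 enum2 enum3 enum4 enum5 enum6 enum7 enum8 enum9 enum10 by (elim disjE) simp_all
  then obtain k where "decn k [] = replicate n (Ga, True) @ [(Gt, True)]"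
    "EXT good n k (Gt, True) n (10 - n) (12 - n)"
    unfolding starts_def by blast
  then have "good ?w" using n n10 red nr last t lu by (intro good_if_EXT)
  then show ?thesis using v by (rule good_variant[rotated])
qed

theorem theorem3p3:
  fixes r :: "gen letter list"
  assumes "cyclically_reduced r"
    and "length r \<le> 12"
    and "t_exp_sum r = 0"
    and "\<not> is_power_of_a r"
  shows "\<not> large (one_rel_group r) \<longleftrightarrow>
           ((\<exists>w \<in> set exceptional_words. equiv_word r w) \<or>
            (\<exists>p q :: int. coprime p q \<and> equiv_word r (bs_word p q)))"
proof -
  have red: "reduced r" using assms(1) by (simp add: cyclically_reduced_def)
  have "has_witness r \<or> is_exc r" using all_good[OF assms] by (simp only: good_def)
  then have "\<not> large (one_rel_group r) \<Longrightarrow> is_exc r" using large_if_has_witness[OF _ red] by blast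
  moreover have "is_exc r \<Longrightarrow> \<not> large (one_rel_group r)"
    unfolding is_exc_def using not_large_exceptional[OF red] not_large_bs[OF red] by blast
  ultimately show ?thesis unfolding is_exc_def by blast
qed

end
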